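(* Let $r\ge 1$, $m_0\ge m_1\ge\cdots\ge m_r\ge 1$, $A_0$ a real symmetric positive definite $m_0\times m_0$ matrix, and $B_k$ a real $m_{k-1}\times m_k$ matrix of rank $m_k$ for $k=1,\dots,r$. Let $A$, $B$, $E(t)=\exp(-tB^* )$, $\mathcal{C}(t)=\int_0^tE(s)AE^*(s)\,ds$ (a positive definite matrix for $t>0$) and the semigroup $(P_t)_{t\ge 0}$ on $\mathbb{R}^N=\mathbb{R}^{m_0}\times\cdots\times\mathbb{R}^{m_r}$ be the associated objects defined in the context. (i) (Logarithmic Sobolev inequality) Let $f\in C^2(\mathbb{R}^N)$ be a positive, globally Lipschitz and bounded function. Then for every $t\ge 0$, at every $x\in\mathbb{R}^N$, $$P_t(f\ln f)-(P_tf)\ln P_tf\le\frac12P_t\left(f\left\langle\int_0^tE(-(t-s))AE^*(-(t-s))\,ds\,\nabla\ln f,\nabla\ln f\right\rangle\right).$$ (ii) (Reverse logarithmic Sobolev inequality) For every $t>0$ and every positive bounded Borel measurable function $f$ on $\mathbb{R}^N$, at every $x\in\mathbb{R}^N$, $$P_t(f\ln f)-(P_tf)\ln P_tf\ge\frac12P_tf\left\langle\mathcal{C}(t)\nabla\ln P_tf,\nabla\ln P_tf\right\rangle.$$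
   Context: $N=\sum_{k=0}^rm_k$. In block form (block sizes $m_0,\dots,m_r$), $A=\begin{pmatrix}A_0&0\\0&0\end{pmatrix}$ is the $N\times N$ matrix with upper left block $A_0$ and zeros elsewhere, and $B$ is the $N\times N$ matrix whose $(k,k+1)$ block is $B_k$ for $1\le k\le r$ and all of whose other blocks are zero. $M^*$ denotes the transpose of a matrix $M$; $E^*(t)$ is the transpose of $E(t)$. $\nabla$ is the full gradient in $\mathbb{R}^N$ and $\langle\cdot,\cdot\rangle$ the Euclidean inner product. $P_t=e^{t\mathcal{L}}$ is the semigroup generated by $\mathcal{L}=\frac12\mathrm{div}(AD)+\langle x,BD\rangle$, $D=(\partial_{x_1},\dots,\partial_{x_N})$; explicitly $P_0f=f$ and, for $t>0$, $$P_tf(x)=\int_{\mathbb{R}^N}p(x-E(t)y,t)f(y)\,dy,\qquad p(x,t)=\frac{(2\pi)^{-N/2}}{\sqrt{\det\mathcal{C}(t)}}\exp\left(-\tfrac12\langle\mathcal{C}^{-1}(t)x,x\rangle\right).$$ *)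

theory Defs
  imports "Jordan_Normal_Form.DL_Rank" "HOL-Analysis.Analysis"
begin

text \<open>
  The blocks \<open>A\<^sub>0, B\<^sub>1, ..., B\<^sub>r\<close> have sizes that vary with the block index, hence they are matrices
  of type \<^typ>\<open>real mat\<close>. The ambient space is \<^typ>\<open>real ^ 'n\<close>.
\<close>

no_notation vec_index (infixl "$" 100)
no_notation scalar_prod (infix "\<bullet>" 70)
hide_const (open) Matrix.mat Matrix.vec Matrix.row Determinant.det

definition pos_def_mat :: "nat \<Rightarrow> real mat \<Rightarrow> bool" where
  "pos_def_mat n M \<longleftrightarrow> M \<in> carrier_mat n n \<and> transpose_mat M = M \<and>
     (\<forall>v \<in> carrier_vec n. v \<noteq> 0\<^sub>v n \<longrightarrow> scalar_prod v (M *\<^sub>v v) > 0)"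

text \<open>
  The identification of \<open>\<real>\<^sup>N\<close> with \<open>\<real>\<^bsup>m 0\<^esup> \<times> ... \<times> \<real>\<^bsup>m r\<^esup>\<close>: coordinate \<open>a\<close> of \<^typ>\<open>real ^ 'n\<close> is the
  entry number \<open>snd (\<iota> a)\<close> of the block number \<open>fst (\<iota> a)\<close>, counting from zero in both cases.
  In particular \<open>CARD('n) = m 0 + ... + m r\<close>.
\<close>

definition block_coordinates :: "nat \<Rightarrow> (nat \<Rightarrow> nat) \<Rightarrow> ('n::finite \<Rightarrow> nat \<times> nat) \<Rightarrow> bool" where
  "block_coordinates r m \<iota> \<longleftrightarrow> bij_betw \<iota> UNIV (SIGMA k:{0..r}. {0..<m k})"

definition diffusion_matrix :: "('n::finite \<Rightarrow> nat \<times> nat) \<Rightarrow> real mat \<Rightarrow> real ^ 'n ^ 'n" where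
  "diffusion_matrix \<iota> A0 = (\<chi> a b.
     if fst (\<iota> a) = 0 \<and> fst (\<iota> b) = 0 then A0 $$ (snd (\<iota> a), snd (\<iota> b)) else 0)"

text \<open>
  With blocks counted from zero, \<open>B\<^sub>k\<close> is the block in block row \<open>k - 1\<close> and block column \<open>k\<close>.
\<close>

definition drift_matrix :: "('n::finite \<Rightarrow> nat \<times> nat) \<Rightarrow> (nat \<Rightarrow> real mat) \<Rightarrow> real ^ 'n ^ 'n" where
  "drift_matrix \<iota> Bk = (\<chi> a b.
     if fst (\<iota> b) = fst (\<iota> a) + 1 then Bk (fst (\<iota> b)) $$ (snd (\<iota> a), snd (\<iota> b)) else 0)"

text \<open>
  On \<^typ>\<open>real ^ 'n ^ 'n\<close> the operation \<open>*\<close>, and hence \<open>^\<close>, acts entrywise, so the powers in the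
  exponential series are iterated matrix products.
\<close>

definition matrix_exp :: "real ^ 'n ^ 'n \<Rightarrow> real ^ 'n ^ 'n" where
  "matrix_exp M = (\<Sum>k. (1 / fact k) *\<^sub>R (((\<lambda>X. M ** X) ^^ k) (mat 1)))"

definition E_mat :: "real ^ 'n ^ 'n \<Rightarrow> real \<Rightarrow> real ^ 'n ^ 'n" where
  "E_mat B t = matrix_exp ((- t) *\<^sub>R transpose B)"

definition C_mat :: "real ^ 'n ^ 'n \<Rightarrow> real ^ 'n ^ 'n \<Rightarrow> real \<Rightarrow> real ^ 'n ^ 'n" where
  "C_mat A B t = integral {0..t} (\<lambda>s. E_mat B s ** A ** transpose (E_mat B s))"

definition kernel_p :: "real ^ 'n ^ 'n \<Rightarrow> real ^ 'n ^ 'n \<Rightarrow> real ^ 'n \<Rightarrow> real \<Rightarrow> real" where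
  "kernel_p A B x t =
     (2 * pi) powr (- real CARD('n) / 2) / sqrt (det (C_mat A B t)) *
     exp (- (1 / 2) * ((matrix_inv (C_mat A B t) *v x) \<bullet> x))"

definition semigroup_P ::
    "real ^ 'n ^ 'n \<Rightarrow> real ^ 'n ^ 'n \<Rightarrow> real \<Rightarrow> (real ^ 'n \<Rightarrow> real) \<Rightarrow> real ^ 'n \<Rightarrow> real" where
  "semigroup_P A B t f x =
     (if t = 0 then f x else (\<integral>y. kernel_p A B (x - E_mat B t *v y) t * f y \<partial>lborel))"

text \<open>
  The same semigroup acting on functions with values in \<open>[0, \<infinity>]\<close>. The right-hand side of the
  logarithmic Sobolev inequality is \<open>P\<^sub>t\<close> of a nonnegative function which need not be integrable
  against the kernel; the Bochner integral would then return 0 instead of \<open>\<infinity>\<close>.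
\<close>

definition semigroup_P_nn ::
    "real ^ 'n ^ 'n \<Rightarrow> real ^ 'n ^ 'n \<Rightarrow> real \<Rightarrow> (real ^ 'n \<Rightarrow> ennreal) \<Rightarrow> real ^ 'n \<Rightarrow> ennreal" where
  "semigroup_P_nn A B t g x =
     (if t = 0 then g x
      else (\<integral>\<^sup>+y. ennreal (kernel_p A B (x - E_mat B t *v y) t) * g y \<partial>lborel))"

definition grad :: "('a::real_inner \<Rightarrow> real) \<Rightarrow> 'a \<Rightarrow> 'a" where
  "grad f x = (THE D. GDERIV f x :> D)"

definition C2 :: "('a::real_normed_vector \<Rightarrow> real) \<Rightarrow> bool" where
  "C2 f \<longleftrightarrow> (\<exists>(f' :: 'a \<Rightarrow> 'a \<Rightarrow>\<^sub>L real) (f'' :: 'a \<Rightarrow> 'a \<Rightarrow>\<^sub>L ('a \<Rightarrow>\<^sub>L real)).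
     (\<forall>x. (f has_derivative blinfun_apply (f' x)) (at x)) \<and>
     (\<forall>x. (f' has_derivative blinfun_apply (f'' x)) (at x)) \<and>
     continuous_on UNIV f'')"

end

theory Submission
  imports Defs "HOL-Probability.Distributions"
begin

text \<open>
  Both inequalities are statements about the standard Gaussian measure \<open>\<gamma>\<close> in disguise. The drift is
  nilpotent and graded by the block index, so \<open>det E(t) = 1\<close>, and the rank conditions make \<open>C(t)\<close>
  positive definite. Write \<open>C(t) = S S\<^sup>*\<close> with \<open>S\<close> invertible and put \<open>T = E(-t) S\<close>. Substituting
  \<open>y = E(-t) x + T z\<close> in the kernel turns the semigroup into \<open>P\<^sub>t f(x) = \<integral> f(E(-t) x + T z) d\<gamma>(z)\<close>, and
  \<open>T T\<^sup>* = E(-t) C(t) E(-t)\<^sup>*\<close> is the matrix on the right-hand side of part (i). Thus (i) is the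
  Gaussian logarithmic Sobolev inequality for \<open>z \<mapsto> f(E(-t) x + T z)\<close>, and (ii) is the reverse
  inequality for the heat flow at time one started in \<open>z \<mapsto> f(T z)\<close>, evaluated at \<open>S\<^sup>-\<^sup>1 x\<close>.
  
  The reverse inequality is the variational principle for the entropy, tested with the exponential
  tilt \<open>exp (\<langle>\<theta>, z\<rangle> - |\<theta>|\<^sup>2/2)\<close>, which has \<open>\<gamma>\<close>-integral one; the optimal \<open>\<theta>\<close> is the logarithmic gradient
  of the heat flow (\<open>gaussian_reverse_log_sobolev\<close>).
  
  The logarithmic Sobolev inequality is obtained from infinitesimal times. Over a time \<open>\<delta>\<close> a second
  order expansion gives entropy at most \<open>\<delta>/2 |\<nabla>f|\<^sup>2/f + O(\<delta>\<^sup>3\<^sup>/\<^sup>2)\<close>, uniformly over functions with given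
  bounds and a Lipschitz-type bound on the gradient (\<open>small_time_log_sobolev\<close>). The chain rule for the
  entropy along the semigroup splits the entropy over time one into \<open>n\<close> such steps with \<open>\<delta> = 1/n\<close>, and
  \<open>|\<nabla>f|\<^sup>2/f\<close> is only decreased by averaging because \<open>(v, f) \<mapsto> |v|\<^sup>2/f\<close> is convex; the total error
  \<open>n O(n\<^sup>-\<^sup>3\<^sup>/\<^sup>2)\<close> vanishes in the limit (\<open>entropy_iterate\<close>, \<open>log_sobolev_regular_pair\<close>). A function that is merely
  continuously differentiable and Lipschitz is first bounded away from zero by adding a constant, and then
  smoothed by running the heat flow for a short time (\<open>gaussian_log_sobolev\<close>).
  
  Positive definiteness of \<open>C(t)\<close> is an observability argument: if \<open>\<langle>C(t) v, v\<rangle> = 0\<close>, then the block \<open>0\<close> of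
  \<open>exp (-s B) v\<close>, a polynomial in \<open>s\<close>, vanishes on \<open>[0, t]\<close>, hence so do the blocks \<open>0\<close> of all \<open>B\<^sup>k v\<close>, that is
  \<open>B\<^sub>1 \<dots> B\<^sub>k v\<^sub>k = 0\<close>, and full column rank forces \<open>v = 0\<close>.
\<close>

section \<open>The standard Gaussian measure\<close>

definition gaussian_density :: "'a::euclidean_space \<Rightarrow> real" where
  "gaussian_density x = (2 * pi) powr (- real DIM('a) / 2) * exp (- (x \<bullet> x) / 2)"

definition std_gaussian :: "'a::euclidean_space measure" where
  "std_gaussian = density lborel (\<lambda>x. ennreal (gaussian_density x))"

lemma gaussian_density_pos: "gaussian_density x > 0"
  by (simp add: gaussian_density_def)

lemma borel_measurable_gaussian_density [measurable]: "gaussian_density \<in> borel_measurable borel"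
  unfolding gaussian_density_def[abs_def] by measurable

lemma space_std_gaussian [simp]: "space std_gaussian = UNIV"
  by (simp add: std_gaussian_def)

lemma sets_std_gaussian [simp, measurable_cong]: "sets std_gaussian = sets borel"
  by (simp add: std_gaussian_def)

lemma gaussian_density_prod:
  "gaussian_density (x::'a::euclidean_space) = (\<Prod>b\<in>Basis. std_normal_density (x \<bullet> b))"
proof -
  have "(\<Prod>b\<in>(Basis::'a set). std_normal_density (x \<bullet> b))
     = (1 / sqrt (2 * pi)) ^ DIM('a) * exp (\<Sum>b\<in>Basis. - (x \<bullet> b)\<^sup>2 / 2)"
    by (simp add: std_normal_density_def prod.distrib exp_sum power_one_over prod_dividef)
  also have "(\<Sum>b\<in>Basis. - (x \<bullet> b)\<^sup>2 / 2) = - (x \<bullet> x) / 2"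
    by (subst euclidean_inner[of x x]) (simp add: power2_eq_square sum_negf sum_divide_distrib)
  also have "(1 / sqrt (2 * pi)) ^ DIM('a) = (2 * pi) powr (- real DIM('a) / 2)"
    by (simp add: powr_half_sqrt[symmetric] powr_realpow[symmetric] powr_powr powr_minus_divide
        powr_divide)
  finally show ?thesis by (simp add: gaussian_density_def)
qed

lemma prob_space_std_gaussian: "prob_space (std_gaussian :: 'a::euclidean_space measure)"
proof
  have "emeasure (std_gaussian :: 'a measure) (space std_gaussian)
      = (\<integral>\<^sup>+x. (\<Prod>b\<in>Basis. ennreal (std_normal_density (x \<bullet> b))) \<partial>(lborel :: 'a measure))"
    by (simp add: std_gaussian_def emeasure_density gaussian_density_prod prod_ennreal)
  also have "\<dots> = (\<Prod>b\<in>(Basis::'a set). (\<integral>\<^sup>+x. ennreal (std_normal_density x) \<partial>lborel))"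
    by (rule nn_integral_lborel_prod) auto
  also have "(\<integral>\<^sup>+x. ennreal (std_normal_density x) \<partial>lborel) = 1"
    using prob_space.emeasure_space_1[OF prob_space_normal_density[of 1 0]]
    by (simp add: emeasure_density)
  finally show "emeasure (std_gaussian :: 'a measure) (space std_gaussian) = 1" by simp
qed

interpretation std_gaussian: prob_space "std_gaussian :: 'a::euclidean_space measure"
  by (rule prob_space_std_gaussian)

lemma emeasure_std_gaussian_UNIV [simp]: "emeasure (std_gaussian :: 'a::euclidean_space measure) UNIV = 1"
  using std_gaussian.emeasure_space_1[where 'a='a] by simp

lemma measure_std_gaussian_UNIV [simp]: "measure (std_gaussian :: 'a::euclidean_space measure) UNIV = 1"
  by (simp add: measure_def)

lemma nn_integral_std_gaussian:
  fixes f :: "'a::euclidean_space \<Rightarrow> ennreal"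
  assumes [measurable]: "f \<in> borel_measurable borel"
  shows "(\<integral>\<^sup>+x. f x \<partial>std_gaussian) = (\<integral>\<^sup>+x. ennreal (gaussian_density x) * f x \<partial>lborel)"
  unfolding std_gaussian_def by (subst nn_integral_density) auto

text \<open>
  Translating the density is the same as tilting it by an exponential. This is the source of the
  exponential moments and of every derivative of the heat flow below.
\<close>

lemma gaussian_density_shift:
  "gaussian_density (z - h) = gaussian_density z * exp (z \<bullet> h - (h \<bullet> h) / 2)"
proof -
  have "- ((z - h) \<bullet> (z - h)) / 2 = - (z \<bullet> z) / 2 + (z \<bullet> h - (h \<bullet> h) / 2)"
    by (simp add: inner_diff inner_commute field_simps)
  then show ?thesis by (simp add: gaussian_density_def exp_add[symmetric])
qed

lemma nn_integral_lborel_affine: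
  fixes f :: "'a::euclidean_space \<Rightarrow> ennreal"
  assumes [measurable]: "f \<in> borel_measurable borel" and c: "c \<noteq> 0"
  shows "(\<integral>\<^sup>+x. f x \<partial>lborel) = ennreal (\<bar>c\<bar> ^ DIM('a)) * (\<integral>\<^sup>+x. f (t + c *\<^sub>R x) \<partial>lborel)"
proof -
  have "(\<integral>\<^sup>+x. f x \<partial>lborel) = (\<integral>\<^sup>+x. f x
      \<partial>(density (distr lborel borel (\<lambda>x. t + c *\<^sub>R x)) (\<lambda>_. ennreal (\<bar>c\<bar> ^ DIM('a)))))"
    by (subst lborel_affine[OF c, of t]) simp
  also have "\<dots> = ennreal (\<bar>c\<bar> ^ DIM('a)) * (\<integral>\<^sup>+x. f (t + c *\<^sub>R x) \<partial>lborel)"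
    by (subst nn_integral_density) (auto simp: nn_integral_distr nn_integral_cmult)
  finally show ?thesis .
qed

lemma nn_integral_std_gaussian_shift:
  fixes f :: "'a::euclidean_space \<Rightarrow> ennreal"
  assumes [measurable]: "f \<in> borel_measurable borel"
  shows "(\<integral>\<^sup>+z. f (h + z) \<partial>std_gaussian)
       = (\<integral>\<^sup>+z. ennreal (exp (z \<bullet> h - (h \<bullet> h) / 2)) * f z \<partial>std_gaussian)"
proof -
  have "(\<integral>\<^sup>+z. ennreal (exp (z \<bullet> h - (h \<bullet> h) / 2)) * f z \<partial>std_gaussian)
      = (\<integral>\<^sup>+z. ennreal (gaussian_density (z - h)) * f z \<partial>lborel)"
    by (subst nn_integral_std_gaussian)
       (auto simp: gaussian_density_shift ennreal_mult' mult.assoc[symmetric]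
         gaussian_density_pos less_imp_le ennreal_mult)
  also have "\<dots> = (\<integral>\<^sup>+z. ennreal (gaussian_density z) * f (h + z) \<partial>lborel)"
    by (subst nn_integral_lborel_affine[where c=1 and t=h]) auto
  also have "\<dots> = (\<integral>\<^sup>+z. f (h + z) \<partial>std_gaussian)"
    by (subst nn_integral_std_gaussian) auto
  finally show ?thesis by simp
qed

lemma distr_std_gaussian_shift:
  "distr std_gaussian borel (\<lambda>z. h + z)
     = density std_gaussian (\<lambda>z. ennreal (exp (z \<bullet> h - (h \<bullet> h) / 2)))"
proof (rule measure_eqI)
  fix A assume "A \<in> sets (distr std_gaussian borel (\<lambda>z. h + z))"
  then have [measurable]: "A \<in> sets borel" by simp
  show "emeasure (distr std_gaussian borel (\<lambda>z. h + z)) A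
      = emeasure (density std_gaussian (\<lambda>z. ennreal (exp (z \<bullet> h - (h \<bullet> h) / 2)))) A"
    using nn_integral_std_gaussian_shift[of "indicator A" h]
    by (simp add: nn_integral_distr[symmetric] emeasure_density del: nn_integral_indicator)
       (simp add: nn_integral_distr[symmetric, where f="indicator A" and M=std_gaussian and M'=borel and T="\<lambda>z. h + z"])
qed simp

lemma integral_std_gaussian_shift:
  fixes f :: "'a::euclidean_space \<Rightarrow> real"
  assumes [measurable]: "f \<in> borel_measurable borel"
  shows "(\<integral>z. f (h + z) \<partial>std_gaussian)
       = (\<integral>z. exp (z \<bullet> h - (h \<bullet> h) / 2) * f z \<partial>std_gaussian)"
proof -
  have "(\<integral>z. f (h + z) \<partial>std_gaussian) = (\<integral>z. f z \<partial>(distr std_gaussian borel (\<lambda>z. h + z)))"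
    by (subst integral_distr) auto
  then show ?thesis
    unfolding distr_std_gaussian_shift by (subst (asm) integral_density) auto
qed

lemma std_gaussian_exp_inner:
  fixes h :: "'a::euclidean_space"
  shows
  "integrable std_gaussian (\<lambda>z. exp (z \<bullet> h))"
  "(\<integral>z. exp (z \<bullet> h) \<partial>std_gaussian) = exp ((h \<bullet> h) / 2)"
proof -
  have "(\<integral>\<^sup>+z. ennreal (exp (z \<bullet> h - (h \<bullet> h) / 2)) \<partial>std_gaussian) = 1"
    using nn_integral_std_gaussian_shift[of "\<lambda>_. 1" h] std_gaussian.emeasure_space_1[where 'a='a] by simp
  then have *: "has_bochner_integral std_gaussian (\<lambda>z. exp (z \<bullet> h - (h \<bullet> h) / 2)) 1"
    by (intro has_bochner_integral_nn_integral) auto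
  have "has_bochner_integral std_gaussian
      (\<lambda>z. exp ((h \<bullet> h) / 2) * exp (z \<bullet> h - (h \<bullet> h) / 2)) (exp ((h \<bullet> h) / 2) * 1)"
    by (intro has_bochner_integral_mult_right *)
  then have **: "has_bochner_integral std_gaussian (\<lambda>z. exp (z \<bullet> h)) (exp ((h \<bullet> h) / 2))"
    by (simp add: exp_add[symmetric])
  show "integrable std_gaussian (\<lambda>z. exp (z \<bullet> h))"
    "(\<integral>z. exp (z \<bullet> h) \<partial>std_gaussian) = exp ((h \<bullet> h) / 2)"
    using ** by (auto simp: has_bochner_integral_iff)
qed

text \<open>
  The largest coordinate of \<open>z\<close> is at least \<open>norm z\<close> divided by the dimension, so exponentials of
  linear functionals, whose Gaussian integrals are explicit, dominate exponentials of the norm.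
\<close>

lemma exp_norm_le_sum_exp_inner:
  fixes z :: "'a::euclidean_space"
  assumes "c \<ge> 0"
  shows "exp (c * norm z) \<le> (\<Sum>b\<in>Basis. exp (z \<bullet> ((c * DIM('a)) *\<^sub>R b)) + exp (z \<bullet> (- (c * DIM('a)) *\<^sub>R b)))"
proof -
  have "\<exists>b\<in>Basis. norm z \<le> DIM('a) * \<bar>z \<bullet> b\<bar>"
  proof (rule ccontr)
    assume "\<not> ?thesis"
    then have "(\<Sum>b\<in>(Basis::'a set). DIM('a) * \<bar>z \<bullet> b\<bar>) < (\<Sum>b\<in>(Basis::'a set). norm z)"
      by (intro sum_strict_mono) (auto simp: not_le)
    then have "DIM('a) * (\<Sum>b\<in>(Basis::'a set). \<bar>z \<bullet> b\<bar>) < DIM('a) * norm z"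
      by (simp add: sum_distrib_left)
    then show False using norm_le_l1[of z] by (simp add: mult_less_cancel_left)
  qed
  then obtain b where b: "b \<in> Basis" "norm z \<le> DIM('a) * \<bar>z \<bullet> b\<bar>" by blast
  have "exp (c * norm z) \<le> exp (c * (DIM('a) * \<bar>z \<bullet> b\<bar>))"
    using b assms by (simp add: mult_left_mono)
  also have "\<dots> \<le> exp (z \<bullet> ((c * DIM('a)) *\<^sub>R b)) + exp (z \<bullet> (- (c * DIM('a)) *\<^sub>R b))"
    by (cases "z \<bullet> b \<ge> 0") (auto simp: abs_if algebra_simps intro: add_increasing add_increasing2)
  also have "\<dots> \<le> (\<Sum>b\<in>Basis. exp (z \<bullet> ((c * DIM('a)) *\<^sub>R b)) + exp (z \<bullet> (- (c * DIM('a)) *\<^sub>R b)))"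
    using b by (intro member_le_sum) auto
  finally show ?thesis .
qed

lemma power_le_fact_exp:
  fixes x :: real
  assumes "x \<ge> 0"
  shows "x ^ k \<le> fact k * exp x"
proof -
  have "(\<Sum>i\<in>{k}. x ^ i /\<^sub>R fact i) \<le> (\<Sum>i. x ^ i /\<^sub>R fact i)"
    using assms by (intro sum_le_suminf sums_summable[OF exp_converges]) auto
  also have "\<dots> = exp x" by (rule sums_unique[OF exp_converges, symmetric])
  finally show ?thesis by (simp add: field_simps)
qed

text \<open>
  The integrability statement behind all dominations below, where the integrands are polynomials
  times exponentials of the norm.
\<close>

lemma integrable_std_gaussian_exp_norm:
  "integrable (std_gaussian :: 'a::euclidean_space measure) (\<lambda>z. norm z ^ k * exp (c * norm z))"
proof -
  \<comment> \<open>the extra one absorbs the power of the norm, which is at most a multiple of \<open>exp (norm z)\<close>\<close>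
  define d where "d = max c 0 + 1"
  have d: "d \<ge> 0" "d \<ge> c + 1" by (auto simp: d_def)
  show ?thesis
  proof (rule Bochner_Integration.integrable_bound)
    show "integrable (std_gaussian :: 'a measure)
      (\<lambda>z. fact k * (\<Sum>b\<in>Basis. exp (z \<bullet> ((d * DIM('a)) *\<^sub>R b)) + exp (z \<bullet> (- (d * DIM('a)) *\<^sub>R b))))"
      by (intro integrable_mult_right Bochner_Integration.integrable_sum
          Bochner_Integration.integrable_add std_gaussian_exp_inner)
    show "(\<lambda>z. norm z ^ k * exp (c * norm z)) \<in> borel_measurable std_gaussian" by measurable
    show "AE z in (std_gaussian :: 'a measure). norm (norm z ^ k * exp (c * norm z))
       \<le> norm (fact k * (\<Sum>b\<in>Basis. exp (z \<bullet> ((d * DIM('a)) *\<^sub>R b)) + exp (z \<bullet> (- (d * DIM('a)) *\<^sub>R b))))"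
    proof (rule AE_I2)
      fix z :: 'a
      have "norm z ^ k * exp (c * norm z) \<le> fact k * exp (norm z) * exp (c * norm z)"
        by (intro mult_right_mono power_le_fact_exp) auto
      then have "norm z ^ k * exp (c * norm z) \<le> fact k * (exp (norm z) * exp (c * norm z))"
        by (simp add: mult.assoc)
      also have "exp (norm z) * exp (c * norm z) = exp ((c + 1) * norm z)"
        by (simp add: exp_add[symmetric] algebra_simps)
      also have "\<dots> \<le> exp (d * norm z)" using d by (simp add: mult_right_mono)
      also note exp_norm_le_sum_exp_inner[OF d(1)]
      finally show "norm (norm z ^ k * exp (c * norm z))
         \<le> norm (fact k * (\<Sum>b\<in>Basis. exp (z \<bullet> ((d * DIM('a)) *\<^sub>R b)) + exp (z \<bullet> (- (d * DIM('a)) *\<^sub>R b))))"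
        by (simp add: sum_nonneg)
    qed
  qed
qed

section \<open>The heat semigroup\<close>

text \<open>
  Completing the square for \<open>a\<^sup>2 + b\<^sup>2 = 1\<close>: if \<open>u = a z + b w\<close>, then the joint density of \<open>(z, w)\<close> is also
  the joint density of \<open>u\<close> and \<open>(z - a u) / b\<close>. Integrating out the second variable gives rotation
  invariance without Fourier analysis.
\<close>

lemma gaussian_density_rotate:
  fixes z u :: "'a::euclidean_space"
  assumes "a\<^sup>2 + b\<^sup>2 = 1" "b \<noteq> 0"
  shows "gaussian_density z * gaussian_density ((1 / b) *\<^sub>R (u - a *\<^sub>R z))
       = gaussian_density u * gaussian_density ((1 / b) *\<^sub>R (z - a *\<^sub>R u))"
proof -
  have sq: "((1 / b) *\<^sub>R (p - a *\<^sub>R q)) \<bullet> ((1 / b) *\<^sub>R (p - a *\<^sub>R q))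
    = (p \<bullet> p - 2 * a * (p \<bullet> q) + a\<^sup>2 * (q \<bullet> q)) / b\<^sup>2" for p q :: 'a
    by (simp add: inner_diff inner_commute power2_eq_square add_divide_distrib diff_divide_distrib)
  have half: "- p / 2 + - q / 2 = - r / 2 + - s / 2" if "p + q = r + s" for p q r s :: real
    using that by (simp add: field_simps)
  have "b\<^sup>2 = 1 - a\<^sup>2" using assms by simp
  have "b\<^sup>2 * (z \<bullet> z) + (u \<bullet> u - 2 * a * (u \<bullet> z) + a\<^sup>2 * (z \<bullet> z))
     = b\<^sup>2 * (u \<bullet> u) + (z \<bullet> z - 2 * a * (z \<bullet> u) + a\<^sup>2 * (u \<bullet> u))"
    unfolding \<open>b\<^sup>2 = 1 - a\<^sup>2\<close> by (simp add: inner_commute algebra_simps)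
  then have "z \<bullet> z + (u \<bullet> u - 2 * a * (u \<bullet> z) + a\<^sup>2 * (z \<bullet> z)) / b\<^sup>2
     = u \<bullet> u + (z \<bullet> z - 2 * a * (z \<bullet> u) + a\<^sup>2 * (u \<bullet> u)) / b\<^sup>2"
    using assms(2) by (simp add: field_simps)
  then have *: "- (z \<bullet> z) / 2 + - ((u \<bullet> u - 2 * a * (u \<bullet> z) + a\<^sup>2 * (z \<bullet> z)) / b\<^sup>2) / 2
     = - (u \<bullet> u) / 2 + - ((z \<bullet> z - 2 * a * (z \<bullet> u) + a\<^sup>2 * (u \<bullet> u)) / b\<^sup>2) / 2"
    by (rule half)
  have e: "(c * exp p) * (c * exp q) = c * c * exp (p + q)" for c p q :: real
    by (simp add: exp_add)
  show ?thesis
    unfolding gaussian_density_def sq e * ..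
qed

lemma nn_integral_std_gaussian_rotate:
  fixes f :: "'a::euclidean_space \<Rightarrow> ennreal"
  assumes [measurable]: "f \<in> borel_measurable borel" and ab: "a\<^sup>2 + b\<^sup>2 = 1" "b \<noteq> 0"
  shows "(\<integral>\<^sup>+z. \<integral>\<^sup>+w. f (a *\<^sub>R z + b *\<^sub>R w) \<partial>std_gaussian \<partial>std_gaussian) = (\<integral>\<^sup>+u. f u \<partial>std_gaussian)"
proof -
  let ?\<phi> = "\<lambda>x::'a. ennreal (gaussian_density x)"
  let ?c = "ennreal (\<bar>b\<bar> ^ DIM('a))"
  let ?s = "\<lambda>p q::'a. (1 / b) *\<^sub>R (p - a *\<^sub>R q)"
  have c0: "?c \<noteq> 0" "?c \<noteq> \<infinity>" using ab by auto
  have inner1: "?c * (\<integral>\<^sup>+w. f (a *\<^sub>R z + b *\<^sub>R w) \<partial>std_gaussian) = (\<integral>\<^sup>+u. ?\<phi> (?s u z) * f u \<partial>lborel)" for z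
    using ab by (subst nn_integral_lborel_affine[where c=b and t="a *\<^sub>R z"]) (auto simp: nn_integral_std_gaussian)
  have inner2: "(\<integral>\<^sup>+z. ?\<phi> (?s z u) \<partial>lborel) = ?c" for u
    using ab std_gaussian.emeasure_space_1[where 'a='a]
    by (subst nn_integral_lborel_affine[where c=b and t="a *\<^sub>R u"]) (auto simp: std_gaussian_def emeasure_density)
  have "?c * (\<integral>\<^sup>+z. \<integral>\<^sup>+w. f (a *\<^sub>R z + b *\<^sub>R w) \<partial>std_gaussian \<partial>std_gaussian)
      = (\<integral>\<^sup>+z. ?c * (\<integral>\<^sup>+w. f (a *\<^sub>R z + b *\<^sub>R w) \<partial>std_gaussian) \<partial>std_gaussian)"
    by (subst nn_integral_cmult) auto
  also have "\<dots> = (\<integral>\<^sup>+z. ?\<phi> z * (\<integral>\<^sup>+u. ?\<phi> (?s u z) * f u \<partial>lborel) \<partial>lborel)"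
    unfolding inner1 by (subst nn_integral_std_gaussian) auto
  also have "\<dots> = (\<integral>\<^sup>+z. (\<integral>\<^sup>+u. ?\<phi> z * (?\<phi> (?s u z) * f u) \<partial>lborel) \<partial>lborel)"
    by (subst nn_integral_cmult) auto
  also have "\<dots> = (\<integral>\<^sup>+u. (\<integral>\<^sup>+z. ?\<phi> z * (?\<phi> (?s u z) * f u) \<partial>lborel) \<partial>lborel)"
    by (rule lborel_pair.Fubini') measurable
  also have "\<dots> = (\<integral>\<^sup>+u. (\<integral>\<^sup>+z. ?\<phi> u * f u * ?\<phi> (?s z u) \<partial>lborel) \<partial>lborel)"
  proof (intro nn_integral_cong)
    fix u z :: 'a
    have "?\<phi> z * ?\<phi> (?s u z) = ?\<phi> u * ?\<phi> (?s z u)"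
      using gaussian_density_rotate[OF ab, of z u]
      by (simp add: ennreal_mult[symmetric] less_imp_le[OF gaussian_density_pos])
    then show "?\<phi> z * (?\<phi> (?s u z) * f u) = ?\<phi> u * f u * ?\<phi> (?s z u)"
      by (simp add: mult.assoc[symmetric]) (simp add: ac_simps)
  qed
  also have "\<dots> = (\<integral>\<^sup>+u. ?\<phi> u * f u * ?c \<partial>lborel)"
    by (subst nn_integral_cmult) (auto simp: inner2)
  also have "\<dots> = ?c * (\<integral>\<^sup>+u. f u \<partial>std_gaussian)"
    by (subst nn_integral_multc) (auto simp: nn_integral_std_gaussian mult.commute)
  finally show ?thesis using c0 by (simp add: ennreal_mult_cancel_left)
qed

lemma distr_std_gaussian_rotate:
  assumes ab: "a\<^sup>2 + b\<^sup>2 = 1" "b \<noteq> 0"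
  shows "distr (std_gaussian \<Otimes>\<^sub>M std_gaussian) borel (\<lambda>(z, w). a *\<^sub>R z + b *\<^sub>R w)
     = (std_gaussian :: 'a::euclidean_space measure)"
proof (rule measure_eqI)
  fix A :: "'a set" assume "A \<in> sets (distr (std_gaussian \<Otimes>\<^sub>M std_gaussian) borel (\<lambda>(z, w). a *\<^sub>R z + b *\<^sub>R w))"
  then have [measurable]: "A \<in> sets borel" by simp
  have "emeasure (distr (std_gaussian \<Otimes>\<^sub>M std_gaussian) borel (\<lambda>(z, w). a *\<^sub>R z + b *\<^sub>R w)) A
     = (\<integral>\<^sup>+x. indicator A x \<partial>(distr (std_gaussian \<Otimes>\<^sub>M std_gaussian) borel (\<lambda>(z, w). a *\<^sub>R z + b *\<^sub>R w)))"
    by simp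
  also have "\<dots> = (\<integral>\<^sup>+p. indicator A (case p of (z, w) \<Rightarrow> a *\<^sub>R z + b *\<^sub>R w) \<partial>(std_gaussian \<Otimes>\<^sub>M std_gaussian))"
    by (subst nn_integral_distr) auto
  also have "\<dots> = (\<integral>\<^sup>+z. \<integral>\<^sup>+w. indicator A (a *\<^sub>R z + b *\<^sub>R w) \<partial>std_gaussian \<partial>std_gaussian)"
    by (subst std_gaussian.nn_integral_fst[symmetric]) auto
  also have "\<dots> = emeasure std_gaussian A"
    by (subst nn_integral_std_gaussian_rotate[OF _ ab]) auto
  finally show "emeasure (distr (std_gaussian \<Otimes>\<^sub>M std_gaussian) borel (\<lambda>(z, w). a *\<^sub>R z + b *\<^sub>R w)) A
     = emeasure std_gaussian A" .
qed simp

text \<open>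
  This is \<open>exp (t \<Delta> / 2)\<close>, written with a fixed Gaussian measure so that the dependence on \<open>t\<close> and \<open>x\<close>
  sits in the integrand. Values in a Banach space are allowed because the flow is also applied to
  gradient fields.
\<close>

definition heat :: "real \<Rightarrow> ('a::euclidean_space \<Rightarrow> 'b::{banach, second_countable_topology}) \<Rightarrow> 'a \<Rightarrow> 'b" where
  "heat t f x = (\<integral>z. f (x + sqrt t *\<^sub>R z) \<partial>std_gaussian)"

lemma heat_0 [simp]: "heat 0 f = f"
  by (simp add: heat_def fun_eq_iff)

lemma integrable_std_gaussian_bounded:
  fixes f :: "'a::euclidean_space \<Rightarrow> 'b::{banach, second_countable_topology}"
  assumes [measurable]: "f \<in> borel_measurable borel" and "\<And>z. norm (f z) \<le> M"
  shows "integrable std_gaussian (\<lambda>z. f (x + c *\<^sub>R z))"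
  by (rule std_gaussian.integrable_const_bound[where B=M]) (use assms in auto)

lemma borel_measurable_heat [measurable]:
  fixes f :: "'a::euclidean_space \<Rightarrow> 'b::{banach, second_countable_topology}"
  assumes [measurable]: "f \<in> borel_measurable borel"
  shows "heat t f \<in> borel_measurable borel"
  unfolding heat_def[abs_def]
  by (rule std_gaussian.borel_measurable_lebesgue_integral) measurable

lemma norm_heat_le:
  fixes f :: "'a::euclidean_space \<Rightarrow> 'b::{banach, second_countable_topology}"
  assumes "\<And>z. norm (f z) \<le> M"
  shows "norm (heat t f x) \<le> M"
proof -
  have M: "0 \<le> M" using assms norm_ge_zero order_trans by blast
  have "norm (heat t f x) \<le> (\<integral>z. norm (f (x + sqrt t *\<^sub>R z)) \<partial>std_gaussian)"
    unfolding heat_def by (rule integral_norm_bound)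
  also have "\<dots> \<le> (\<integral>z. M \<partial>(std_gaussian :: 'a measure))"
    by (intro integral_mono_AE') (use assms M in auto)
  finally show ?thesis using std_gaussian.prob_space[where 'a='a] by simp
qed

lemma heat_mono:
  fixes f g :: "'a::euclidean_space \<Rightarrow> real"
  assumes "f \<in> borel_measurable borel" "\<And>z. norm (f z) \<le> M"
    "g \<in> borel_measurable borel" "\<And>z. norm (g z) \<le> N" "\<And>z. f z \<le> g z"
  shows "heat t f x \<le> heat t g x"
  unfolding heat_def
  by (intro integral_mono integrable_std_gaussian_bounded[of _ M] integrable_std_gaussian_bounded[of _ N] assms)

lemma heat_const [simp]: "heat t (\<lambda>_. c) x = c"
  by (simp add: heat_def)

lemma heat_add:
  fixes f g :: "'a::euclidean_space \<Rightarrow> 'b::{banach, second_countable_topology}"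
  assumes "f \<in> borel_measurable borel" "\<And>z. norm (f z) \<le> M"
    "g \<in> borel_measurable borel" "\<And>z. norm (g z) \<le> N"
  shows "heat t (\<lambda>y. f y + g y) x = heat t f x + heat t g x"
  unfolding heat_def
  by (intro Bochner_Integration.integral_add integrable_std_gaussian_bounded[of _ M] integrable_std_gaussian_bounded[of _ N] assms)

text \<open>
  The semigroup law: with weights \<open>sqrt s\<close> and \<open>sqrt t\<close> normalised by \<open>sqrt (s + t)\<close>, it is rotation
  invariance of the Gaussian measure.
\<close>

lemma heat_heat:
  fixes f :: "'a::euclidean_space \<Rightarrow> 'b::{banach, second_countable_topology}"
  assumes [measurable]: "f \<in> borel_measurable borel" and bd: "\<And>z. norm (f z) \<le> M"
    and st: "s \<ge> 0" "t \<ge> 0"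
  shows "heat s (heat t f) = heat (s + t) f"
proof (cases "t = 0")
  case False
  with st have pos: "s + t > 0" by linarith
  define a b where "a = sqrt s / sqrt (s + t)" and "b = sqrt t / sqrt (s + t)"
  have ab: "a\<^sup>2 + b\<^sup>2 = 1" "b \<noteq> 0"
    using pos st False by (auto simp: a_def b_def power_divide add_divide_distrib[symmetric])
  have sab: "sqrt (s + t) * a = sqrt s" "sqrt (s + t) * b = sqrt t"
    using pos by (auto simp: a_def b_def)
  interpret P: pair_prob_space "std_gaussian :: 'a measure" "std_gaussian :: 'a measure" ..
  show ?thesis
  proof
    fix x
    have "heat (s + t) f x = (\<integral>u. f (x + sqrt (s + t) *\<^sub>R u)
        \<partial>(distr (std_gaussian \<Otimes>\<^sub>M std_gaussian) borel (\<lambda>(z, w). a *\<^sub>R z + b *\<^sub>R w)))"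
      by (simp add: heat_def distr_std_gaussian_rotate[OF ab])
    also have "\<dots> = (\<integral>p. f (x + sqrt (s + t) *\<^sub>R (case p of (z, w) \<Rightarrow> a *\<^sub>R z + b *\<^sub>R w))
        \<partial>(std_gaussian \<Otimes>\<^sub>M std_gaussian))"
      by (subst integral_distr) auto
    also have "\<dots> = (\<integral>p. f (x + sqrt s *\<^sub>R fst p + sqrt t *\<^sub>R snd p) \<partial>(std_gaussian \<Otimes>\<^sub>M std_gaussian))"
      by (simp add: case_prod_beta scaleR_add_right sab add.assoc)
    also have "\<dots> = (\<integral>z. \<integral>w. f (x + sqrt s *\<^sub>R z + sqrt t *\<^sub>R w) \<partial>std_gaussian \<partial>std_gaussian)"
      by (subst P.integral_fst'[symmetric])
         (auto intro!: P.integrable_const_bound[where B=M] bd)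
    finally show "heat s (heat t f) x = heat (s + t) f x" by (simp add: heat_def)
  qed
qed simp

lemma tendsto_heat:
  fixes f :: "'a::euclidean_space \<Rightarrow> 'b::{banach, second_countable_topology}"
  assumes f: "continuous_on UNIV f" and bd: "\<And>z. norm (f z) \<le> M"
    and s: "(\<lambda>n. s n) \<longlonglongrightarrow> t" and x: "(\<lambda>n. x n) \<longlonglongrightarrow> y"
  shows "(\<lambda>n. heat (s n) f (x n)) \<longlonglongrightarrow> heat t f y"
  unfolding heat_def
proof (rule integral_dominated_convergence[where w="\<lambda>_. M"])
  have [measurable]: "f \<in> borel_measurable borel" using f by (rule borel_measurable_continuous_onI)
  show "(\<lambda>z. f (y + sqrt t *\<^sub>R z)) \<in> borel_measurable std_gaussian" by measurable
  show "\<And>n. (\<lambda>z. f (x n + sqrt (s n) *\<^sub>R z)) \<in> borel_measurable std_gaussian" by measurable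
  show "AE z in std_gaussian. (\<lambda>n. f (x n + sqrt (s n) *\<^sub>R z)) \<longlonglongrightarrow> f (y + sqrt t *\<^sub>R z)"
  proof (rule AE_I2)
    fix z
    have "isCont f (y + sqrt t *\<^sub>R z)" using f by (simp add: continuous_on_eq_continuous_at)
    moreover have "(\<lambda>n. x n + sqrt (s n) *\<^sub>R z) \<longlonglongrightarrow> y + sqrt t *\<^sub>R z"
      by (intro tendsto_intros s x)
    ultimately show "(\<lambda>n. f (x n + sqrt (s n) *\<^sub>R z)) \<longlonglongrightarrow> f (y + sqrt t *\<^sub>R z)"
      by (rule isCont_tendsto_compose)
  qed
qed (use bd in auto)

lemma continuous_on_heat:
  fixes f :: "'a::euclidean_space \<Rightarrow> 'b::{banach, second_countable_topology}"
  assumes f: "continuous_on UNIV f" and bd: "\<And>z. norm (f z) \<le> M"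
  shows "continuous_on UNIV (heat t f)"
  unfolding continuous_on_sequentially
  using tendsto_heat[OF f bd tendsto_const] by (auto simp: comp_def)

text \<open>
  The bound follows from the exponential moments: compare \<open>u\<^sup>2 + 2\<close> with \<open>exp u + exp (-u)\<close> for
  \<open>u = sqrt s \<langle>v, z\<rangle>\<close>, and let \<open>s\<close> tend to zero.
\<close>

lemma std_gaussian_second_moment:
  "integrable std_gaussian (\<lambda>z. (v \<bullet> z)\<^sup>2)"
  "(\<integral>z. (v \<bullet> z)\<^sup>2 \<partial>std_gaussian) \<le> v \<bullet> (v::'a::euclidean_space)"
proof -
  show int: "integrable std_gaussian (\<lambda>z. (v \<bullet> z)\<^sup>2)"
  proof (rule Bochner_Integration.integrable_bound)
    show "integrable (std_gaussian::'a measure) (\<lambda>z. (norm v)\<^sup>2 * (norm z ^ 2 * exp (0 * norm z)))"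
      by (intro integrable_mult_right integrable_std_gaussian_exp_norm)
    show "AE z in std_gaussian. norm ((v \<bullet> z)\<^sup>2) \<le> norm ((norm v)\<^sup>2 * (norm z ^ 2 * exp (0 * norm z)))"
      using Cauchy_Schwarz_ineq2 by (auto intro!: AE_I2 simp flip: power_mult_distrib intro!: power_mono abs_le_square_iff[THEN iffD1])
  qed auto
  have *: "(\<integral>z. (v \<bullet> z)\<^sup>2 \<partial>std_gaussian) \<le> (2 * exp (s * ((v \<bullet> v) / 2)) - 2) / s" if s: "s > 0" for s
  proof -
    let ?a = "sqrt s *\<^sub>R v"
    have "s * (\<integral>z. (v \<bullet> z)\<^sup>2 \<partial>std_gaussian) = (\<integral>z. s * (v \<bullet> z)\<^sup>2 \<partial>std_gaussian)"
      using int by simp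
    also have "\<dots> \<le> (\<integral>z. exp (z \<bullet> ?a) + exp (z \<bullet> - ?a) - 2 \<partial>std_gaussian)"
    proof (intro integral_mono Bochner_Integration.integrable_diff Bochner_Integration.integrable_add std_gaussian_exp_inner)
      fix z :: 'a
      have "u\<^sup>2 + 2 \<le> exp u + exp (- u)" for u :: real
      proof -
        have "(\<Sum>i\<in>{0, 2}. if even i then u ^ i /\<^sub>R fact i else 0)
          \<le> (\<Sum>i. if even i then u ^ i /\<^sub>R fact i else 0)"
          by (intro sum_le_suminf sums_summable[OF cosh_converges]) (auto elim: evenE)
        also have "\<dots> = cosh u" by (rule sums_unique[OF cosh_converges, symmetric])
        finally show ?thesis by (simp add: cosh_field_def field_simps)
      qed
      from this[of "z \<bullet> ?a"]
      show "s * (v \<bullet> z)\<^sup>2 \<le> exp (z \<bullet> ?a) + exp (z \<bullet> - ?a) - 2"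
        using s by (simp add: power_mult_distrib inner_commute)
    qed (use int in auto)
    also have "\<dots> = 2 * exp (s * ((v \<bullet> v) / 2)) - 2"
      using s std_gaussian.prob_space[where 'a='a]
      by (simp add: std_gaussian_exp_inner[of ?a] std_gaussian_exp_inner[of "-?a"] del: inner_scaleR_right inner_minus_right)
         simp
    finally show ?thesis using s by (simp add: field_simps)
  qed
  have "((\<lambda>s. 2 * exp (s * ((v \<bullet> v) / 2)) - 2) has_real_derivative (v \<bullet> v)) (at 0)"
    by (auto intro!: derivative_eq_intros)
  then have "((\<lambda>s. (2 * exp (s * ((v \<bullet> v) / 2)) - 2) / s) \<longlongrightarrow> v \<bullet> v) (at_right 0)"
    by (auto simp: DERIV_def intro: filterlim_at_split[THEN iffD1, THEN conjunct2])
  then show "(\<integral>z. (v \<bullet> z)\<^sup>2 \<partial>std_gaussian) \<le> v \<bullet> v"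
    by (rule tendsto_lowerbound) (use * in \<open>auto simp: eventually_at_filter intro!: always_eventually\<close>)
qed

section \<open>Gradients and Gaussian smoothing\<close>

text \<open>
  A uniform first-order expansion with quadratic remainder. It is the only form in which second
  derivatives enter, and unlike differentiability it is visibly stable under averaging translates.
\<close>

definition quadratic_approx :: "('a::euclidean_space \<Rightarrow> real) \<Rightarrow> ('a \<Rightarrow> 'a) \<Rightarrow> real \<Rightarrow> bool" where
  "quadratic_approx f v K \<longleftrightarrow> (\<forall>y h. \<bar>f (y + h) - f y - v y \<bullet> h\<bar> \<le> K * (h \<bullet> h))"

lemma quadratic_approx_GDERIV:
  assumes "quadratic_approx f v K"
  shows "GDERIV f y :> v y"
proof -
  have bd: "\<bar>f (y + h) - f y - v y \<bullet> h\<bar> / norm h \<le> \<bar>K\<bar> * norm h" for h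
  proof (cases "h = 0")
    case False
    have "\<bar>f (y + h) - f y - v y \<bullet> h\<bar> \<le> K * (h \<bullet> h)"
      using assms by (simp add: quadratic_approx_def)
    also have "\<dots> \<le> \<bar>K\<bar> * (h \<bullet> h)" by (intro mult_right_mono) auto
    finally show ?thesis using False by (simp add: divide_le_eq dot_square_norm power2_eq_square mult.assoc)
  qed simp
  have "((\<lambda>h. \<bar>K\<bar> * norm h) \<longlongrightarrow> 0) (at 0)"
    by (auto intro!: tendsto_eq_intros)
  then have "((\<lambda>h. norm (f (y + h) - f y - h \<bullet> v y) / norm h) \<longlongrightarrow> 0) (at 0)"
    by (rule Lim_null_comparison[rotated]) (use bd in \<open>auto simp: inner_commute\<close>)
  then show ?thesis
    by (simp add: gderiv_def has_derivative_at bounded_linear_inner_left)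
qed

lemma grad_eq: "GDERIV f x :> D \<Longrightarrow> grad f x = D"
  unfolding grad_def
proof (rule the_equality)
  fix D' assume "GDERIV f x :> D" "GDERIV f x :> D'"
  then have "(\<lambda>h. h \<bullet> D) = (\<lambda>h. h \<bullet> D')"
    unfolding gderiv_def by (rule has_derivative_unique)
  then show "D' = D" by (metis inner_commute vector_eq_rdot)
qed

lemma GDERIV_directional_limit:
  assumes g: "GDERIV g y :> D"
  shows "(\<lambda>n. (g (y + inverse (real (Suc n)) *\<^sub>R h) - g y) / inverse (real (Suc n))) \<longlonglongrightarrow> D \<bullet> h"
proof -
  have "((\<lambda>u. g (y + u *\<^sub>R h)) has_derivative (\<lambda>u. (u *\<^sub>R h) \<bullet> D)) (at 0)"
    using g unfolding gderiv_def
    by (intro has_derivative_compose[where f="\<lambda>u. y + u *\<^sub>R h" and g=g and f'="\<lambda>u. u *\<^sub>R h"])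
       (auto intro!: derivative_eq_intros)
  then have "((\<lambda>u. g (y + u *\<^sub>R h)) has_real_derivative (D \<bullet> h)) (at 0)"
    by (simp add: has_field_derivative_def inner_commute mult.commute[of _ "D \<bullet> h"])
  then have "((\<lambda>u. (g (y + u *\<^sub>R h) - g y) / u) \<longlongrightarrow> D \<bullet> h) (at 0)"
    by (simp add: DERIV_def)
  moreover have "filterlim (\<lambda>n. inverse (real (Suc n))) (at 0) sequentially"
    using LIMSEQ_inverse_real_of_nat by (simp add: filterlim_at)
  ultimately show ?thesis by (rule filterlim_compose)
qed

lemma lipschitz_quotient_le:
  fixes f :: "'a::euclidean_space \<Rightarrow> real"
  assumes lip: "L-lipschitz_on UNIV f" and e: "e > 0"
  shows "\<bar>(f (y + e *\<^sub>R h) - f y) / e\<bar> \<le> L * norm h"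
  using lipschitz_onD[OF lip, of "y + e *\<^sub>R h" y] e by (simp add: dist_norm field_simps)

lemma GDERIV_norm_le_lipschitz:
  fixes f :: "'a::euclidean_space \<Rightarrow> real"
  assumes g: "GDERIV f y :> D" and lip: "L-lipschitz_on UNIV f"
  shows "norm D \<le> L"
proof (cases "D = 0")
  case False
  have "\<bar>D \<bullet> D\<bar> \<le> L * norm D"
    by (rule LIMSEQ_le_const2[OF tendsto_rabs[OF GDERIV_directional_limit[OF g, of D]]])
       (use lipschitz_quotient_le[OF lip, of "inverse (real (Suc _))"] in auto)
  then show ?thesis using False by (simp add: dot_square_norm power2_eq_square)
qed (use lipschitz_on_nonneg[OF lip] in simp)

lemma exp_minus_one_minus_self_bound:
  fixes s :: real
  shows "\<bar>exp s - 1 - s\<bar> \<le> s\<^sup>2 * exp \<bar>s\<bar>"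
  using Taylor_exp_field[of s 1] by (simp add: power2_eq_square algebra_simps)

text \<open>
  Expand \<open>exp s\<close> at \<open>s = \<langle>z, k\<rangle> - |k|\<^sup>2/2\<close>. For \<open>|k| \<le> 1\<close> both \<open>|s| \<le> |k| (|z| + 1)\<close> and \<open>|s| \<le> |z| + 1\<close>
  hold; the first bound provides the factor \<open>|k|\<^sup>2\<close> and the second the integrable exponential.
\<close>

lemma exp_tilt_second_order:
  fixes z k :: "'a::euclidean_space"
  assumes "k \<bullet> k \<le> 1"
  shows "\<bar>exp (z \<bullet> k - (k \<bullet> k) / 2) - 1 - z \<bullet> k\<bar> \<le> (k \<bullet> k) * (3 * (exp 2 * exp (2 * norm z)))"
proof -
  define W where "W = (k \<bullet> k) * (exp 2 * exp (2 * norm z))"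
  define s where "s = z \<bullet> k - (k \<bullet> k) / 2"
  have nk: "norm k \<le> 1" using assms by (simp add: norm_eq_sqrt_inner)
  have "\<bar>s\<bar> \<le> norm z * norm k + norm k * norm k"
    using Cauchy_Schwarz_ineq2[of z k] inner_ge_zero[of k] unfolding s_def dot_square_norm power2_eq_square
    by linarith
  also have "\<dots> \<le> norm k * (norm z + 1)" using mult_left_mono[OF nk, of "norm k"] by (simp add: algebra_simps)
  finally have s: "\<bar>s\<bar> \<le> norm k * (norm z + 1)" .
  also have "\<dots> \<le> 1 * (norm z + 1)" by (intro mult_right_mono nk) auto
  finally have s1: "\<bar>s\<bar> \<le> norm z + 1" by simp
  have "s\<^sup>2 \<le> (norm k * (norm z + 1))\<^sup>2"
    using s by (metis abs_ge_zero power2_abs power_mono)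
  also have "\<dots> = (k \<bullet> k) * (norm z + 1)\<^sup>2" by (simp add: power_mult_distrib dot_square_norm)
  also have "\<dots> \<le> (k \<bullet> k) * (2 * exp (norm z + 1))"
    using power_le_fact_exp[of "norm z + 1" 2] by (intro mult_left_mono) auto
  finally have "s\<^sup>2 * exp \<bar>s\<bar> \<le> ((k \<bullet> k) * (2 * exp (norm z + 1))) * exp (norm z + 1)"
    using s1 by (intro mult_mono) auto
  also have "\<dots> = (k \<bullet> k) * (2 * (exp 2 * exp (2 * norm z)))"
    by (simp add: exp_add[symmetric] algebra_simps)
  finally have a: "\<bar>exp s - 1 - s\<bar> \<le> 2 * W"
    using exp_minus_one_minus_self_bound[of s] by (simp add: W_def)
  have "1 \<le> exp 2 * exp (2 * norm z)" by (simp flip: exp_add)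
  then have b: "(k \<bullet> k) / 2 \<le> W"
    unfolding W_def using mult_left_mono[of 1 "exp 2 * exp (2 * norm z)" "k \<bullet> k"] inner_ge_zero[of k] by linarith
  have "\<bar>exp s - 1 - z \<bullet> k\<bar> \<le> 3 * W"
    using a b inner_ge_zero[of k] unfolding abs_le_iff s_def by linarith
  then show ?thesis by (simp add: s_def W_def)
qed

text \<open>
  The gradient of \<open>heat t f\<close>, with the derivative moved onto the Gaussian density. It makes sense for
  bounded measurable \<open>f\<close>.
\<close>

definition heat_grad :: "real \<Rightarrow> ('a::euclidean_space \<Rightarrow> real) \<Rightarrow> 'a \<Rightarrow> 'a" where
  "heat_grad t f x = (1 / sqrt t) *\<^sub>R (\<integral>z. f (x + sqrt t *\<^sub>R z) *\<^sub>R z \<partial>std_gaussian)"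

lemma integrable_std_gaussian_bounded_times:
  fixes f :: "'a::euclidean_space \<Rightarrow> real" and g :: "'a \<Rightarrow> 'b::{banach, second_countable_topology}"
  assumes [measurable]: "f \<in> borel_measurable borel" "g \<in> borel_measurable borel"
    and "\<And>z. norm (f z) \<le> M" and "\<And>z. norm (g z) \<le> C * (norm z ^ k * exp (c * norm z))"
  shows "integrable std_gaussian (\<lambda>z. f (x + a *\<^sub>R z) *\<^sub>R g z)"
proof (rule Bochner_Integration.integrable_bound)
  show "integrable (std_gaussian::'a measure) (\<lambda>z. M * (C * (norm z ^ k * exp (c * norm z))))"
    by (intro integrable_mult_right integrable_std_gaussian_exp_norm)
  have M: "0 \<le> M" using assms(3) norm_ge_zero order_trans by blast
  show "AE z in std_gaussian. norm (f (x + a *\<^sub>R z) *\<^sub>R g z) \<le> norm (M * (C * (norm z ^ k * exp (c * norm z))))"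
  proof (rule AE_I2)
    fix z :: 'a
    have "norm (f (x + a *\<^sub>R z) *\<^sub>R g z) \<le> M * (C * (norm z ^ k * exp (c * norm z)))"
      unfolding norm_scaleR by (intro mult_mono assms M) (use assms(3)[of "x + a *\<^sub>R z"] in auto)
    also have "\<dots> \<le> norm (M * (C * (norm z ^ k * exp (c * norm z))))" by simp
    finally show "norm (f (x + a *\<^sub>R z) *\<^sub>R g z) \<le> norm (M * (C * (norm z ^ k * exp (c * norm z))))" .
  qed
qed measurable

text \<open>
  Gaussian smoothing: shifting \<open>x\<close> by \<open>sqrt t k\<close> tilts the density, and the tilt is expanded to first
  order. For \<open>|k| > 1\<close> the expansion is useless, but then boundedness of \<open>f\<close> suffices.
\<close>

lemma heat_quadratic_approx:
  fixes f :: "'a::euclidean_space \<Rightarrow> real"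
  assumes [measurable]: "f \<in> borel_measurable borel" and bd: "\<And>z. norm (f z) \<le> M" and t: "t > 0"
  shows "\<exists>K. quadratic_approx (heat t f) (heat_grad t f) K"
proof -
  define D where "D = (\<integral>z. 3 * (exp 2 * exp (2 * norm z)) \<partial>(std_gaussian :: 'a measure))"
  define K where "K = M * (2 + 2 * D)"
  have M: "0 \<le> M" using bd norm_ge_zero order_trans by blast
  have intexp: "integrable (std_gaussian :: 'a measure) (\<lambda>z. 3 * (exp 2 * exp (2 * norm z)))"
    using integrable_std_gaussian_exp_norm[where 'a='a, of 0 2] by simp
  have D: "D \<ge> 0" unfolding D_def by (rule integral_nonneg_AE) auto
  have intf: "integrable std_gaussian (\<lambda>z. f (x + sqrt t *\<^sub>R z))" for x
    by (rule integrable_std_gaussian_bounded[OF _ bd]) simp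
  have intfz: "integrable std_gaussian (\<lambda>z. f (x + sqrt t *\<^sub>R z) *\<^sub>R z)" for x
    by (rule integrable_std_gaussian_bounded_times[OF _ _ bd, where C=1 and k=1 and c=0]) auto
  have intfe: "integrable std_gaussian (\<lambda>z. f (x + sqrt t *\<^sub>R z) *\<^sub>R exp (z \<bullet> k - (k \<bullet> k) / 2))" for x k
  proof (rule integrable_std_gaussian_bounded_times[OF _ _ bd, where C=1 and k=0 and c="norm k"])
    fix z
    have "z \<bullet> k - (k \<bullet> k) / 2 \<le> norm k * norm z"
      using norm_cauchy_schwarz[of z k] inner_ge_zero[of k] unfolding mult.commute[of "norm k"] by linarith
    then show "norm (exp (z \<bullet> k - (k \<bullet> k) / 2)) \<le> 1 * (norm z ^ 0 * exp (norm k * norm z))" by simp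
  qed auto
  have main: "\<bar>heat t f (x + h) - heat t f x - heat_grad t f x \<bullet> h\<bar> \<le> K * (k \<bullet> k)"
    if hk: "h = sqrt t *\<^sub>R k" for x h k
  proof (cases "k \<bullet> k \<le> 1")
    case True
    have "heat t f (x + h) = (\<integral>z. f (x + sqrt t *\<^sub>R (k + z)) \<partial>std_gaussian)"
      by (simp add: heat_def hk scaleR_add_right add.assoc)
    also have "\<dots> = (\<integral>z. exp (z \<bullet> k - (k \<bullet> k) / 2) * f (x + sqrt t *\<^sub>R z) \<partial>std_gaussian)"
      by (rule integral_std_gaussian_shift) measurable
    finally have 1: "heat t f (x + h) = (\<integral>z. f (x + sqrt t *\<^sub>R z) *\<^sub>R exp (z \<bullet> k - (k \<bullet> k) / 2) \<partial>std_gaussian)"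
      by (simp add: mult.commute)
    have "heat_grad t f x \<bullet> h = (\<integral>z. f (x + sqrt t *\<^sub>R z) *\<^sub>R z \<partial>std_gaussian) \<bullet> k"
      using t by (simp add: heat_grad_def hk)
    also have "\<dots> = (\<integral>z. f (x + sqrt t *\<^sub>R z) *\<^sub>R z \<bullet> k \<partial>std_gaussian)"
      using intfz by (rule integral_inner_left[symmetric, rotated]) 
    finally have 2: "heat_grad t f x \<bullet> h = (\<integral>z. f (x + sqrt t *\<^sub>R z) * (z \<bullet> k) \<partial>std_gaussian)" by simp
    have intfk: "integrable std_gaussian (\<lambda>z. f (x + sqrt t *\<^sub>R z) * (z \<bullet> k))"
      using integrable_inner_left[OF intfz, of x k] by simp
    have "heat t f (x + h) - heat t f x - heat_grad t f x \<bullet> h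
      = (\<integral>z. f (x + sqrt t *\<^sub>R z) * (exp (z \<bullet> k - (k \<bullet> k) / 2) - 1 - z \<bullet> k) \<partial>std_gaussian)"
      unfolding 1 2 heat_def[of t f x] using intfe[of x k] intf[of x] intfk
      by (simp add: right_diff_distrib)
    also have "\<bar>\<dots>\<bar> \<le> (\<integral>z. M * ((k \<bullet> k) * (3 * (exp 2 * exp (2 * norm z)))) \<partial>(std_gaussian :: 'a measure))"
      unfolding real_norm_def[symmetric]
    proof (rule Bochner_Integration.integral_norm_bound_integral)
      show "integrable std_gaussian (\<lambda>z. f (x + sqrt t *\<^sub>R z) * (exp (z \<bullet> k - k \<bullet> k / 2) - 1 - z \<bullet> k))"
        using intfe[of x k] intf[of x] intfk by (simp add: right_diff_distrib)
      show "integrable (std_gaussian :: 'a measure) (\<lambda>z. M * ((k \<bullet> k) * (3 * (exp 2 * exp (2 * norm z)))))"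
        by (intro integrable_mult_right intexp)
      fix z :: 'a
      show "norm (f (x + sqrt t *\<^sub>R z) * (exp (z \<bullet> k - k \<bullet> k / 2) - 1 - z \<bullet> k))
         \<le> M * ((k \<bullet> k) * (3 * (exp 2 * exp (2 * norm z))))"
        unfolding norm_mult using exp_tilt_second_order[OF True, of z] M
        by (intro mult_mono bd) auto
    qed
    also have "\<dots> = M * ((k \<bullet> k) * D)" unfolding D_def using intexp by simp
    also have "\<dots> \<le> K * (k \<bullet> k)"
      unfolding K_def using M D mult_nonneg_nonneg[OF M inner_ge_zero[of k]] mult_nonneg_nonneg[OF mult_nonneg_nonneg[OF M inner_ge_zero[of k]] D]
      by (simp add: algebra_simps)
    finally show ?thesis .
  next
    case False
    have kk: "k \<bullet> k = norm k * norm k" by (simp add: dot_square_norm power2_eq_square)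
    have "1 \<le> norm k"
    proof (rule ccontr)
      assume "\<not> 1 \<le> norm k"
      then have "norm k * norm k \<le> 1 * 1" by (intro mult_mono) auto
      with False kk show False by simp
    qed
    moreover from this have "1 * norm k \<le> norm k * norm k" by (intro mult_right_mono) auto
    ultimately have nk: "1 \<le> norm k" "norm k \<le> k \<bullet> k" using kk by auto
    have "\<bar>heat_grad t f x \<bullet> h\<bar> \<le> norm (\<integral>z. f (x + sqrt t *\<^sub>R z) *\<^sub>R z \<partial>std_gaussian) * norm k"
      using t Cauchy_Schwarz_ineq2[of "\<integral>z. f (x + sqrt t *\<^sub>R z) *\<^sub>R z \<partial>std_gaussian" k]
      by (simp add: heat_grad_def hk)
    also have "norm (\<integral>z. f (x + sqrt t *\<^sub>R z) *\<^sub>R z \<partial>std_gaussian)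
      \<le> (\<integral>z. M * (3 * (exp 2 * exp (2 * norm z))) \<partial>(std_gaussian :: 'a measure))"
    proof (rule Bochner_Integration.integral_norm_bound_integral[OF intfz])
      show "integrable (std_gaussian :: 'a measure) (\<lambda>z. M * (3 * (exp 2 * exp (2 * norm z))))"
        by (intro integrable_mult_right intexp)
      fix z :: 'a
      have "norm z \<le> exp (norm z)" using exp_ge_add_one_self[of "norm z"] by linarith
      also have "\<dots> \<le> 3 * (exp 2 * exp (2 * norm z))"
      proof -
        have "exp (norm z) \<le> exp 2 * exp (2 * norm z)" by (simp flip: exp_add)
        moreover have "0 < exp (2::real) * exp (2 * norm z)" by simp
        ultimately show ?thesis by linarith
      qed
      finally show "norm (f (x + sqrt t *\<^sub>R z) *\<^sub>R z) \<le> M * (3 * (exp 2 * exp (2 * norm z)))"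
        unfolding norm_scaleR using M bd by (intro mult_mono) auto
    qed
    also have "\<dots> = M * D" unfolding D_def using intexp by simp
    finally have "\<bar>heat_grad t f x \<bullet> h\<bar> \<le> M * D * norm k" by (simp add: mult_right_mono)
    also have "\<dots> \<le> M * D * (k \<bullet> k)" using nk M D by (intro mult_left_mono) auto
    finally have a: "\<bar>heat_grad t f x \<bullet> h\<bar> \<le> M * D * (k \<bullet> k)" .
    have "\<bar>heat t f (x + h)\<bar> \<le> M" "\<bar>heat t f x\<bar> \<le> M" using norm_heat_le[OF bd] by auto
    moreover have "M \<le> M * (k \<bullet> k)" using mult_left_mono[of 1 "k \<bullet> k" M] False M by simp
    ultimately have "\<bar>heat t f (x + h) - heat t f x - heat_grad t f x \<bullet> h\<bar> \<le> 2 * (M * (k \<bullet> k)) + M * D * (k \<bullet> k)"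
      using a by linarith
    also have "\<dots> \<le> K * (k \<bullet> k)" 
      unfolding K_def using mult_nonneg_nonneg[OF mult_nonneg_nonneg[OF M inner_ge_zero[of k]] D]
      by (simp add: algebra_simps)
    finally show ?thesis .
  qed
  have "quadratic_approx (heat t f) (heat_grad t f) (K / t)"
    unfolding quadratic_approx_def
  proof (intro allI)
    fix y h
    show "\<bar>heat t f (y + h) - heat t f y - heat_grad t f y \<bullet> h\<bar> \<le> K / t * (h \<bullet> h)"
      using main[of h "(1 / sqrt t) *\<^sub>R h" y] t by (simp add: divide_simps)
  qed
  then show ?thesis ..
qed

text \<open>
  For Lipschitz \<open>f\<close> the derivative can be left on \<open>f\<close> by dominated convergence of difference quotients;
  both computations give the directional derivative of \<open>heat t f\<close>. This is the commutation of the
  gradient with the semigroup.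
\<close>

lemma heat_grad_eq_heat:
  fixes f :: "'a::euclidean_space \<Rightarrow> real"
  assumes v: "\<And>y. GDERIV f y :> v y" and lip: "L-lipschitz_on UNIV f"
    and bdf: "\<And>z. norm (f z) \<le> M" and cv: "continuous_on UNIV v" and t: "t > 0"
  shows "heat_grad t f x = heat t v x"
proof -
  have bdv: "norm (v y) \<le> L" for y by (rule GDERIV_norm_le_lipschitz[OF v lip])
  have "continuous_on UNIV f" using lip by (rule lipschitz_on_continuous_on)
  then have mf [measurable]: "f \<in> borel_measurable borel" by (rule borel_measurable_continuous_onI)
  have mv [measurable]: "v \<in> borel_measurable borel" using cv by (rule borel_measurable_continuous_onI)
  obtain K where K: "quadratic_approx (heat t f) (heat_grad t f) K"
    using heat_quadratic_approx[OF mf bdf t] ..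
  have "heat_grad t f x \<bullet> h = heat t v x \<bullet> h" for h
  proof (rule LIMSEQ_unique)
    show "(\<lambda>n. (heat t f (x + inverse (real (Suc n)) *\<^sub>R h) - heat t f x) / inverse (real (Suc n))) \<longlonglongrightarrow> heat_grad t f x \<bullet> h"
      by (rule GDERIV_directional_limit[OF quadratic_approx_GDERIV[OF K]])
    have intf: "integrable std_gaussian (\<lambda>z. f (y + sqrt t *\<^sub>R z))" for y
      by (rule integrable_std_gaussian_bounded[OF mf bdf])
    have intv: "integrable std_gaussian (\<lambda>z. v (x + sqrt t *\<^sub>R z))"
      by (rule integrable_std_gaussian_bounded[OF mv bdv])
    have "(\<lambda>n. \<integral>z. (f (x + sqrt t *\<^sub>R z + inverse (real (Suc n)) *\<^sub>R h) - f (x + sqrt t *\<^sub>R z)) / inverse (real (Suc n)) \<partial>std_gaussian)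
       \<longlonglongrightarrow> (\<integral>z. v (x + sqrt t *\<^sub>R z) \<bullet> h \<partial>std_gaussian)"
    proof (rule integral_dominated_convergence[where w="\<lambda>_. L * norm h"])
      show "AE z in std_gaussian. (\<lambda>n. (f (x + sqrt t *\<^sub>R z + inverse (real (Suc n)) *\<^sub>R h) - f (x + sqrt t *\<^sub>R z)) / inverse (real (Suc n)))
         \<longlonglongrightarrow> v (x + sqrt t *\<^sub>R z) \<bullet> h"
        by (rule AE_I2, rule GDERIV_directional_limit[OF v])
      show "AE z in std_gaussian. norm ((f (x + sqrt t *\<^sub>R z + inverse (real (Suc n)) *\<^sub>R h) - f (x + sqrt t *\<^sub>R z)) / inverse (real (Suc n))) \<le> L * norm h" for n
        unfolding real_norm_def by (intro AE_I2 lipschitz_quotient_le[OF lip]) simp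
    qed auto
    also have "(\<integral>z. v (x + sqrt t *\<^sub>R z) \<bullet> h \<partial>std_gaussian) = heat t v x \<bullet> h"
      unfolding heat_def using intv by (intro integral_inner_left) auto
    also have "(\<lambda>n. \<integral>z. (f (x + sqrt t *\<^sub>R z + inverse (real (Suc n)) *\<^sub>R h) - f (x + sqrt t *\<^sub>R z)) / inverse (real (Suc n)) \<partial>std_gaussian)
      = (\<lambda>n. (heat t f (x + inverse (real (Suc n)) *\<^sub>R h) - heat t f x) / inverse (real (Suc n)))"
    proof
      fix n
      let ?e = "inverse (real (Suc n))"
      have "heat t f (x + ?e *\<^sub>R h) - heat t f x
          = (\<integral>z. f (x + ?e *\<^sub>R h + sqrt t *\<^sub>R z) - f (x + sqrt t *\<^sub>R z) \<partial>std_gaussian)"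
        unfolding heat_def by (rule Bochner_Integration.integral_diff[symmetric, OF intf intf])
      then show "(\<integral>z. (f (x + sqrt t *\<^sub>R z + ?e *\<^sub>R h) - f (x + sqrt t *\<^sub>R z)) / ?e \<partial>std_gaussian)
         = (heat t f (x + ?e *\<^sub>R h) - heat t f x) / ?e"
        by (simp add: add.assoc add.commute[of "sqrt t *\<^sub>R _"] del: of_nat_Suc)
    qed
    finally show "(\<lambda>n. (heat t f (x + inverse (real (Suc n)) *\<^sub>R h) - heat t f x) / inverse (real (Suc n))) \<longlonglongrightarrow> heat t v x \<bullet> h" .
  qed
  then show ?thesis by (metis inner_commute vector_eq_rdot)
qed

section \<open>Elementary inequalities for the entropy function\<close>

text \<open>
  Convexity of \<open>u \<mapsto> u ln u\<close>: its graph lies above the tangent at \<open>c\<close>.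
\<close>

lemma entropy_tangent:
  fixes c m :: real
  assumes "c > 0" "m > 0"
  shows "c * ln c + (m - c) * (ln c + 1) \<le> m * ln m"
proof -
  have "ln (c / m) \<le> c / m - 1" using assms by (intro ln_le_minus_one) auto
  then have "m * (ln c - ln m) \<le> m * (c / m - 1)" using assms by (intro mult_left_mono) (auto simp: ln_div)
  then show ?thesis using assms by (simp add: algebra_simps)
qed

text \<open>
  The Young inequality for the conjugate pair \<open>a ln a - a\<close> and \<open>exp b\<close>, rescaled by \<open>H\<close>. Integrated, it
  is the variational characterisation of the entropy.
\<close>

lemma entropy_young:
  fixes a b H :: real
  assumes "a > 0" "H > 0"
  shows "a * b \<le> a * ln a - a * ln H - a + H * exp b"
proof -
  have "1 + (b - ln (a / H)) \<le> exp (b - ln (a / H))" by (rule exp_ge_add_one_self)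
  then have "a * (1 + (b - ln (a / H))) \<le> a * exp (b - ln (a / H))" using assms by (intro mult_left_mono) auto
  also have "exp (b - ln (a / H)) = exp b / (a / H)" using assms by (simp add: exp_diff)
  also have "a * (exp b / (a / H)) = H * exp b" using assms by simp
  also have "ln (a / H) = ln a - ln H" using assms by (simp add: ln_div)
  finally show ?thesis by (simp add: algebra_simps)
qed

text \<open>
  The quadratic coefficient \<open>1/2\<close> is sharp, and it produces the sharp constant in the logarithmic
  Sobolev inequality; the cubic term is only an error. For negative \<open>s\<close> the proof rests on
  \<open>ln (1 + s) \<le> 2 s / (2 + s)\<close>.
\<close>

lemma entropy_upper:
  fixes s :: real
  assumes "s > - 1"
  shows "(1 + s) * ln (1 + s) - s \<le> s\<^sup>2 / 2 + \<bar>s\<bar> ^ 3 / 2"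
proof (cases "s \<ge> 0")
  case True
  define g where "g s = s\<^sup>2 / 2 + s - (1 + s) * ln (1 + s)" for s :: real
  have "g 0 \<le> g s"
  proof (rule DERIV_nonneg_imp_nondecreasing[OF True])
    fix x :: real assume x: "0 \<le> x" "x \<le> s"
    have "(g has_real_derivative (x + 1 - (ln (1 + x) + (1 + x) / (1 + x)))) (at x)"
      unfolding g_def using x by (auto intro!: derivative_eq_intros)
    moreover have "x + 1 - (ln (1 + x) + (1 + x) / (1 + x)) \<ge> 0"
      using x ln_add_one_self_le_self[of x] by simp
    ultimately show "\<exists>y. (g has_real_derivative y) (at x) \<and> 0 \<le> y" by blast
  qed
  then have "(1 + s) * ln (1 + s) \<le> s\<^sup>2 / 2 + s" by (simp add: g_def)
  moreover have "\<bar>s\<bar> ^ 3 \<ge> 0" by simp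
  ultimately show ?thesis by linarith
next
  case False
  define g where "g s = 2 * s - (2 + s) * ln (1 + s)" for s :: real
  have "g 0 \<le> g s"
  proof (rule DERIV_nonpos_imp_nonincreasing[of s 0])
    show "s \<le> 0" using False by simp
    fix x :: real assume x: "s \<le> x" "x \<le> 0"
    then have x1: "1 + x > 0" using assms by linarith
    have "(g has_real_derivative (2 - (ln (1 + x) + (2 + x) / (1 + x)))) (at x)"
      unfolding g_def using x1 by (auto intro!: derivative_eq_intros)
    moreover have "2 - (ln (1 + x) + (2 + x) / (1 + x)) \<le> 0"
    proof -
      have "ln (1 / (1 + x)) \<le> 1 / (1 + x) - 1" using x1 by (intro ln_le_minus_one) auto
      moreover have "(2 + x) / (1 + x) = 1 + 1 / (1 + x)" using x1 by (simp add: field_simps)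
      ultimately show ?thesis using x1 by (simp add: ln_div)
    qed
    ultimately show "\<exists>y. (g has_real_derivative y) (at x) \<and> y \<le> 0" by blast
  qed
  then have "ln (1 + s) \<le> 2 * s / (2 + s)" using assms by (simp add: g_def field_simps)
  then have "(1 + s) * ln (1 + s) \<le> (1 + s) * (2 * s / (2 + s))" using assms by (intro mult_left_mono) auto
  moreover have "(1 + s) * (2 * s / (2 + s)) - s = s\<^sup>2 / 2 + (- s) ^ 3 / (2 * (2 + s))"
    using assms by (simp add: field_simps power2_eq_square power3_eq_cube)
  moreover have "(- s) ^ 3 / (2 * (2 + s)) \<le> (- s) ^ 3 / 2"
    using assms False by (intro divide_left_mono) auto
  ultimately show ?thesis using False by simp
qed

lemma entropy_taylor:
  fixes c u :: real
  assumes "c > 0" "u > 0"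
  shows "u * ln u - c * ln c - (u - c) * (ln c + 1) \<le> (u - c)\<^sup>2 / (2 * c) + \<bar>u - c\<bar> ^ 3 / (2 * c\<^sup>2)"
proof -
  define s where "s = (u - c) / c"
  have s: "s > - 1" using assms by (simp add: s_def field_simps)
  have u: "u = c * (1 + s)" using assms by (simp add: s_def field_simps)
  have lnu: "ln u = ln c + ln (1 + s)" unfolding u using assms s by (simp add: ln_mult)
  have "u * ln u - c * ln c - (u - c) * (ln c + 1) = c * ((1 + s) * ln (1 + s) - s)"
    using assms s unfolding lnu by (simp add: u algebra_simps)
  also have "\<dots> \<le> c * (s\<^sup>2 / 2 + \<bar>s\<bar> ^ 3 / 2)"
    using assms entropy_upper[OF s] by (intro mult_left_mono) auto
  also have "\<dots> = (u - c)\<^sup>2 / (2 * c) + \<bar>u - c\<bar> ^ 3 / (2 * c\<^sup>2)"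
    using assms unfolding s_def by (simp add: abs_divide power_divide power2_eq_square power3_eq_cube field_simps)
  finally show ?thesis .
qed

lemma abs_mult_ln_le:
  fixes u :: real
  assumes "u > 0" "u \<le> M"
  shows "\<bar>u * ln u\<bar> \<le> 1 + M\<^sup>2"
proof -
  have "u * ln u \<le> u * u" using ln_le_minus_one[of u] assms by (intro mult_left_mono) auto
  also have "\<dots> \<le> M\<^sup>2" using assms by (simp add: power2_eq_square mult_mono)
  finally have 1: "u * ln u \<le> M\<^sup>2" .
  have "ln (1 / u) \<le> 1 / u - 1" using assms by (intro ln_le_minus_one) auto
  then have "u * (- ln u) \<le> u * (1 / u - 1)" using assms by (intro mult_left_mono) (auto simp: ln_div)
  then have "- (u * ln u) \<le> 1" using assms by (simp add: algebra_simps)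
  then show ?thesis using 1 zero_le_power2[of M] unfolding abs_le_iff by linarith
qed

section \<open>The Gaussian reverse logarithmic Sobolev inequality\<close>

definition entropy :: "real \<Rightarrow> ('a::euclidean_space \<Rightarrow> real) \<Rightarrow> 'a \<Rightarrow> real" where
  "entropy t f x = heat t (\<lambda>y. f y * ln (f y)) x - heat t f x * ln (heat t f x)"

lemma integral_std_gaussian_pos:
  fixes f :: "'a::euclidean_space \<Rightarrow> real"
  assumes "f \<in> borel_measurable borel" "\<And>z. f z > 0" "integrable std_gaussian f"
  shows "(\<integral>z. f z \<partial>std_gaussian) > 0"
  using std_gaussian.integral_less_AE_space[of "\<lambda>_. 0" f] assms by simp

lemma heat_pos:
  fixes f :: "'a::euclidean_space \<Rightarrow> real"
  assumes [measurable]: "f \<in> borel_measurable borel" and "\<And>z. f z > 0" "\<And>z. f z \<le> M"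
  shows "heat t f x > 0"
  unfolding heat_def
proof (rule integral_std_gaussian_pos)
  show "integrable std_gaussian (\<lambda>z. f (x + sqrt t *\<^sub>R z))"
    by (rule integrable_std_gaussian_bounded[of _ M]) (use assms in \<open>auto simp: abs_of_pos\<close>)
qed (use assms in auto)

text \<open>
  Integrate the Young inequality with \<open>a = f (x + z)\<close>, \<open>H = P\<^sub>1 f(x)\<close> and \<open>b = \<langle>z, \<theta>\<rangle> - |\<theta>|\<^sup>2/2\<close>. Since \<open>exp b\<close> has
  integral one, the result is \<open>\<langle>w, \<theta>\<rangle> - H |\<theta>|\<^sup>2/2 \<le> Ent\<close>, where \<open>w\<close> is the gradient of the heat flow at
  \<open>x\<close>; the left-hand side is maximal for \<open>\<theta> = w / H\<close>.
\<close>

theorem gaussian_reverse_log_sobolev: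
  fixes f :: "'a::euclidean_space \<Rightarrow> real"
  assumes [measurable]: "f \<in> borel_measurable borel" and pos: "\<And>z. f z > 0" and le: "\<And>z. f z \<le> M"
  shows "heat_grad 1 f x \<bullet> heat_grad 1 f x / (2 * heat 1 f x) \<le> entropy 1 f x"
proof -
  let ?H = "heat 1 f x" and ?w = "heat_grad 1 f x"
  have H: "?H > 0" by (rule heat_pos[OF _ pos le]) simp
  have bd: "norm (f z) \<le> M" for z using pos[of z] le[of z] by simp
  have bdl: "norm (f z * ln (f z)) \<le> 1 + M\<^sup>2" for z using abs_mult_ln_le[OF pos le] by simp
  \<comment> \<open>the maximiser of \<open>\<langle>w, \<theta>\<rangle> - H |\<theta>|\<^sup>2/2\<close>\<close>
  define \<theta> where "\<theta> = (1 / ?H) *\<^sub>R ?w"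
  have intf: "integrable std_gaussian (\<lambda>z. f (x + z))"
    using integrable_std_gaussian_bounded[where f=f and M=M and x=x and c=1] bd by simp
  have intl: "integrable std_gaussian (\<lambda>z. f (x + z) * ln (f (x + z)))"
    using integrable_std_gaussian_bounded[where f="\<lambda>z. f z * ln (f z)" and M="1 + M\<^sup>2" and x=x and c=1] bdl by simp
  have intfz: "integrable std_gaussian (\<lambda>z. f (x + z) *\<^sub>R z)"
    using integrable_std_gaussian_bounded_times[where g="\<lambda>z::'a. z" and f=f and M=M and C=1 and k=1 and c=0 and x=x and a=1] bd by simp
  have intft: "integrable std_gaussian (\<lambda>z. f (x + z) * (z \<bullet> \<theta>))"
    using integrable_inner_left[where f="\<lambda>z. f (x + z) *\<^sub>R z" and c=\<theta> and M=std_gaussian] intfz by simp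
  have inte: "integrable std_gaussian (\<lambda>z. exp (z \<bullet> \<theta> - (\<theta> \<bullet> \<theta>) / 2))"
    "(\<integral>z. exp (z \<bullet> \<theta> - (\<theta> \<bullet> \<theta>) / 2) \<partial>std_gaussian) = 1"
    using std_gaussian_exp_inner[of \<theta>] by (auto simp: exp_diff)
  have w: "?w = (\<integral>z. f (x + z) *\<^sub>R z \<partial>std_gaussian)" by (simp add: heat_grad_def)
  have wt: "(\<integral>z. f (x + z) * (z \<bullet> \<theta>) \<partial>std_gaussian) = ?w \<bullet> \<theta>"
    unfolding w using integral_inner_left[where f="\<lambda>z. f (x + z) *\<^sub>R z" and c=\<theta> and M=std_gaussian] intfz by simp
  have H': "(\<integral>z. f (x + z) \<partial>std_gaussian) = ?H" by (simp add: heat_def)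
  have "(\<integral>z. f (x + z) * (z \<bullet> \<theta> - (\<theta> \<bullet> \<theta>) / 2) \<partial>std_gaussian)
    \<le> (\<integral>z. f (x + z) * ln (f (x + z)) - f (x + z) * ln ?H - f (x + z) + ?H * exp (z \<bullet> \<theta> - (\<theta> \<bullet> \<theta>) / 2) \<partial>std_gaussian)"
  proof (rule integral_mono)
    show "integrable std_gaussian (\<lambda>z. f (x + z) * (z \<bullet> \<theta> - \<theta> \<bullet> \<theta> / 2))"
      using intft intf by (simp add: right_diff_distrib)
    show "integrable std_gaussian (\<lambda>z. f (x + z) * ln (f (x + z)) - f (x + z) * ln ?H - f (x + z) + ?H * exp (z \<bullet> \<theta> - \<theta> \<bullet> \<theta> / 2))"
      using intf intl inte by auto
  qed (use entropy_young pos H in auto)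
  also have "\<dots> = entropy 1 f x"
    using intf intl inte by (simp add: H' entropy_def) (simp add: heat_def)
  also have "(\<integral>z. f (x + z) * (z \<bullet> \<theta> - (\<theta> \<bullet> \<theta>) / 2) \<partial>std_gaussian) = ?w \<bullet> \<theta> - ?H * ((\<theta> \<bullet> \<theta>) / 2)"
    using intft intf by (simp add: right_diff_distrib wt H')
  also have "\<dots> = ?w \<bullet> ?w / (2 * ?H)"
    using H by (simp add: \<theta>_def field_simps)
  finally show ?thesis .
qed

section \<open>The Gaussian logarithmic Sobolev inequality\<close>

definition fisher :: "('a::euclidean_space \<Rightarrow> real) \<Rightarrow> ('a \<Rightarrow> 'a) \<Rightarrow> 'a \<Rightarrow> real" where
  "fisher f v y = v y \<bullet> v y / f y"

text \<open>
  The class of functions over which the small-time expansion is uniform. The gradient field \<open>v\<close> is part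
  of the data, so that stability under the heat flow needs no differentiation under the integral.
\<close>

definition regular_pair :: "real \<Rightarrow> real \<Rightarrow> real \<Rightarrow> real \<Rightarrow> ('a::euclidean_space \<Rightarrow> real) \<Rightarrow> ('a \<Rightarrow> 'a) \<Rightarrow> bool" where
  "regular_pair \<epsilon> M L K f v \<longleftrightarrow> f \<in> borel_measurable borel \<and> v \<in> borel_measurable borel \<and>
     (\<forall>x. \<epsilon> \<le> f x \<and> f x \<le> M \<and> norm (v x) \<le> L) \<and> quadratic_approx f v K"

lemma heat_regular_pair:
  assumes r: "regular_pair \<epsilon> M L K f v" and \<epsilon>: "\<epsilon> > 0"
  shows "regular_pair \<epsilon> M L K (heat t f) (heat t v)"
proof -
  have [measurable]: "f \<in> borel_measurable borel" "v \<in> borel_measurable borel"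
    and f: "\<epsilon> \<le> f x" "f x \<le> M" and v: "norm (v x) \<le> L" 
    and q: "\<bar>f (x + h) - f x - v x \<bullet> h\<bar> \<le> K * (h \<bullet> h)" for x h
    using r by (auto simp: regular_pair_def quadratic_approx_def)
  have bd: "norm (f x) \<le> M" for x using f[of x] \<epsilon> by auto
  have M: "M \<ge> \<epsilon>" using f[of undefined] by simp
  have intf: "integrable std_gaussian (\<lambda>z. f (y + sqrt t *\<^sub>R z))" for y
    by (rule integrable_std_gaussian_bounded[OF _ bd]) simp
  have intv: "integrable std_gaussian (\<lambda>z. v (y + sqrt t *\<^sub>R z))" for y
    by (rule integrable_std_gaussian_bounded[OF _ v]) simp
  have "\<epsilon> \<le> heat t f x" for x
    using heat_mono[of "\<lambda>_. \<epsilon>" \<epsilon> f M t x] bd f \<epsilon> by simp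
  moreover have "heat t f x \<le> M" for x
    using heat_mono[of f M "\<lambda>_. M" M t x] bd f \<epsilon> M by simp
  moreover have "norm (heat t v x) \<le> L" for x by (rule norm_heat_le[OF v])
  moreover have "\<bar>heat t f (y + h) - heat t f y - heat t v y \<bullet> h\<bar> \<le> K * (h \<bullet> h)" for y h
  proof -
    have intvh: "integrable std_gaussian (\<lambda>z. v (y + sqrt t *\<^sub>R z) \<bullet> h)"
      by (rule integrable_inner_left) (rule intv)
    have "heat t f (y + h) - heat t f y - heat t v y \<bullet> h
      = (\<integral>z. f (y + h + sqrt t *\<^sub>R z) - f (y + sqrt t *\<^sub>R z) - v (y + sqrt t *\<^sub>R z) \<bullet> h \<partial>std_gaussian)"
      unfolding heat_def using intf intv intvh by simp
    also have "\<bar>\<dots>\<bar> \<le> (\<integral>z. K * (h \<bullet> h) \<partial>(std_gaussian :: 'a measure))"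
      unfolding real_norm_def[symmetric]
    proof (rule Bochner_Integration.integral_norm_bound_integral)
      fix z
      show "norm (f (y + h + sqrt t *\<^sub>R z) - f (y + sqrt t *\<^sub>R z) - v (y + sqrt t *\<^sub>R z) \<bullet> h) \<le> K * (h \<bullet> h)"
        using q[of "y + sqrt t *\<^sub>R z" h] by (simp add: ac_simps)
    qed (use intf intvh in auto)
    finally show ?thesis by simp
  qed
  ultimately show ?thesis by (simp add: regular_pair_def quadratic_approx_def)
qed

lemma fisher_bounds:
  assumes r: "regular_pair \<epsilon> M L K f v" and \<epsilon>: "\<epsilon> > 0"
  shows "fisher f v \<in> borel_measurable borel" "0 \<le> fisher f v x" "norm (fisher f v x) \<le> L\<^sup>2 / \<epsilon>"
proof -
  have [measurable]: "f \<in> borel_measurable borel" "v \<in> borel_measurable borel"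
    and f: "\<epsilon> \<le> f x" and v: "norm (v x) \<le> L" for x
    using r by (auto simp: regular_pair_def)
  show "fisher f v \<in> borel_measurable borel" unfolding fisher_def[abs_def] by measurable
  show "0 \<le> fisher f v x" using f[of x] \<epsilon> by (auto simp: fisher_def)
  then have "norm (fisher f v x) = v x \<bullet> v x / f x" by (simp only: fisher_def real_norm_def abs_of_nonneg)
  also have "\<dots> \<le> L\<^sup>2 / \<epsilon>"
    using f[of x] v[of x] \<epsilon> by (intro frac_le) (auto simp: dot_square_norm power_mono)
  finally show "norm (fisher f v x) \<le> L\<^sup>2 / \<epsilon>" .
qed

text \<open>
  Convexity of \<open>(v, f) \<mapsto> |v|\<^sup>2/f\<close>: it is the supremum over \<open>w\<close> of the linear functions
  \<open>2 \<langle>v, w\<rangle> - f |w|\<^sup>2\<close>. The \<open>w\<close> that is optimal for the averages serves at all points at once.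
\<close>

lemma fisher_heat_le:
  assumes r: "regular_pair \<epsilon> M L K f v" and \<epsilon>: "\<epsilon> > 0"
  shows "fisher (heat t f) (heat t v) x \<le> heat t (fisher f v) x"
proof -
  have [measurable]: "f \<in> borel_measurable borel" "v \<in> borel_measurable borel"
    and f: "\<epsilon> \<le> f x" "f x \<le> M" and v: "norm (v x) \<le> L" for x
    using r by (auto simp: regular_pair_def)
  have bd: "norm (f x) \<le> M" for x using f[of x] \<epsilon> by auto
  have intf: "integrable std_gaussian (\<lambda>z. f (y + sqrt t *\<^sub>R z))" for y
    by (rule integrable_std_gaussian_bounded[OF _ bd]) simp
  have intv: "integrable std_gaussian (\<lambda>z. v (y + sqrt t *\<^sub>R z))" for y
    by (rule integrable_std_gaussian_bounded[OF _ v]) simp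
  have intI: "integrable std_gaussian (\<lambda>z. fisher f v (y + sqrt t *\<^sub>R z))" for y
    by (rule integrable_std_gaussian_bounded[OF fisher_bounds(1)[OF r \<epsilon>] fisher_bounds(3)[OF r \<epsilon>]])
  have H: "heat t f x > 0" using f \<epsilon> by (intro heat_pos[where M=M]) (auto intro: less_le_trans)
  \<comment> \<open>the maximiser of \<open>2 \<langle>v, w\<rangle> - f |w|\<^sup>2\<close> for the averaged pair\<close>
  define w where "w = (1 / heat t f x) *\<^sub>R heat t v x"
  have intvw: "integrable std_gaussian (\<lambda>z. v (x + sqrt t *\<^sub>R z) \<bullet> w)"
    by (rule integrable_inner_left) (rule intv)
  have "fisher (heat t f) (heat t v) x = 2 * (heat t v x \<bullet> w) - heat t f x * (w \<bullet> w)"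
    using H by (simp add: fisher_def w_def field_simps)
  also have "\<dots> = (\<integral>z. 2 * (v (x + sqrt t *\<^sub>R z) \<bullet> w) - f (x + sqrt t *\<^sub>R z) * (w \<bullet> w) \<partial>std_gaussian)"
    unfolding heat_def using intf intv intvw by simp
  also have "\<dots> \<le> heat t (fisher f v) x"
    unfolding heat_def
  proof (rule integral_mono)
    fix z
    let ?y = "x + sqrt t *\<^sub>R z"
    have fy: "f ?y > 0" using f[of ?y] \<epsilon> by linarith
    have "0 \<le> (v ?y - f ?y *\<^sub>R w) \<bullet> (v ?y - f ?y *\<^sub>R w)" by simp
    also have "\<dots> = v ?y \<bullet> v ?y - f ?y * (2 * (v ?y \<bullet> w) - f ?y * (w \<bullet> w))"
      by (simp add: inner_diff inner_commute algebra_simps)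
    finally show "2 * (v ?y \<bullet> w) - f ?y * (w \<bullet> w) \<le> fisher f v ?y"
      using fy by (simp add: fisher_def field_simps)
  qed (use intf intvw intI in auto)
  finally show ?thesis .
qed

text \<open>
  Over a time \<open>\<delta>\<close> the function differs from its value \<open>c\<close> at \<open>x\<close> by \<open>sqrt \<delta> \<langle>v, z\<rangle>\<close> up to an error of order
  \<open>\<delta>\<close>. The entropy is at most the mean of the convex Taylor remainder of \<open>u ln u\<close> at \<open>c\<close>, whose quadratic
  part has mean at most \<open>\<delta> |v|\<^sup>2 / (2 c)\<close>. What remains is of order \<open>\<delta>\<^sup>3\<^sup>/\<^sup>2\<close> times \<open>(1 + |z|)\<^sup>6\<close>, and its
  constant depends on \<open>f\<close> only through the bounds of its class.
\<close>

lemma small_time_log_sobolev: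
  assumes \<epsilon>: "\<epsilon> > 0" and L: "L \<ge> 0" and K: "K \<ge> 0"
  shows "\<exists>C. \<forall>(f :: 'a::euclidean_space \<Rightarrow> real) v \<delta> x. regular_pair \<epsilon> M L K f v \<longrightarrow> 0 < \<delta> \<longrightarrow> \<delta> \<le> 1 \<longrightarrow>
     entropy \<delta> f x \<le> \<delta> / 2 * fisher f v x + C * (\<delta> * sqrt \<delta>)"
proof -
  define B where "B = L + K"
  define C0 where "C0 = (2 * L * K + K\<^sup>2) / (2 * \<epsilon>) + B ^ 3 / (2 * \<epsilon>\<^sup>2)"
  have B: "B \<ge> 0" using L K by (simp add: B_def)
  have C0: "C0 \<ge> 0" using L K B \<epsilon> by (simp add: C0_def)
  \<comment> \<open>an integrable majorant of \<open>(1 + norm z) ^ 6\<close>, the highest power that occurs in the error\<close>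
  define Q where "Q = (\<lambda>z::'a. fact 6 * (exp 1 * exp (norm z)))"
  have intQ: "integrable std_gaussian Q"
    unfolding Q_def using integrable_std_gaussian_exp_norm[where 'a='a, of 0 1] by simp
  have Q: "(1 + norm z) ^ k \<le> Q z" if "k \<le> 6" for z k
  proof -
    have "(1 + norm z) ^ k \<le> (1 + norm z) ^ 6" using that by (intro power_increasing) auto
    also have "\<dots> \<le> Q z" using power_le_fact_exp[of "1 + norm z" 6] by (simp add: Q_def exp_add)
    finally show ?thesis .
  qed
  have "entropy \<delta> f x \<le> \<delta> / 2 * fisher f v x + (C0 * (\<integral>z. Q z \<partial>std_gaussian)) * (\<delta> * sqrt \<delta>)"
    if r: "regular_pair \<epsilon> M L K f v" and \<delta>: "0 < \<delta>" "\<delta> \<le> 1" for f :: "'a \<Rightarrow> real" and v \<delta> x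
  proof -
    have [measurable]: "f \<in> borel_measurable borel" "v \<in> borel_measurable borel"
      and f: "\<epsilon> \<le> f x" "f x \<le> M" and v: "norm (v x) \<le> L"
      and q: "\<bar>f (x + h) - f x - v x \<bullet> h\<bar> \<le> K * (h \<bullet> h)" for x h
      using r by (auto simp: regular_pair_def quadratic_approx_def)
    have fpos: "f y > 0" for y using f[of y] \<epsilon> by linarith
    have bd: "norm (f y) \<le> M" for y using f[of y] fpos[of y] by simp
    have bdl: "norm (f y * ln (f y)) \<le> 1 + M\<^sup>2" for y using abs_mult_ln_le[OF fpos f(2)] by simp
    have intf: "integrable std_gaussian (\<lambda>z. f (x + sqrt \<delta> *\<^sub>R z))"
      by (rule integrable_std_gaussian_bounded[OF _ bd]) simp
    have intl: "integrable std_gaussian (\<lambda>z. f (x + sqrt \<delta> *\<^sub>R z) * ln (f (x + sqrt \<delta> *\<^sub>R z)))"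
      using integrable_std_gaussian_bounded[where f="\<lambda>y. f y * ln (f y)" and M="1 + M\<^sup>2" and x=x and c="sqrt \<delta>"] bdl by simp
    define c where "c = f x"
    have c: "c > 0" "\<epsilon> \<le> c" using fpos f by (auto simp: c_def)
    let ?m = "heat \<delta> f x"
    have m: "?m > 0" by (rule heat_pos[OF _ fpos f(2)]) simp
    let ?F = "\<lambda>z. f (x + sqrt \<delta> *\<^sub>R z)"
    have "entropy \<delta> f x \<le> heat \<delta> (\<lambda>y. f y * ln (f y)) x - c * ln c - (?m - c) * (ln c + 1)"
      using entropy_tangent[OF c(1) m] by (simp add: entropy_def)
    also have "\<dots> = (\<integral>z. ?F z * ln (?F z) - c * ln c - (?F z - c) * (ln c + 1) \<partial>std_gaussian)"
      unfolding heat_def using intf intl by simp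
    also have "\<dots> \<le> (\<integral>z. \<delta> / (2 * c) * (v x \<bullet> z)\<^sup>2 + (\<delta> * sqrt \<delta>) * C0 * Q z \<partial>std_gaussian)"
    proof (rule integral_mono)
      show "integrable std_gaussian (\<lambda>z. ?F z * ln (?F z) - c * ln c - (?F z - c) * (ln c + 1))"
        using intf intl by simp
      show "integrable std_gaussian (\<lambda>z. \<delta> / (2 * c) * (v x \<bullet> z)\<^sup>2 + (\<delta> * sqrt \<delta>) * C0 * Q z)"
        using intQ std_gaussian_second_moment(1)[of "v x"] by simp
      fix z :: 'a
      define a where "a = norm z"
      have a: "a \<ge> 0" by (simp add: a_def)
      \<comment> \<open>\<open>sqrt \<delta> * g\<close> is the linear part of the increment and \<open>R\<close> the quadratic remainder\<close>
      define g where "g = v x \<bullet> z"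
      define R where "R = ?F z - c - sqrt \<delta> * g"
      have sd: "sqrt \<delta> * sqrt \<delta> = \<delta>" "0 < sqrt \<delta>" "sqrt \<delta> \<le> 1" using \<delta> by auto
      have g: "\<bar>g\<bar> \<le> L * a"
      proof -
        have "\<bar>g\<bar> \<le> norm (v x) * a" unfolding g_def a_def by (rule Cauchy_Schwarz_ineq2)
        also have "\<dots> \<le> L * a" using v a by (intro mult_right_mono) auto
        finally show ?thesis .
      qed
      have R: "\<bar>R\<bar> \<le> \<delta> * (K * a\<^sup>2)"
      proof -
        have "K * ((sqrt \<delta> *\<^sub>R z) \<bullet> (sqrt \<delta> *\<^sub>R z)) = \<delta> * (K * a\<^sup>2)"
          unfolding dot_square_norm norm_scaleR power_mult_distrib using \<delta> by (simp add: a_def)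
        then show ?thesis
          using q[of x "sqrt \<delta> *\<^sub>R z"] by (simp only: R_def c_def g_def inner_scaleR_right)
      qed
      have \<delta>s: "\<delta> \<le> sqrt \<delta>" using sd \<delta> by (metis mult_left_le less_imp_le)
      have d: "\<bar>?F z - c\<bar> \<le> sqrt \<delta> * (B * (1 + a)\<^sup>2)"
      proof -
        have "\<bar>?F z - c\<bar> \<le> sqrt \<delta> * \<bar>g\<bar> + \<bar>R\<bar>" unfolding R_def using sd(2) abs_mult[of "sqrt \<delta>" g] by linarith
        also have "\<dots> \<le> sqrt \<delta> * (L * a) + sqrt \<delta> * (K * a\<^sup>2)"
          using g R sd mult_right_mono[OF \<delta>s, of "K * a\<^sup>2"] K by (intro add_mono mult_left_mono) auto
        also have "\<dots> = sqrt \<delta> * (L * a + K * a\<^sup>2)" by (simp add: algebra_simps)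
        also have "\<dots> \<le> sqrt \<delta> * (B * (1 + a)\<^sup>2)"
        proof (intro mult_left_mono)
          have "L * a \<le> L * (1 + a)\<^sup>2" "K * a\<^sup>2 \<le> K * (1 + a)\<^sup>2"
            using L K a by (auto intro!: mult_left_mono simp: power2_eq_square algebra_simps)
          then show "L * a + K * a\<^sup>2 \<le> B * (1 + a)\<^sup>2" by (simp add: B_def algebra_simps)
        qed (use sd in auto)
        finally show ?thesis .
      qed
      have sq: "(?F z - c)\<^sup>2 \<le> \<delta> * g\<^sup>2 + \<delta> * sqrt \<delta> * ((2 * L * K + K\<^sup>2) * Q z)"
      proof -
        have "(?F z - c)\<^sup>2 = (sqrt \<delta> * g + R)\<^sup>2" by (simp add: R_def)
        also have "\<dots> = \<delta> * g\<^sup>2 + 2 * (sqrt \<delta> * (g * R)) + R\<^sup>2"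
          using sd(1) by (simp add: power2_eq_square algebra_simps)
        also have "\<dots> \<le> \<delta> * g\<^sup>2 + 2 * (sqrt \<delta> * ((L * a) * (\<delta> * (K * a\<^sup>2)))) + \<delta> * sqrt \<delta> * (K * a\<^sup>2)\<^sup>2"
        proof (intro add_mono mult_left_mono order_refl)
          show "g * R \<le> (L * a) * (\<delta> * (K * a\<^sup>2))"
            using mult_mono[OF g R] L a abs_ge_self[of "g * R"] by (simp add: abs_mult)
          have "R\<^sup>2 \<le> (\<delta> * (K * a\<^sup>2))\<^sup>2" using R by (metis abs_ge_zero power2_abs power_mono)
          also have "\<dots> = \<delta> * \<delta> * (K * a\<^sup>2)\<^sup>2" by (simp add: power2_eq_square)
          also have "\<dots> \<le> \<delta> * sqrt \<delta> * (K * a\<^sup>2)\<^sup>2"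
            using \<delta>s \<delta> by (intro mult_right_mono mult_left_mono) auto
          finally show "R\<^sup>2 \<le> \<delta> * sqrt \<delta> * (K * a\<^sup>2)\<^sup>2" .
        qed (use sd in auto)
        also have "\<dots> = \<delta> * g\<^sup>2 + \<delta> * sqrt \<delta> * (2 * L * K * a ^ 3 + K\<^sup>2 * a ^ 4)"
          by (simp add: power2_eq_square power3_eq_cube power4_eq_xxxx algebra_simps)
        also have "\<dots> \<le> \<delta> * g\<^sup>2 + \<delta> * sqrt \<delta> * ((2 * L * K + K\<^sup>2) * Q z)"
        proof (intro add_mono mult_left_mono order_refl)
          have "a ^ k \<le> Q z" if "k \<le> 6" for k
          proof -
            have "a ^ k \<le> (1 + a) ^ k" using a by (intro power_mono) auto
            also have "\<dots> \<le> Q z" unfolding a_def by (rule Q[OF that])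
            finally show ?thesis .
          qed
          from this[of 3] this[of 4] have "a ^ 3 \<le> Q z" "a ^ 4 \<le> Q z" by auto
          then have "2 * L * K * a ^ 3 \<le> 2 * L * K * Q z" "K\<^sup>2 * a ^ 4 \<le> K\<^sup>2 * Q z"
            using L K by (auto intro!: mult_left_mono)
          then show "2 * L * K * a ^ 3 + K\<^sup>2 * a ^ 4 \<le> (2 * L * K + K\<^sup>2) * Q z" by (simp add: algebra_simps)
        qed (use \<delta> in auto)
        finally show ?thesis .
      qed
      have cu: "\<bar>?F z - c\<bar> ^ 3 \<le> \<delta> * sqrt \<delta> * (B ^ 3 * Q z)"
      proof -
        have "\<bar>?F z - c\<bar> ^ 3 \<le> (sqrt \<delta> * (B * (1 + a)\<^sup>2)) ^ 3" using d by (intro power_mono) auto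
        also have "\<dots> = (sqrt \<delta>) ^ 3 * (B ^ 3 * (1 + a) ^ 6)"
          by (simp add: power_mult_distrib power_mult[symmetric])
        also have "\<dots> = \<delta> * sqrt \<delta> * (B ^ 3 * (1 + a) ^ 6)" using sd(1) by (simp add: power3_eq_cube)
        also have "\<dots> \<le> \<delta> * sqrt \<delta> * (B ^ 3 * Q z)"
          using Q[of 6 z] B \<delta> by (intro mult_left_mono) (auto simp: a_def)
        finally show ?thesis .
      qed
      have Q0: "Q z \<ge> 0" by (simp add: Q_def)
      have "?F z * ln (?F z) - c * ln c - (?F z - c) * (ln c + 1)
          \<le> (?F z - c)\<^sup>2 / (2 * c) + \<bar>?F z - c\<bar> ^ 3 / (2 * c\<^sup>2)"
        by (rule entropy_taylor[OF c(1) fpos])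
      also have "\<dots> \<le> (\<delta> * g\<^sup>2 + \<delta> * sqrt \<delta> * ((2 * L * K + K\<^sup>2) * Q z)) / (2 * c) + \<delta> * sqrt \<delta> * (B ^ 3 * Q z) / (2 * \<epsilon>\<^sup>2)"
        using sq cu c \<epsilon> Q0 B \<delta> by (intro add_mono divide_right_mono frac_le power_mono) auto
      also have "\<dots> = \<delta> / (2 * c) * g\<^sup>2 + (\<delta> * sqrt \<delta> * ((2 * L * K + K\<^sup>2) * Q z)) / (2 * c) + \<delta> * sqrt \<delta> * (B ^ 3 * Q z) / (2 * \<epsilon>\<^sup>2)"
        by (simp add: add_divide_distrib)
      also have "(\<delta> * sqrt \<delta> * ((2 * L * K + K\<^sup>2) * Q z)) / (2 * c) \<le> (\<delta> * sqrt \<delta> * ((2 * L * K + K\<^sup>2) * Q z)) / (2 * \<epsilon>)"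
        using c \<epsilon> \<delta> L K Q0 by (intro divide_left_mono) auto
      finally have "?F z * ln (?F z) - c * ln c - (?F z - c) * (ln c + 1)
          \<le> \<delta> / (2 * c) * g\<^sup>2 + (\<delta> * sqrt \<delta> * ((2 * L * K + K\<^sup>2) * Q z)) / (2 * \<epsilon>) + \<delta> * sqrt \<delta> * (B ^ 3 * Q z) / (2 * \<epsilon>\<^sup>2)"
        by simp
      also have "\<dots> = \<delta> / (2 * c) * (v x \<bullet> z)\<^sup>2 + (\<delta> * sqrt \<delta>) * C0 * Q z"
        unfolding C0_def g_def by (simp add: algebra_simps)
      finally show "?F z * ln (?F z) - c * ln c - (?F z - c) * (ln c + 1)
          \<le> \<delta> / (2 * c) * (v x \<bullet> z)\<^sup>2 + (\<delta> * sqrt \<delta>) * C0 * Q z" .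
    qed
    also have "\<dots> = \<delta> / (2 * c) * (\<integral>z. (v x \<bullet> z)\<^sup>2 \<partial>std_gaussian) + (\<delta> * sqrt \<delta>) * C0 * (\<integral>z. Q z \<partial>std_gaussian)"
      using intQ std_gaussian_second_moment(1)[of "v x"] by simp
    also have "\<dots> \<le> \<delta> / (2 * c) * (v x \<bullet> v x) + (\<delta> * sqrt \<delta>) * C0 * (\<integral>z. Q z \<partial>std_gaussian)"
      using std_gaussian_second_moment(2)[of "v x"] \<delta> c by (intro add_right_mono mult_left_mono) auto
    also have "\<dots> = \<delta> / 2 * fisher f v x + (C0 * (\<integral>z. Q z \<partial>std_gaussian)) * (\<delta> * sqrt \<delta>)"
      by (simp add: fisher_def c_def mult_ac)
    finally show ?thesis .
  qed
  then show ?thesis by blast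
qed

text \<open>
  The chain rule for the entropy along the semigroup: the averages over time \<open>s\<close> of
  \<open>P\<^sub>t f ln (P\<^sub>t f)\<close> in the two terms cancel.
\<close>

lemma entropy_add_time:
  fixes f :: "'a::euclidean_space \<Rightarrow> real"
  assumes [measurable]: "f \<in> borel_measurable borel" and pos: "\<And>z. f z > 0" and le: "\<And>z. f z \<le> M"
    and st: "s \<ge> 0" "t \<ge> 0"
  shows "entropy (s + t) f x = heat s (entropy t f) x + entropy s (heat t f) x"
proof -
  have bd: "norm (f z) \<le> M" for z using pos[of z] le[of z] by simp
  have bdl: "norm (f z * ln (f z)) \<le> 1 + M\<^sup>2" for z using abs_mult_ln_le[OF pos le] by simp
  have hpos: "heat t f y > 0" for y by (rule heat_pos[OF _ pos le]) simp
  have "heat t f y \<le> M" for y using norm_heat_le[of f M t y] bd by simp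
  then have bdh: "norm (heat t f z * ln (heat t f z)) \<le> 1 + M\<^sup>2" for z using abs_mult_ln_le[OF hpos] by simp
  have "heat s (entropy t f) x = (\<integral>z. heat t (\<lambda>y. f y * ln (f y)) (x + sqrt s *\<^sub>R z) - heat t f (x + sqrt s *\<^sub>R z) * ln (heat t f (x + sqrt s *\<^sub>R z)) \<partial>std_gaussian)"
    by (simp add: heat_def[of s] entropy_def)
  also have "\<dots> = heat s (heat t (\<lambda>y. f y * ln (f y))) x - heat s (\<lambda>y. heat t f y * ln (heat t f y)) x"
    unfolding heat_def[of s]
  proof (rule Bochner_Integration.integral_diff)
    show "integrable std_gaussian (\<lambda>z. heat t (\<lambda>y. f y * ln (f y)) (x + sqrt s *\<^sub>R z))"
      by (rule integrable_std_gaussian_bounded[where M="1 + M\<^sup>2"]) (use norm_heat_le[OF bdl] in auto)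
    show "integrable std_gaussian (\<lambda>z. heat t f (x + sqrt s *\<^sub>R z) * ln (heat t f (x + sqrt s *\<^sub>R z)))"
      using integrable_std_gaussian_bounded[where f="\<lambda>y. heat t f y * ln (heat t f y)" and M="1 + M\<^sup>2" and x=x and c="sqrt s"] bdh by simp
  qed
  also have "heat s (heat t (\<lambda>y. f y * ln (f y))) x = heat (s + t) (\<lambda>y. f y * ln (f y)) x"
    using heat_heat[of "\<lambda>y. f y * ln (f y)" "1 + M\<^sup>2" s t] bdl st by simp
  finally show ?thesis
    using heat_heat[of f M s t] bd st by (simp add: entropy_def[abs_def])
qed

text \<open>
  In \<open>Suc n\<close> steps of length \<open>\<delta>\<close>, the chain rule contributes \<open>\<delta>/2\<close> times an averaged Fisher information for
  each step. A step bounds the entropy by the Fisher information at its starting point, not by an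
  average over the step, so after all of them are transferred to \<open>f\<close> by \<open>fisher_heat_le\<close> the average runs
  over the time \<open>n \<delta>\<close>.
\<close>

lemma entropy_iterate:
  fixes \<delta> c :: real and f :: "'a::euclidean_space \<Rightarrow> real"
  assumes \<epsilon>: "\<epsilon> > 0" and \<delta>: "\<delta> \<ge> 0"
    and step: "\<And>(f :: 'a \<Rightarrow> real) v x. regular_pair \<epsilon> M L K f v \<Longrightarrow> entropy \<delta> f x \<le> \<delta> / 2 * fisher f v x + c"
    and r: "regular_pair \<epsilon> M L K f v"
  shows "entropy (real (Suc n) * \<delta>) f x
    \<le> real (Suc n) * \<delta> / 2 * heat (real n * \<delta>) (fisher f v) x + real (Suc n) * c"
  using r
proof (induction n arbitrary: f v x)
  case 0
  then show ?case using step[OF 0] by simp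
next
  case (Suc n)
  note r = Suc.prems
  let ?t = "real (Suc n) * \<delta>"
  have t: "?t \<ge> 0" using \<delta> by simp
  have [measurable]: "f \<in> borel_measurable borel" and f: "\<epsilon> \<le> f y" "f y \<le> M" for y
    using r by (auto simp: regular_pair_def)
  have fpos: "f y > 0" for y using f[of y] \<epsilon> by linarith
  have bd: "norm (f y) \<le> M" for y using f[of y] fpos[of y] by simp
  note I = fisher_bounds[OF r \<epsilon>]
  have hpos: "heat \<delta> f y > 0" for y by (rule heat_pos[OF _ fpos f(2)]) simp
  have hM: "heat \<delta> f y \<le> M" for y using norm_heat_le[of f M \<delta> y] bd by simp
  have bdl: "norm (f z * ln (f z)) \<le> 1 + M\<^sup>2" for z using abs_mult_ln_le[OF fpos f(2)] by simp
  have bdE: "norm (entropy \<delta> f y) \<le> (1 + M\<^sup>2) + (1 + M\<^sup>2)" for y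
    unfolding entropy_def using norm_heat_le[of "\<lambda>y. f y * ln (f y)" "1 + M\<^sup>2" \<delta> y] bdl abs_mult_ln_le[OF hpos hM, of y]
      norm_triangle_ineq4[of "heat \<delta> (\<lambda>y. f y * ln (f y)) y" "heat \<delta> f y * ln (heat \<delta> f y)"] by simp
  have mE: "entropy \<delta> f \<in> borel_measurable borel" unfolding entropy_def[abs_def] by measurable
  have bdI: "norm (\<delta> / 2 * fisher f v y) \<le> \<delta> / 2 * (L\<^sup>2 / \<epsilon>)" for y
    using I(3)[of y] \<delta> unfolding norm_mult by (intro mult_mono) auto
  have bdS: "norm (\<delta> / 2 * fisher f v y + c) \<le> \<delta> / 2 * (L\<^sup>2 / \<epsilon>) + norm c" for y
    using norm_triangle_ineq[of "\<delta> / 2 * fisher f v y" c] bdI[of y] by linarith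
  have [measurable]: "fisher f v \<in> borel_measurable borel" by (rule I(1))
  have "real (Suc (Suc n)) * \<delta> = ?t + \<delta>" by (simp add: algebra_simps)
  then have "entropy (real (Suc (Suc n)) * \<delta>) f x = heat ?t (entropy \<delta> f) x + entropy ?t (heat \<delta> f) x"
    using entropy_add_time[where f=f and M=M and x=x, OF _ fpos f(2) t \<delta>] by simp
  also have "heat ?t (entropy \<delta> f) x \<le> heat ?t (\<lambda>y. \<delta> / 2 * fisher f v y + c) x"
    by (rule heat_mono[OF mE bdE _ bdS step[OF r]]) measurable
  also have "\<dots> = heat ?t (\<lambda>y. \<delta> / 2 * fisher f v y) x + c"
    using heat_add[of "\<lambda>y. \<delta> / 2 * fisher f v y" "\<delta> / 2 * (L\<^sup>2 / \<epsilon>)" "\<lambda>_. c" "norm c" ?t x] bdI by simp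
  also have "\<dots> = \<delta> / 2 * heat ?t (fisher f v) x + c"
    by (simp add: heat_def)
  finally have 1: "entropy (real (Suc (Suc n)) * \<delta>) f x
     \<le> \<delta> / 2 * heat ?t (fisher f v) x + c + entropy ?t (heat \<delta> f) x" by simp
  have r': "regular_pair \<epsilon> M L K (heat \<delta> f) (heat \<delta> v)" by (rule heat_regular_pair[OF r \<epsilon>])
  have "heat (n * \<delta>) (fisher (heat \<delta> f) (heat \<delta> v)) x \<le> heat (n * \<delta>) (heat \<delta> (fisher f v)) x"
    by (rule heat_mono[OF fisher_bounds(1)[OF r' \<epsilon>] fisher_bounds(3)[OF r' \<epsilon>] _ _ fisher_heat_le[OF r \<epsilon>], where N="L\<^sup>2 / \<epsilon>"])
       (use norm_heat_le[OF I(3)] in auto)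
  also have "heat (n * \<delta>) (heat \<delta> (fisher f v)) = heat (n * \<delta> + \<delta>) (fisher f v)"
    by (rule heat_heat[OF I(1) I(3)]) (use \<delta> in auto)
  also have "n * \<delta> + \<delta> = ?t" by (simp add: algebra_simps)
  finally have "?t / 2 * heat (n * \<delta>) (fisher (heat \<delta> f) (heat \<delta> v)) x \<le> ?t / 2 * heat ?t (fisher f v) x"
    using t by (intro mult_left_mono) auto
  then have 2: "entropy ?t (heat \<delta> f) x \<le> ?t / 2 * heat ?t (fisher f v) x + Suc n * c"
    using Suc.IH[OF r', of x] by linarith
  from 1 2 have "entropy (real (Suc (Suc n)) * \<delta>) f x
     \<le> \<delta> / 2 * heat ?t (fisher f v) x + c + (?t / 2 * heat ?t (fisher f v) x + Suc n * c)" by linarith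
  also have "\<dots> = Suc (Suc n) * \<delta> / 2 * heat ?t (fisher f v) x + Suc (Suc n) * c"
    by (simp add: field_simps)
  finally show ?case .
qed

text \<open>
  Time one is divided into \<open>Suc n\<close> steps; the accumulated error \<open>Suc n * (\<delta> * sqrt \<delta>) = sqrt \<delta>\<close> vanishes.
\<close>

lemma log_sobolev_regular_pair:
  assumes r: "regular_pair \<epsilon> M L K (f :: 'a::euclidean_space \<Rightarrow> real) v" and \<epsilon>: "\<epsilon> > 0" and K: "K \<ge> 0"
    and cf: "continuous_on UNIV f" and cv: "continuous_on UNIV v"
  shows "entropy 1 f x \<le> 1 / 2 * heat 1 (fisher f v) x"
proof -
  have fpos: "f y > 0" and vL: "norm (v y) \<le> L" for y using r \<epsilon> by (auto simp: regular_pair_def intro: less_le_trans)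
  have L: "L \<ge> 0" using vL norm_ge_zero order_trans by blast
  obtain C where C: "\<And>f v \<delta> x. regular_pair \<epsilon> M L K (f :: 'a \<Rightarrow> real) v \<Longrightarrow> 0 < \<delta> \<Longrightarrow> \<delta> \<le> 1 \<Longrightarrow>
     entropy \<delta> f x \<le> \<delta> / 2 * fisher f v x + C * (\<delta> * sqrt \<delta>)"
    using small_time_log_sobolev[OF \<epsilon> L K, where 'a='a] by blast
  have cI: "continuous_on UNIV (fisher f v)"
    unfolding fisher_def[abs_def] by (intro continuous_intros cf cv) (use fpos in \<open>auto simp: less_imp_neq[symmetric]\<close>)
  define e where "e n = inverse (real (Suc n))" for n
  have e0: "e \<longlonglongrightarrow> 0" unfolding e_def by (rule LIMSEQ_inverse_real_of_nat)
  have e: "0 < e n" "e n \<le> 1" "real (Suc n) * e n = 1" "real n * e n = 1 - e n" for n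
    by (auto simp: e_def field_simps)
  have le: "entropy 1 f x \<le> 1 / 2 * heat (1 - e n) (fisher f v) x + C * sqrt (e n)" for n
  proof -
    have "entropy (real (Suc n) * e n) f x \<le> real (Suc n) * e n / 2 * heat (real n * e n) (fisher f v) x
        + real (Suc n) * (C * (e n * sqrt (e n)))"
      by (rule entropy_iterate[OF \<epsilon> _ C r]) (use e in \<open>auto simp: less_imp_le\<close>)
    also have "real (Suc n) * (C * (e n * sqrt (e n))) = (real (Suc n) * e n) * (C * sqrt (e n))" by simp
    finally show ?thesis unfolding e by simp
  qed
  have "(\<lambda>n. 1 / 2 * heat (1 - e n) (fisher f v) x + C * sqrt (e n)) \<longlonglongrightarrow> 1 / 2 * heat (1 - 0) (fisher f v) x + C * sqrt 0"
    by (intro tendsto_intros tendsto_heat[OF cI fisher_bounds(3)[OF r \<epsilon>]] e0)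
  then show ?thesis
    using le by (intro LIMSEQ_le_const) auto
qed

lemma tendsto_heat_pointwise:
  fixes g :: "'a::euclidean_space \<Rightarrow> 'b::{banach, second_countable_topology}"
  assumes [measurable]: "\<And>n. f n \<in> borel_measurable borel" "g \<in> borel_measurable borel"
    and "\<And>y. (\<lambda>n. f n y) \<longlonglongrightarrow> g y" and "\<And>n y. norm (f n y) \<le> M"
  shows "(\<lambda>n. heat t (f n) x) \<longlonglongrightarrow> heat t g x"
  unfolding heat_def
  by (rule integral_dominated_convergence[where w="\<lambda>_. M"]) (use assms in auto)

lemma tendsto_mult_ln:
  fixes u :: real
  assumes "a \<longlonglongrightarrow> u" "u > 0"
  shows "(\<lambda>n. a n * ln (a n)) \<longlonglongrightarrow> u * ln u"
  using assms by (auto intro!: tendsto_intros)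

lemma tendsto_entropy:
  fixes f :: "'a::euclidean_space \<Rightarrow> real"
  assumes [measurable]: "\<And>n. g n \<in> borel_measurable borel" "f \<in> borel_measurable borel"
    and lim: "\<And>y. (\<lambda>n. g n y) \<longlonglongrightarrow> f y"
    and g: "\<And>n y. g n y > 0" "\<And>n y. g n y \<le> M" and f: "\<And>y. f y > 0" "\<And>y. f y \<le> M"
  shows "(\<lambda>n. entropy t (g n) x) \<longlonglongrightarrow> entropy t f x"
  unfolding entropy_def
proof (intro tendsto_diff tendsto_mult_ln)
  show "(\<lambda>n. heat t (\<lambda>y. g n y * ln (g n y)) x) \<longlonglongrightarrow> heat t (\<lambda>y. f y * ln (f y)) x"
    by (rule tendsto_heat_pointwise[where M="1 + M\<^sup>2"])
       (use abs_mult_ln_le[OF g] lim f in \<open>auto intro!: tendsto_mult_ln\<close>)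
  show "(\<lambda>n. heat t (g n) x) \<longlonglongrightarrow> heat t f x"
    by (rule tendsto_heat_pointwise[where M=M]) (use g lim in \<open>auto simp: abs_of_pos\<close>)
  show "heat t f x > 0" by (rule heat_pos[OF _ f]) simp
qed

text \<open>
  The heat flow for a short time \<open>e n\<close> puts \<open>f\<close> into a class of regular pairs. The constant of the class
  deteriorates as \<open>e n\<close> tends to zero, but the inequality for its members does not involve it.
\<close>

lemma log_sobolev_bounded_below:
  fixes f :: "'a::euclidean_space \<Rightarrow> real"
  assumes v: "\<And>y. GDERIV f y :> v y" and cv: "continuous_on UNIV v" and lip: "L-lipschitz_on UNIV f"
    and f: "\<And>y. \<epsilon> \<le> f y" "\<And>y. f y \<le> M" and \<epsilon>: "\<epsilon> > 0"
  shows "entropy 1 f x \<le> 1 / 2 * heat 1 (fisher f v) x"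
proof -
  have vL: "norm (v y) \<le> L" for y by (rule GDERIV_norm_le_lipschitz[OF v lip])
  have cf: "continuous_on UNIV f" using lip by (rule lipschitz_on_continuous_on)
  have mf [measurable]: "f \<in> borel_measurable borel" using cf by (rule borel_measurable_continuous_onI)
  have mv [measurable]: "v \<in> borel_measurable borel" using cv by (rule borel_measurable_continuous_onI)
  have fpos: "f y > 0" for y using f(1)[of y] \<epsilon> by linarith
  have bd: "norm (f y) \<le> M" for y using f(2)[of y] fpos[of y] by simp
  define e where "e n = inverse (real (Suc n))" for n
  have e0: "e \<longlonglongrightarrow> 0" unfolding e_def by (rule LIMSEQ_inverse_real_of_nat)
  have e: "0 < e n" for n by (simp add: e_def)
  have "\<exists>K. K \<ge> 0 \<and> regular_pair \<epsilon> M L K (heat t f) (heat t v)" if t: "t > 0" for t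
  proof -
    obtain K where "quadratic_approx (heat t f) (heat_grad t f) K"
      using heat_quadratic_approx[OF mf bd t] ..
    moreover have "heat_grad t f = heat t v"
      using heat_grad_eq_heat[OF v lip bd cv t] by (rule ext)
    ultimately have q: "quadratic_approx (heat t f) (heat t v) K" by simp
    have "K * (h \<bullet> h) \<le> max 0 K * (h \<bullet> h)" for h :: 'a by (intro mult_right_mono) auto
    with q have "quadratic_approx (heat t f) (heat t v) (max 0 K)"
      unfolding quadratic_approx_def by (meson order_trans)
    moreover have "\<epsilon> \<le> heat t f y" for y
      using heat_mono[of "\<lambda>_. \<epsilon>" \<epsilon> f M t y] bd f \<epsilon> by simp
    moreover have "heat t f y \<le> M" for y using norm_heat_le[of f M t y] bd by simp
    moreover have "norm (heat t v y) \<le> L" for y by (rule norm_heat_le[OF vL])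
    ultimately have "regular_pair \<epsilon> M L (max 0 K) (heat t f) (heat t v)"
      by (simp add: regular_pair_def)
    then show ?thesis by (intro exI[of _ "max 0 K"]) simp
  qed
  then have rp: "\<exists>K. K \<ge> 0 \<and> regular_pair \<epsilon> M L K (heat (e n) f) (heat (e n) v)" for n using e by blast
  have le: "entropy 1 (heat (e n) f) x \<le> 1 / 2 * heat 1 (fisher (heat (e n) f) (heat (e n) v)) x" for n
  proof -
    obtain K where K: "K \<ge> 0" "regular_pair \<epsilon> M L K (heat (e n) f) (heat (e n) v)" using rp by blast
    show ?thesis
      by (rule log_sobolev_regular_pair[OF K(2) \<epsilon> K(1)]) (intro continuous_on_heat[OF cf bd] continuous_on_heat[OF cv vL])+
  qed
  have b: "\<epsilon> \<le> heat (e n) f y" "heat (e n) f y \<le> M"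
    "fisher (heat (e n) f) (heat (e n) v) \<in> borel_measurable borel"
    "norm (fisher (heat (e n) f) (heat (e n) v) y) \<le> L\<^sup>2 / \<epsilon>" for n y
  proof -
    obtain K where K: "regular_pair \<epsilon> M L K (heat (e n) f) (heat (e n) v)" using rp by blast
    show "\<epsilon> \<le> heat (e n) f y" "heat (e n) f y \<le> M" using K by (auto simp: regular_pair_def)
    show "fisher (heat (e n) f) (heat (e n) v) \<in> borel_measurable borel"
      "norm (fisher (heat (e n) f) (heat (e n) v) y) \<le> L\<^sup>2 / \<epsilon>"
      using fisher_bounds[OF K \<epsilon>] by auto
  qed
  have lf: "(\<lambda>n. heat (e n) f y) \<longlonglongrightarrow> f y" for y
    using tendsto_heat[OF cf bd e0 tendsto_const, of y] by simp
  have lv: "(\<lambda>n. heat (e n) v y) \<longlonglongrightarrow> v y" for y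
    using tendsto_heat[OF cv vL e0 tendsto_const, of y] by simp
  have "(\<lambda>n. entropy 1 (heat (e n) f) x) \<longlonglongrightarrow> entropy 1 f x"
    by (rule tendsto_entropy[where M=M]) (use b lf fpos f \<epsilon> in \<open>auto intro: less_le_trans\<close>)
  moreover have "(\<lambda>n. 1 / 2 * heat 1 (fisher (heat (e n) f) (heat (e n) v)) x) \<longlonglongrightarrow> 1 / 2 * heat 1 (fisher f v) x"
  proof (intro tendsto_intros tendsto_heat_pointwise[where M="L\<^sup>2 / \<epsilon>"] b(3,4))
    show "fisher f v \<in> borel_measurable borel" unfolding fisher_def[abs_def] by measurable
    show "(\<lambda>n. fisher (heat (e n) f) (heat (e n) v) y) \<longlonglongrightarrow> fisher f v y" for y
      unfolding fisher_def by (intro tendsto_intros lf lv) (use fpos[of y] in simp)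
  qed
  ultimately show ?thesis by (rule LIMSEQ_le) (use le in blast)
qed

text \<open>
  Apply the previous inequality to \<open>f + e\<close> and let \<open>e\<close> decrease to zero. The Fisher information only
  grows in the limit, so no convergence is needed on the right-hand side, which may be infinite.
\<close>

theorem gaussian_log_sobolev:
  fixes f :: "'a::euclidean_space \<Rightarrow> real"
  assumes v: "\<And>y. GDERIV f y :> v y" and cv: "continuous_on UNIV v" and lip: "L-lipschitz_on UNIV f"
    and f: "\<And>y. 0 < f y" "\<And>y. f y \<le> M"
  shows "ennreal (entropy 1 f x) \<le> ennreal (1 / 2) * (\<integral>\<^sup>+z. ennreal (fisher f v (x + z)) \<partial>std_gaussian)"
proof -
  have vL: "norm (v y) \<le> L" for y by (rule GDERIV_norm_le_lipschitz[OF v lip])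
  have cf: "continuous_on UNIV f" using lip by (rule lipschitz_on_continuous_on)
  have mf [measurable]: "f \<in> borel_measurable borel" using cf by (rule borel_measurable_continuous_onI)
  have mv [measurable]: "v \<in> borel_measurable borel" using cv by (rule borel_measurable_continuous_onI)
  define e where "e n = inverse (real (Suc n))" for n
  have e0: "e \<longlonglongrightarrow> 0" unfolding e_def by (rule LIMSEQ_inverse_real_of_nat)
  have e: "0 < e n" "e n \<le> 1" for n by (auto simp: e_def field_simps)
  let ?I = "ennreal (1 / 2) * (\<integral>\<^sup>+z. ennreal (fisher f v (x + z)) \<partial>std_gaussian)"
  have le: "ennreal (entropy 1 (\<lambda>y. f y + e n) x) \<le> ?I" for n
  proof -
    let ?g = "\<lambda>y. f y + e n"
    have fe: "0 < f y + e n" for y using f(1)[of y] e(1)[of n] by linarith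
    have L: "L \<ge> 0" using vL norm_ge_zero order_trans by blast
    have "entropy 1 ?g x \<le> 1 / 2 * heat 1 (fisher ?g v) x"
    proof (rule log_sobolev_bounded_below[where \<epsilon>="e n" and M="M + 1" and L=L])
      show "GDERIV ?g y :> v y" for y using GDERIV_add[OF v[of y] GDERIV_const[of "e n" y]] by simp
      show "L-lipschitz_on UNIV ?g"
        using lip by (simp add: lipschitz_on_def dist_norm)
    qed (use e f vL cv in \<open>auto intro: add_mono less_imp_le\<close>)
    then have "ennreal (entropy 1 ?g x) \<le> ennreal (1 / 2 * heat 1 (fisher ?g v) x)" by (rule ennreal_leI)
    also have "\<dots> = ennreal (1 / 2) * ennreal (heat 1 (fisher ?g v) x)" by (rule ennreal_mult') simp
    also have "ennreal (heat 1 (fisher ?g v) x) = (\<integral>\<^sup>+z. ennreal (fisher ?g v (x + z)) \<partial>std_gaussian)"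
    proof -
      have bdI: "norm (fisher ?g v y) \<le> L\<^sup>2 / e n" for y
      proof -
        have "v y \<bullet> v y \<le> L\<^sup>2" using vL[of y] by (simp add: dot_square_norm power_mono)
        then show ?thesis unfolding fisher_def using e(1)[of n] f(1)[of y] 
          by (simp add: abs_of_nonneg) (intro frac_le, auto)
      qed
      have "integrable std_gaussian (\<lambda>z. fisher ?g v (x + z))"
        using integrable_std_gaussian_bounded[where f="fisher ?g v" and M="L\<^sup>2 / e n" and x=x and c=1] bdI
        by (simp add: fisher_def[abs_def])
      then show ?thesis unfolding heat_def
        by (subst nn_integral_eq_integral) (use fe in \<open>auto simp: fisher_def intro!: AE_I2 divide_nonneg_pos\<close>)
    qed
    also have "\<dots> \<le> (\<integral>\<^sup>+z. ennreal (fisher f v (x + z)) \<partial>std_gaussian)"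
      by (intro nn_integral_mono ennreal_leI)
         (use f e in \<open>auto simp: fisher_def intro!: divide_left_mono mult_pos_pos add_pos_pos intro: less_imp_le\<close>)
    finally show ?thesis by (simp add: mult_left_mono)
  qed
  have "(\<lambda>n. entropy 1 (\<lambda>y. f y + e n) x) \<longlonglongrightarrow> entropy 1 f x"
  proof (rule tendsto_entropy[where M="M + 1"])
    show "(\<lambda>n. f y + e n) \<longlonglongrightarrow> f y" for y using tendsto_add[OF tendsto_const e0, of "f y"] by simp
    show "f y \<le> M + 1" for y using f(2)[of y] by simp
  qed (use f e in \<open>auto intro: add_mono add_pos_pos\<close>)
  then have "(\<lambda>n. ennreal (entropy 1 (\<lambda>y. f y + e n) x)) \<longlonglongrightarrow> ennreal (entropy 1 f x)"
    by (rule tendsto_ennrealI)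
  then show ?thesis by (rule LIMSEQ_le_const2) (use le in blast)
qed

section \<open>Exponentials of nilpotent matrices\<close>

text \<open>
  The iterated matrix product in the exponential series; the operation \<open>^\<close> on this type is entrywise.
\<close>

definition mpow :: "real ^ 'n ^ 'n \<Rightarrow> nat \<Rightarrow> real ^ 'n ^ 'n" where
  "mpow M k = ((\<lambda>X. M ** X) ^^ k) (mat 1)"

lemma mpow_0 [simp]: "mpow M 0 = mat 1"
  and mpow_Suc: "mpow M (Suc k) = M ** mpow M k"
  by (auto simp: mpow_def)

lemma mpow_add: "mpow M (j + k) = mpow M j ** mpow M k"
  by (induction j) (simp_all add: mpow_Suc matrix_mul_assoc)

lemma scaleR_matrix_mult: "(c *\<^sub>R A) ** B = c *\<^sub>R (A ** B)" "A ** (c *\<^sub>R B) = c *\<^sub>R (A ** B)"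
  for A B :: "real ^ 'n ^ 'n"
  by (simp_all add: matrix_matrix_mult_def vec_eq_iff sum_distrib_left mult_ac)

lemma matrix_mult_add_left: "(A + B) ** C = A ** C + B ** C" for A B C :: "real ^ 'n ^ 'n"
  by (simp add: matrix_matrix_mult_def vec_eq_iff sum.distrib distrib_right)

lemma mpow_scaleR: "mpow (c *\<^sub>R M) k = c ^ k *\<^sub>R mpow M k"
  by (induction k) (simp_all add: mpow_Suc scaleR_matrix_mult)

lemma bounded_bilinear_matrix_mult: "bounded_bilinear ((**) :: real ^ 'n ^ 'n \<Rightarrow> real ^ 'n ^ 'n \<Rightarrow> real ^ 'n ^ 'n)"
proof -
  have "bilinear ((**) :: real ^ 'n ^ 'n \<Rightarrow> real ^ 'n ^ 'n \<Rightarrow> real ^ 'n ^ 'n)"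
    unfolding bilinear_def
    by (auto intro!: linearI simp: scaleR_matrix_mult matrix_add_ldistrib matrix_mult_add_left)
  then show ?thesis by (simp add: bilinear_conv_bounded_bilinear)
qed

interpretation matrix_mult: bounded_bilinear "(**) :: real ^ 'n ^ 'n \<Rightarrow> real ^ 'n ^ 'n \<Rightarrow> real ^ 'n ^ 'n"
  by (rule bounded_bilinear_matrix_mult)

lemma matrix_exp_nilpotent:
  assumes "\<And>k. k \<ge> n \<Longrightarrow> mpow M k = 0"
  shows "matrix_exp (c *\<^sub>R M) = (\<Sum>k<n. (c ^ k / fact k) *\<^sub>R mpow M k)"
proof -
  have "matrix_exp (c *\<^sub>R M) = (\<Sum>k. (1 / fact k) *\<^sub>R mpow (c *\<^sub>R M) k)"
    by (simp add: matrix_exp_def mpow_def)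
  also have "\<dots> = (\<Sum>k<n. (1 / fact k) *\<^sub>R mpow (c *\<^sub>R M) k)"
    by (rule suminf_finite) (auto simp: mpow_scaleR assms)
  finally show ?thesis by (simp add: mpow_scaleR)
qed

text \<open>
  The exponential series is a finite sum, so the functional equation is a rearrangement of a double sum
  and the binomial theorem; the terms with \<open>i + j \<ge> n\<close> vanish by nilpotency.
\<close>

lemma matrix_exp_nilpotent_add:
  assumes nil: "\<And>k. k \<ge> n \<Longrightarrow> mpow M k = 0"
  shows "matrix_exp ((s + t) *\<^sub>R M) = matrix_exp (s *\<^sub>R M) ** matrix_exp (t *\<^sub>R M)"
proof -
  have nz: "mpow M k \<noteq> 0 \<Longrightarrow> k < n" for k using nil[of k] by (cases "k < n") auto
  let ?g = "\<lambda>i j. (s ^ i / fact i * (t ^ j / fact j)) *\<^sub>R mpow M (i + j)"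
  have "matrix_exp (s *\<^sub>R M) ** matrix_exp (t *\<^sub>R M) = (\<Sum>i<n. \<Sum>j<n. ?g i j)"
    unfolding matrix_exp_nilpotent[where M=M and n=n, OF nil, simplified] matrix_mult.sum_left
    unfolding matrix_mult.sum_right
    by (simp add: scaleR_matrix_mult mpow_add mult_ac)
  also have "\<dots> = (\<Sum>(i,j)\<in>{..<n} \<times> {..<n}. ?g i j)" by (simp add: sum.cartesian_product)
  also have "\<dots> = (\<Sum>(i,j)\<in>{(i,j). i + j < n}. ?g i j)"
    by (rule sum.mono_neutral_right) (auto dest: nz)
  also have "\<dots> = (\<Sum>k<n. \<Sum>i\<le>k. ?g i (k - i))"
    by (rule sum.triangle_reindex)
  also have "\<dots> = (\<Sum>k<n. ((s + t) ^ k / fact k) *\<^sub>R mpow M k)"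
  proof (rule sum.cong[OF refl])
    fix k
    have "(\<Sum>i\<le>k. ?g i (k - i)) = (\<Sum>i\<le>k. s ^ i / fact i * (t ^ (k - i) / fact (k - i))) *\<^sub>R mpow M k"
      by (simp add: scaleR_sum_left)
    also have "(\<Sum>i\<le>k. s ^ i / fact i * (t ^ (k - i) / fact (k - i))) = (s + t) ^ k / fact k"
      unfolding binomial_ring sum_divide_distrib
      by (rule sum.cong[OF refl]) (simp add: binomial_fact)
    finally show "(\<Sum>i\<le>k. ?g i (k - i)) = ((s + t) ^ k / fact k) *\<^sub>R mpow M k" .
  qed
  finally show ?thesis by (simp add: matrix_exp_nilpotent[OF nil])
qed

lemma transpose_mpow: "transpose (mpow M k) = mpow (transpose M) k"
proof (induction k)
  case (Suc k)
  have "mpow (transpose M) (Suc k) = mpow (transpose M) k ** transpose M"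
    using mpow_add[of "transpose M" k 1] by (simp add: mpow_Suc)
  then show ?case by (simp add: mpow_Suc matrix_transpose_mul Suc)
qed simp

lemma mpow_graded:
  assumes gr: "\<And>a b. M $ a $ b \<noteq> 0 \<Longrightarrow> lev a = lev b + (1::nat)"
  shows "mpow M k $ a $ b \<noteq> 0 \<Longrightarrow> lev a = lev b + k"
proof (induction k arbitrary: a)
  case 0
  then show ?case by (auto simp: mat_def split: if_splits)
next
  case (Suc k)
  then obtain c where "M $ a $ c * mpow M k $ c $ b \<noteq> 0"
    by (auto simp: mpow_Suc matrix_matrix_mult_def elim: sum.not_neutral_contains_not_neutral)
  then show ?case using gr[of a c] Suc.IH[of c] by auto
qed

text \<open>
  The determinant of a unitriangular matrix, for an index type that carries no order but only a level
  function. In the Leibniz formula a permutation with a nonzero product cannot increase any level; it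
  preserves the sum of the levels, so it fixes every level and hence every index.
\<close>

lemma det_unitriangular_graded:
  fixes X :: "real ^ 'n ^ 'n" and lev :: "'n \<Rightarrow> nat"
  assumes d: "\<And>a. X $ a $ a = 1" and gr: "\<And>a b. X $ a $ b \<noteq> 0 \<Longrightarrow> a \<noteq> b \<Longrightarrow> lev b < lev a"
  shows "det X = 1"
proof -
  have z: "(\<Prod>i\<in>UNIV. X $ i $ p i) = 0" if p: "p permutes UNIV" "p \<noteq> id" for p
  proof (rule ccontr)
    assume "\<not> ?thesis"
    then have nz: "X $ i $ p i \<noteq> 0" for i by auto
    have le: "lev (p i) \<le> lev i" for i using gr[OF nz[of i]] by (cases "i = p i") auto
    obtain j where j: "p j \<noteq> j" using p(2) by (auto simp: fun_eq_iff)
    have "(\<Sum>i\<in>UNIV. lev (p i)) < (\<Sum>i\<in>UNIV. lev i)"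
      by (rule sum_strict_mono_ex1) (use le gr[OF nz[of j]] j in auto)
    moreover have "(\<Sum>i\<in>UNIV. lev (p i)) = (\<Sum>i\<in>UNIV. lev i)"
      using sum.permute[OF p(1), of lev] by (simp add: comp_def)
    ultimately show False by simp
  qed
  have "det X = (\<Sum>p\<in>{p. p permutes UNIV}. of_int (sign p) * (\<Prod>i\<in>UNIV. X $ i $ p i))"
    by (simp add: det_def)
  also have "\<dots> = (\<Sum>p\<in>{id}. of_int (sign p) * (\<Prod>i\<in>UNIV. X $ i $ p i))"
    by (rule sum.mono_neutral_right) (auto simp: z permutes_id finite_permutations)
  also have "\<dots> = 1" by (simp add: d sign_id)
  finally show ?thesis .
qed

text \<open>
  Gram-Schmidt for the inner product \<open>\<langle>C u, v\<rangle>\<close> yields an orthonormal basis. With its vectors as the rows of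
  \<open>W\<close> this says \<open>W C W\<^sup>* = 1\<close>, so \<open>S = W\<^sup>-\<^sup>1\<close> is the desired factor.
\<close>

lemma pos_def_factorization:
  fixes C :: "real ^ 'n ^ 'n"
  assumes sym: "transpose C = C" and pd: "\<And>v. v \<noteq> 0 \<Longrightarrow> (C *v v) \<bullet> v > 0"
  shows "\<exists>S :: real ^ 'n ^ 'n. invertible S \<and> C = S ** transpose S"
proof -
  let ?ip = "\<lambda>u v. (C *v u) \<bullet> v"
  have sy: "?ip u v = ?ip v u" for u v
    by (metis sym dot_lmul_matrix inner_commute transpose_matrix_vector matrix_vector_mul_linear vector_transpose_matrix)
  define orth where "orth U \<longleftrightarrow> (\<forall>u\<in>U. \<forall>v\<in>U. ?ip u v = (if u = v then 1 else 0))" for U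
  have ind: "independent U" if U: "orth U" for U
  proof -
    have "x \<notin> span (U - {x})" if x: "x \<in> U" for x
    proof
      assume "x \<in> span (U - {x})"
      moreover have "?ip x w = 0" if "w \<in> span (U - {x})" for w
        using that
      proof (induction rule: span_induct_alt)
        case (step c y z)
        then show ?case using U x by (auto simp: orth_def inner_add_right)
      qed simp
      moreover have "?ip x x = 1" using U x by (auto simp: orth_def)
      ultimately show False by force
    qed
    then show ?thesis by (auto simp: dependent_def)
  qed
  have fin: "finite U \<and> card U \<le> CARD('n)" if U: "orth U" for U
    using independent_bound[OF ind[OF U]] by simp
  have ex: "\<exists>U. orth U \<and> card U = k" if "k \<le> CARD('n)" for k
    using that
  proof (induction k)
    case 0
    show ?case by (rule exI[of _ "{}"]) (simp add: orth_def)
  next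
    case (Suc k)
    then obtain U where U: "orth U" "card U = k" by auto
    have "span U \<noteq> UNIV"
    proof
      assume "span U = UNIV"
      then have "card U = DIM(real ^ 'n)"
        using ind[OF U(1)] by (metis dim_UNIV dim_eq_card_independent dim_span)
      then show False using U Suc.prems by simp
    qed
    then obtain x where x: "x \<notin> span U" by auto
    define y where "y = x - (\<Sum>u\<in>U. ?ip x u *\<^sub>R u)"
    have y0: "y \<noteq> 0"
    proof
      assume "y = 0"
      then have "x = (\<Sum>u\<in>U. ?ip x u *\<^sub>R u)" by (simp add: y_def)
      then show False using x by (metis (no_types, lifting) span_base span_scale span_sum)
    qed
    have yu: "?ip y u = 0" if u: "u \<in> U" for u
    proof -
      have "?ip (\<Sum>u\<in>U. ?ip x u *\<^sub>R u) u = (\<Sum>w\<in>U. ?ip x w * ?ip w u)"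
        by (simp add: linear_sum[OF matrix_vector_mul_linear] inner_sum_left linear_cmul[OF matrix_vector_mul_linear])
      also have "\<dots> = (\<Sum>w\<in>U. if w = u then ?ip x w else 0)"
        by (rule sum.cong) (use U u in \<open>auto simp: orth_def\<close>)
      also have "\<dots> = ?ip x u" using fin[OF U(1)] u by simp
      finally show ?thesis by (simp add: y_def matrix_vector_mult_diff_distrib inner_diff_left)
    qed
    \<comment> \<open>\<open>y\<close> is the component of \<open>x\<close> orthogonal to \<open>U\<close>; it only has to be normalised\<close>
    define z where "z = (1 / sqrt (?ip y y)) *\<^sub>R y"
    have yy: "?ip y y > 0" by (rule pd[OF y0])
    have zz: "?ip z z = 1" using yy by (simp add: z_def linear_cmul[OF matrix_vector_mul_linear])
    have zu: "?ip z u = 0" if "u \<in> U" for u using yu[OF that] by (simp add: z_def linear_cmul[OF matrix_vector_mul_linear])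
    have "z \<notin> U" using zz zu by force
    moreover have "orth (insert z U)"
      using U(1) zz zu sy \<open>z \<notin> U\<close> unfolding orth_def by (auto split: if_splits)
    ultimately show ?case using U fin[OF U(1)] by (intro exI[of _ "insert z U"]) simp
  qed
  then obtain U where U: "orth U" "card U = CARD('n)" by blast
  then obtain g where g: "bij_betw g (UNIV :: 'n set) U"
    using fin finite_same_card_bij[of "UNIV :: 'n set" U] by auto
  define W :: "real ^ 'n ^ 'n" where "W = (\<chi> i. g i)"
  have gU: "g i \<in> U" for i using g by (auto simp: bij_betw_def)
  have ginj: "g i = g j \<longleftrightarrow> i = j" for i j using g by (auto simp: bij_betw_def inj_on_def)
  have ent: "(W ** C ** transpose W) $ i $ j = ?ip (g j) (g i)" for i j
  proof -
    have "(W ** (C ** transpose W)) $ i $ j = g i \<bullet> (C *v g j)"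
      unfolding matrix_matrix_mult_def matrix_vector_mult_def W_def inner_vec_def transpose_def by simp
    then show ?thesis by (simp add: matrix_mul_assoc inner_commute)
  qed
  have WCW: "W ** C ** transpose W = mat 1"
    using U(1) gU ginj by (auto simp: vec_eq_iff ent mat_def orth_def)
  have "invertible W" using WCW by (metis matrix_mul_assoc invertible_right_inverse)
  then obtain S where SW: "S ** W = mat 1" "W ** S = mat 1" by (auto simp: invertible_def)
  have "S ** (W ** C ** transpose W) ** transpose S = C"
  proof -
    have "S ** (W ** C ** transpose W) ** transpose S = (S ** W) ** C ** (transpose W ** transpose S)"
      by (simp add: matrix_mul_assoc)
    then show ?thesis using SW by (simp flip: matrix_transpose_mul)
  qed
  then have "C = S ** transpose S" by (simp add: WCW)
  moreover have "invertible S" using SW by (auto simp: invertible_def)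
  ultimately show ?thesis by blast
qed

section \<open>Linear changes of variables\<close>

lemma borel_measurable_matrix_vector_mult [measurable]:
  fixes A :: "real ^ 'n ^ 'm"
  shows "(*v) A \<in> borel_measurable borel"
  by (intro borel_measurable_continuous_onI linear_continuous_on) (simp add: matrix_vector_mul_bounded_linear)

text \<open>
  A shear moves each line in the direction \<open>b0\<close> by a constant. Integrating along these lines first, the
  claim is translation invariance in dimension one.
\<close>

lemma nn_integral_lborel_shear:
  fixes g :: "'a::euclidean_space \<Rightarrow> ennreal" and l :: "'a \<Rightarrow> real"
  assumes [measurable]: "g \<in> borel_measurable borel" "l \<in> borel_measurable borel"
    and b0: "b0 \<in> Basis" and l: "\<And>x c. l (x + c *\<^sub>R b0) = l x"
  shows "(\<integral>\<^sup>+x. g (x + l x *\<^sub>R b0) \<partial>lborel) = (\<integral>\<^sup>+x. g x \<partial>lborel)"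
proof -
  interpret product_sigma_finite "\<lambda>_::'a. lborel :: real measure" ..
  let ?B = "Basis - {b0} :: 'a set"
  let ?r = "\<lambda>\<omega>. \<Sum>b\<in>?B. \<omega> b *\<^sub>R b"
  have B: "Basis = insert b0 ?B" using b0 by auto
  have disint: "(\<integral>\<^sup>+x. G x \<partial>lborel) = (\<integral>\<^sup>+\<omega>. \<integral>\<^sup>+y. G (?r \<omega> + y *\<^sub>R b0) \<partial>lborel \<partial>(\<Pi>\<^sub>M b\<in>?B. lborel))"
    if [measurable]: "G \<in> borel_measurable borel" for G :: "'a \<Rightarrow> ennreal"
  proof -
    have "(\<integral>\<^sup>+x. G x \<partial>lborel) = (\<integral>\<^sup>+\<omega>. G (\<Sum>b\<in>Basis. \<omega> b *\<^sub>R b) \<partial>(\<Pi>\<^sub>M b\<in>Basis. lborel))"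
      by (subst lborel_eq) (simp add: nn_integral_distr)
    also have "\<dots> = (\<integral>\<^sup>+\<omega>. G (\<Sum>b\<in>insert b0 ?B. \<omega> b *\<^sub>R b) \<partial>(\<Pi>\<^sub>M b\<in>insert b0 ?B. lborel))"
      using B by simp
    also have "\<dots> = (\<integral>\<^sup>+\<omega>. \<integral>\<^sup>+y. G (\<Sum>b\<in>insert b0 ?B. (fun_upd \<omega> b0 y) b *\<^sub>R b) \<partial>lborel \<partial>(\<Pi>\<^sub>M b\<in>?B. lborel))"
      by (rule product_nn_integral_insert) (auto simp: measurable_split_conv)
    also have "(\<lambda>\<omega> y. \<Sum>b\<in>insert b0 ?B. (fun_upd \<omega> b0 y) b *\<^sub>R b) = (\<lambda>\<omega> y. ?r \<omega> + y *\<^sub>R b0)"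
    proof (intro ext)
      fix \<omega> y
      have "(\<Sum>b\<in>?B. (fun_upd \<omega> b0 y) b *\<^sub>R b) = ?r \<omega>" by (rule sum.cong) auto
      moreover have "(\<Sum>b\<in>insert b0 ?B. (fun_upd \<omega> b0 y) b *\<^sub>R b)
          = (fun_upd \<omega> b0 y) b0 *\<^sub>R b0 + (\<Sum>b\<in>?B. (fun_upd \<omega> b0 y) b *\<^sub>R b)"
        by (rule sum.insert) auto
      ultimately show "(\<Sum>b\<in>insert b0 ?B. (fun_upd \<omega> b0 y) b *\<^sub>R b) = ?r \<omega> + y *\<^sub>R b0"
        by (simp only: fun_upd_same add.commute)
    qed
    finally show ?thesis by meson
  qed
  have "(\<integral>\<^sup>+x. g (x + l x *\<^sub>R b0) \<partial>lborel)
      = (\<integral>\<^sup>+\<omega>. \<integral>\<^sup>+y. g (?r \<omega> + (l (?r \<omega>) + y) *\<^sub>R b0) \<partial>lborel \<partial>(\<Pi>\<^sub>M b\<in>?B. lborel))"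
  proof (subst disint)
    have "?r \<omega> + y *\<^sub>R b0 + l (?r \<omega> + y *\<^sub>R b0) *\<^sub>R b0 = ?r \<omega> + (l (?r \<omega>) + y) *\<^sub>R b0" for \<omega> y
      unfolding l by (simp add: scaleR_add_left)
    then show "(\<integral>\<^sup>+\<omega>. \<integral>\<^sup>+y. g (?r \<omega> + y *\<^sub>R b0 + l (?r \<omega> + y *\<^sub>R b0) *\<^sub>R b0) \<partial>lborel \<partial>(\<Pi>\<^sub>M b\<in>?B. lborel))
      = (\<integral>\<^sup>+\<omega>. \<integral>\<^sup>+y. g (?r \<omega> + (l (?r \<omega>) + y) *\<^sub>R b0) \<partial>lborel \<partial>(\<Pi>\<^sub>M b\<in>?B. lborel))"
      by (simp only:)
  qed simp
  also have "\<dots> = (\<integral>\<^sup>+\<omega>. \<integral>\<^sup>+y. g (?r \<omega> + y *\<^sub>R b0) \<partial>lborel \<partial>(\<Pi>\<^sub>M b\<in>?B. lborel))"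
  proof (rule nn_integral_cong)
    fix \<omega>
    show "(\<integral>\<^sup>+y. g (?r \<omega> + (l (?r \<omega>) + y) *\<^sub>R b0) \<partial>lborel) = (\<integral>\<^sup>+y. g (?r \<omega> + y *\<^sub>R b0) \<partial>lborel)"
      using nn_integral_lborel_affine[of "\<lambda>y. g (?r \<omega> + y *\<^sub>R b0)" 1 "l (?r \<omega>)"] by simp
  qed
  also have "\<dots> = (\<integral>\<^sup>+x. g x \<partial>lborel)" by (rule disint[symmetric]) simp
  finally show ?thesis .
qed

lemma nn_integral_lborel_permute_coordinates:
  fixes g :: "real ^ 'n \<Rightarrow> ennreal" and p :: "'n \<Rightarrow> 'n"
  assumes [measurable]: "g \<in> borel_measurable borel" and p: "p permutes UNIV"
  shows "(\<integral>\<^sup>+x. g (\<chi> i. x $ p i) \<partial>lborel) = (\<integral>\<^sup>+x. g x \<partial>lborel)"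
proof -
  let ?f = "\<lambda>x :: real ^ 'n. \<chi> i. x $ p i"
  have lin: "linear ?f" by (rule linearI) (auto simp: vec_eq_iff)
  have [measurable]: "?f \<in> borel_measurable borel"
    by (intro borel_measurable_continuous_onI linear_continuous_on linear_conv_bounded_linear[THEN iffD1] lin)
  have prodB: "(\<Prod>b\<in>Basis. h (b :: real ^ 'n)) = (\<Prod>i\<in>UNIV. h (axis i 1))" for h :: "real ^ 'n \<Rightarrow> real"
    unfolding Basis_vec_def
    by (subst prod.reindex[symmetric, unfolded o_def, where h="\<lambda>i. axis i (1::real)"])
       (auto simp: inj_on_def axis_eq_axis intro!: prod.cong)
  have "lborel = distr lborel borel ?f"
  proof (rule lborel_eqI)
    fix l u :: "real ^ 'n"
    assume lu: "\<And>b. b \<in> Basis \<Longrightarrow> l \<bullet> b \<le> u \<bullet> b"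
    let ?q = "Hilbert_Choice.inv p"
    let ?h = "\<lambda>x :: real ^ 'n. \<chi> i. x $ ?q i"
    have pq: "p (?q i) = i" "?q (p i) = i" for i using permutes_inverses[OF p] by auto
    have lu': "l $ i \<le> u $ i" for i using lu[of "axis i 1"] by (simp add: inner_axis)
    have "?f -` box l u = box (?h l) (?h u)"
      by (auto simp: mem_box_cart) (metis pq)+
    then have "emeasure (distr lborel borel ?f) (box l u) = emeasure lborel (box (?h l) (?h u))"
      by (simp add: emeasure_distr)
    also have "\<dots> = (\<Prod>b\<in>Basis. (?h u - ?h l) \<bullet> b)"
      by (rule emeasure_lborel_box) (use lu' in \<open>auto simp: Basis_vec_def inner_axis\<close>)
    also have "(\<Prod>b\<in>Basis. (?h u - ?h l) \<bullet> b) = (\<Prod>i\<in>UNIV. (u - l) $ ?q i)"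
      by (simp add: prodB inner_axis)
    also have "\<dots> = (\<Prod>i\<in>UNIV. (u - l) $ i)"
      using prod.permute[OF permutes_inv[OF p], of "\<lambda>i. (u - l) $ i"] by (simp add: o_def)
    also have "\<dots> = (\<Prod>b\<in>Basis. (u - l) \<bullet> b)" by (simp add: prodB inner_axis)
    finally show "emeasure (distr lborel borel ?f) (box l u) = (\<Prod>b\<in>Basis. (u - l) \<bullet> b)" .
  qed simp
  then have "(\<integral>\<^sup>+x. g x \<partial>lborel) = (\<integral>\<^sup>+x. g x \<partial>(distr lborel borel ?f))" by simp
  also have "\<dots> = (\<integral>\<^sup>+x. g (?f x) \<partial>lborel)" by (rule nn_integral_distr) auto
  finally show ?thesis by simp
qed

text \<open>
  The change of variables formula for an arbitrary finite index type, by reduction to elementary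
  matrices: diagonal matrices, transpositions of coordinates and shears.
\<close>

lemma nn_integral_lborel_linear:
  fixes A :: "real ^ 'n ^ 'n"
  assumes "det A \<noteq> 0" "g \<in> borel_measurable borel"
  shows "(\<integral>\<^sup>+x. g x \<partial>lborel) = ennreal \<bar>det A\<bar> * (\<integral>\<^sup>+x. g (A *v x) \<partial>lborel)"
proof -
  let ?P = "\<lambda>A :: real ^ 'n ^ 'n. det A \<noteq> 0 \<longrightarrow> (\<forall>g \<in> borel_measurable borel.
     (\<integral>\<^sup>+x. g x \<partial>lborel) = ennreal \<bar>det A\<bar> * (\<integral>\<^sup>+x. g (A *v x) \<partial>lborel))"
  have "?P A"
  proof (rule induct_matrix_elementary_alt[where P="?P"])
    fix A B :: "real ^ 'n ^ 'n" assume A: "?P A" and B: "?P B"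
    show "?P (A ** B)"
    proof (intro impI ballI)
      fix g :: "real ^ 'n \<Rightarrow> ennreal" assume g[measurable]: "g \<in> borel_measurable borel" and "det (A ** B) \<noteq> 0"
      then have d: "det A \<noteq> 0" "det B \<noteq> 0" by (auto simp: det_mul)
      have "(\<lambda>x. g (A *v x)) \<in> borel_measurable borel" by measurable
      from bspec[OF mp[OF B d(2)] this]
      have "(\<integral>\<^sup>+x. g x \<partial>lborel) = ennreal \<bar>det A\<bar> * (ennreal \<bar>det B\<bar> * (\<integral>\<^sup>+x. g (A *v (B *v x)) \<partial>lborel))"
        using bspec[OF mp[OF A d(1)] g] by (simp only:)
      then show "(\<integral>\<^sup>+x. g x \<partial>lborel) = ennreal \<bar>det (A ** B)\<bar> * (\<integral>\<^sup>+x. g (A ** B *v x) \<partial>lborel)"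
        by (simp add: det_mul abs_mult ennreal_mult mult.assoc matrix_vector_mul_assoc)
    qed
  next
    fix A :: "real ^ 'n ^ 'n" and i assume "row i A = 0"
    then show "?P A" by (simp add: det_zero_row)
  next
    fix A :: "real ^ 'n ^ 'n" assume 0: "\<And>i j. i \<noteq> j \<Longrightarrow> A $ i $ j = 0"
    show "?P A"
    proof (intro impI ballI)
      fix g :: "real ^ 'n \<Rightarrow> ennreal" assume g[measurable]: "g \<in> borel_measurable borel" and "det A \<noteq> 0"
      define c where "c j = (A *v j) \<bullet> j" for j :: "real ^ 'n"
      have cax: "c (axis i 1) = A $ i $ i" for i by (simp add: c_def inner_axis matrix_vector_mul_component)
      have det: "det A = (\<Prod>i\<in>UNIV. A $ i $ i)" by (rule det_diagonal[OF 0])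
      have c: "c j \<noteq> 0" if "j \<in> Basis" for j
        using that \<open>det A \<noteq> 0\<close> cax by (auto simp: det Basis_vec_def)
      have inj: "inj (\<lambda>i::'n. axis i (1::real))" by (auto simp: inj_on_def axis_eq_axis)
      have Bas: "Basis = range (\<lambda>i::'n. axis i (1::real))" by (auto simp: Basis_vec_def)
      have Av: "0 + (\<Sum>j\<in>Basis. (c j * (x \<bullet> j)) *\<^sub>R j) = A *v x" for x
      proof -
        have "(\<Sum>j\<in>Basis. (c j * (x \<bullet> j)) *\<^sub>R j) = (\<Sum>i\<in>UNIV. (A $ i $ i * x $ i) *\<^sub>R axis i 1)"
          unfolding Bas by (subst sum.reindex[OF inj]) (simp add: o_def cax inner_axis)
        also have "\<dots> = A *v x"
        proof -
          have "(\<Sum>i\<in>UNIV. (A $ i $ i * x $ i) * axis i 1 $ k) = (A *v x) $ k" for k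
          proof -
            have "(\<Sum>i\<in>UNIV. (A $ i $ i * x $ i) * axis i 1 $ k) = A $ k $ k * x $ k"
              by (simp add: axis_def if_distrib cong: if_cong)
            also have "\<dots> = (\<Sum>j\<in>UNIV. if j = k then A $ k $ j * x $ j else 0)" by simp
            also have "\<dots> = (A *v x) $ k" unfolding matrix_vector_mult_def vec_lambda_beta
              by (intro sum.cong) (auto simp: 0)
            finally show ?thesis .
          qed
          then show ?thesis by (simp add: vec_eq_iff)
        qed
        finally show ?thesis by simp
      qed
      have pr: "(\<Prod>j\<in>Basis. \<bar>c j\<bar>) = \<bar>det A\<bar>"
        unfolding Bas det abs_prod by (subst prod.reindex[OF inj]) (simp add: o_def cax)
      have "lborel = density (distr lborel borel (\<lambda>x. A *v x)) (\<lambda>_. ennreal \<bar>det A\<bar>)"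
        using lborel_affine_euclidean[of c 0, OF c] unfolding Av pr by simp
      then have "(\<integral>\<^sup>+x. g x \<partial>lborel) = (\<integral>\<^sup>+x. g x \<partial>(density (distr lborel borel (\<lambda>x. A *v x)) (\<lambda>_. ennreal \<bar>det A\<bar>)))"
        by simp
      also have "\<dots> = ennreal \<bar>det A\<bar> * (\<integral>\<^sup>+x. g (A *v x) \<partial>lborel)"
        by (subst nn_integral_density) (auto simp: nn_integral_distr nn_integral_cmult)
      finally show "(\<integral>\<^sup>+x. g x \<partial>lborel) = ennreal \<bar>det A\<bar> * (\<integral>\<^sup>+x. g (A *v x) \<partial>lborel)" .
    qed
  next
    fix m n :: 'n assume mn: "m \<noteq> n"
    let ?p = "Transposition.transpose m n"
    let ?A = "(\<chi> i j. mat 1 $ i $ ?p j) :: real ^ 'n ^ 'n"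
    have Av: "?A *v x = (\<chi> i. x $ ?p i)" for x
    proof -
      have "(\<Sum>j\<in>UNIV. (mat 1 :: real ^ 'n ^ 'n) $ i $ ?p j * x $ j) = (\<Sum>j\<in>UNIV. if j = ?p i then x $ j else 0)" for i
        by (rule sum.cong) (auto simp: mat_def transpose_eq_iff)
      then show ?thesis by (simp add: matrix_vector_mult_def vec_eq_iff)
    qed
    have "(?A ** ?A) *v x = mat 1 *v x" for x
      by (simp add: matrix_vector_mul_assoc[symmetric] Av)
    then have "?A ** ?A = mat 1" by (metis matrix_eq)
    then have "det ?A * det ?A = 1" by (metis det_I det_mul)
    then have "(det ?A)\<^sup>2 = 1" by (simp add: power2_eq_square)
    then have "\<bar>det ?A\<bar> = 1" by (auto simp: power2_eq_1_iff)
    then show "?P ?A"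
      by (auto simp: Av nn_integral_lborel_permute_coordinates permutes_swap_id)
  next
    fix m n :: 'n assume mn: "m \<noteq> n"
    let ?A = "(\<chi> i j. of_bool (i = m \<and> j = n \<or> i = j)) :: real ^ 'n ^ 'n"
    have det: "det ?A = 1"
      by (rule det_unitriangular_graded[where lev="\<lambda>i. if i = m then 1 else 0"]) (use mn in auto)
    have Av: "?A *v x = x + (x $ n) *\<^sub>R axis m 1" for x
    proof -
      have "(\<Sum>j\<in>UNIV. of_bool (i = m \<and> j = n \<or> i = j) * x $ j)
        = (\<Sum>j\<in>UNIV. (if j = i then x $ j else 0) + (if j = n then of_bool (i = m) * x $ j else 0))" for i
        by (rule sum.cong) (use mn in auto)
      then show ?thesis by (simp add: matrix_vector_mult_def vec_eq_iff sum.distrib axis_def)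
    qed
    show "?P ?A"
      unfolding det Av
      by (auto intro!: nn_integral_lborel_shear[symmetric] simp: axis_in_Basis_iff) (use mn in \<open>auto simp: axis_def\<close>)
  qed
  then show ?thesis using assms by blast
qed

section \<open>The drift exponential and the covariance\<close>

lemma inner_matrix_vector_mult: "(A *v x) \<bullet> y = x \<bullet> (transpose A *v y)" for A :: "real ^ 'n ^ 'm"
  by (metis dot_lmul_matrix transpose_matrix_vector transpose_transpose)

text \<open>
  The structure of the drift that matters for its exponential: \<open>B\<close> maps each level to the preceding one,
  so that \<open>B\<^sup>*\<close> is nilpotent and its exponential is unitriangular with respect to the levels.
\<close>

locale graded_drift =
  fixes B :: "real ^ 'n ^ 'n" and lev :: "'n \<Rightarrow> nat" and r :: nat
  assumes graded: "\<And>a b. B $ a $ b \<noteq> 0 \<Longrightarrow> lev b = lev a + 1" and lev_le: "\<And>a. lev a \<le> r"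
begin

lemma mpow_transpose_graded: "mpow (transpose B) k $ a $ b \<noteq> 0 \<Longrightarrow> lev a = lev b + k"
  by (rule mpow_graded) (use graded in \<open>auto simp: transpose_def\<close>)

lemma mpow_transpose_nilpotent: "k \<ge> Suc r \<Longrightarrow> mpow (transpose B) k = 0"
proof -
  assume "k \<ge> Suc r"
  have "mpow (transpose B) k $ a $ b = 0" for a b
  proof (rule ccontr)
    assume "\<not> ?thesis"
    then have "lev a = lev b + k" by (rule mpow_transpose_graded)
    with lev_le[of a] \<open>k \<ge> Suc r\<close> show False by simp
  qed
  then show ?thesis by (simp add: vec_eq_iff)
qed

lemma E_mat_sum: "E_mat B t = (\<Sum>k<Suc r. ((- t) ^ k / fact k) *\<^sub>R mpow (transpose B) k)"
  unfolding E_mat_def by (rule matrix_exp_nilpotent) (rule mpow_transpose_nilpotent)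

lemma E_mat_add: "E_mat B (s + t) = E_mat B s ** E_mat B t"
  using matrix_exp_nilpotent_add[where n="Suc r" and M="transpose B" and s="- s" and t="- t"] mpow_transpose_nilpotent
  by (simp add: E_mat_def)

lemma E_mat_0: "E_mat B 0 = mat 1"
  by (simp add: E_mat_sum lessThan_Suc_atMost sum.atMost_shift)

lemma E_mat_inverse: "E_mat B (- t) ** E_mat B t = mat 1" "E_mat B t ** E_mat B (- t) = mat 1"
  using E_mat_add[of "- t" t] E_mat_add[of t "- t"] by (simp_all add: E_mat_0)

lemma transpose_E_mat: "transpose (E_mat B t) = (\<Sum>k<Suc r. ((- t) ^ k / fact k) *\<^sub>R mpow B k)"
proof -
  have "linear (transpose :: real ^ 'n ^ 'n \<Rightarrow> real ^ 'n ^ 'n)"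
    by (rule linearI) (auto simp: transpose_def vec_eq_iff)
  then show ?thesis
    by (simp add: E_mat_sum linear_sum linear_cmul transpose_mpow del: sum.lessThan_Suc)
qed

lemma continuous_on_E_mat: "continuous_on S (E_mat B)"
  unfolding E_mat_sum[abs_def] by (intro continuous_intros) auto

lemma det_E_mat: "det (E_mat B t) = 1"
proof (rule det_unitriangular_graded)
  have ent: "E_mat B t $ a $ b = (\<Sum>k<Suc r. ((- t) ^ k / fact k) * mpow (transpose B) k $ a $ b)" for a b
    by (simp add: E_mat_sum del: sum.lessThan_Suc)
  fix a
  have "(\<Sum>k<Suc r. ((- t) ^ k / fact k) * mpow (transpose B) k $ a $ a)
      = (\<Sum>k<Suc r. if k = 0 then 1 else 0)"
  proof (rule sum.cong[OF refl])
    fix k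
    show "((- t) ^ k / fact k) * mpow (transpose B) k $ a $ a = (if k = 0 then 1 else 0)"
      using mpow_transpose_graded[of k a a] by (cases "k = 0") (auto simp: mat_def)
  qed
  then show "E_mat B t $ a $ a = 1" by (simp add: ent del: sum.lessThan_Suc)
  fix b assume "E_mat B t $ a $ b \<noteq> 0" "a \<noteq> b"
  from this(1) obtain k where "((- t) ^ k / fact k) * mpow (transpose B) k $ a $ b \<noteq> 0"
    unfolding ent by (rule sum.not_neutral_contains_not_neutral)
  then have "mpow (transpose B) k $ a $ b \<noteq> 0" by simp
  moreover from this \<open>a \<noteq> b\<close> have "k \<noteq> 0" by (auto simp: mat_def intro: gr0I)
  ultimately show "lev b < lev a" using mpow_transpose_graded[of k a b] by simp
qed

lemma continuous_on_conj_E_mat: "continuous_on S (\<lambda>s. E_mat B s ** A ** transpose (E_mat B s))"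
proof -
  have "bounded_linear (transpose :: real ^ 'n ^ 'n \<Rightarrow> real ^ 'n ^ 'n)"
    unfolding linear_conv_bounded_linear[symmetric]
    by (rule linearI) (auto simp: transpose_def vec_eq_iff)
  from bounded_linear.continuous_on[OF this continuous_on_E_mat] show ?thesis
    by (intro matrix_mult.continuous_on continuous_on_E_mat continuous_on_const)
qed

text \<open>
  Linear maps commute with the integral that defines \<open>C(t)\<close>. Symmetry, the quadratic form and the
  conjugation by \<open>E(-t)\<close> are all instances.
\<close>

lemma C_mat_linear_image:
  assumes "linear (h :: real ^ 'n ^ 'n \<Rightarrow> 'b::euclidean_space)"
  shows "h (C_mat A B t) = integral {0..t} (\<lambda>s. h (E_mat B s ** A ** transpose (E_mat B s)))"
proof -
  have "(\<lambda>s. E_mat B s ** A ** transpose (E_mat B s)) integrable_on {0..t}"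
    by (rule integrable_continuous_interval continuous_on_conj_E_mat)+
  moreover have "bounded_linear h" using assms by (simp add: linear_conv_bounded_linear)
  ultimately show ?thesis
    unfolding C_mat_def by (rule integral_linear[unfolded o_def, symmetric])
qed

lemma transpose_C_mat: "transpose A = A \<Longrightarrow> transpose (C_mat A B t) = C_mat A B t"
proof -
  assume A: "transpose A = A"
  have "transpose (C_mat A B t) = integral {0..t} (\<lambda>s. transpose (E_mat B s ** A ** transpose (E_mat B s)))"
    by (rule C_mat_linear_image, rule linearI) (auto simp: transpose_def vec_eq_iff)
  then show ?thesis by (simp add: C_mat_def matrix_transpose_mul matrix_mul_assoc A)
qed

lemma C_mat_quadratic:
  "(C_mat A B t *v u) \<bullet> u
     = integral {0..t} (\<lambda>s. (A *v (transpose (E_mat B s) *v u)) \<bullet> (transpose (E_mat B s) *v u))"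
proof -
  have "(C_mat A B t *v u) \<bullet> u = integral {0..t} (\<lambda>s. ((E_mat B s ** A ** transpose (E_mat B s)) *v u) \<bullet> u)"
    by (rule C_mat_linear_image[where h="\<lambda>X. (X *v u) \<bullet> u"], rule linearI)
       (auto simp: matrix_vector_mult_add_rdistrib inner_add_left scaleR_matrix_vector_assoc[symmetric])
  then show ?thesis
    by (simp add: matrix_vector_mul_assoc[symmetric] inner_matrix_vector_mult)
qed

lemma backward_covariance:
  "integral {0..t} (\<lambda>s. E_mat B (- (t - s)) ** A ** transpose (E_mat B (- (t - s))))
     = E_mat B (- t) ** C_mat A B t ** transpose (E_mat B (- t))"
proof -
  have "E_mat B (- t) ** C_mat A B t ** transpose (E_mat B (- t))
     = integral {0..t} (\<lambda>s. E_mat B (- t) ** (E_mat B s ** A ** transpose (E_mat B s)) ** transpose (E_mat B (- t)))"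
    by (rule C_mat_linear_image[where h="\<lambda>X. E_mat B (- t) ** X ** transpose (E_mat B (- t))"], rule linearI)
       (auto simp: matrix_add_ldistrib matrix_mult_add_left scaleR_matrix_mult)
  also have "(\<lambda>s. E_mat B (- t) ** (E_mat B s ** A ** transpose (E_mat B s)) ** transpose (E_mat B (- t)))
     = (\<lambda>s. E_mat B (- (t - s)) ** A ** transpose (E_mat B (- (t - s))))"
  proof
    fix s
    have "E_mat B (- (t - s)) = E_mat B (- t) ** E_mat B s"
      using E_mat_add[of "- t" s] by simp
    then show "E_mat B (- t) ** (E_mat B s ** A ** transpose (E_mat B s)) ** transpose (E_mat B (- t))
       = E_mat B (- (t - s)) ** A ** transpose (E_mat B (- (t - s)))"
      by (simp add: matrix_transpose_mul matrix_mul_assoc)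
  qed
  finally show ?thesis by simp
qed

text \<open>
  Hypoellipticity as observability. The quadratic form of \<open>C(t)\<close> is the integral of the quadratic form of
  \<open>A\<close> along \<open>y\<^sub>s = E(s)\<^sup>* v\<close>. If it vanishes, then the level-zero components of \<open>y\<^sub>s\<close>, polynomials in \<open>s\<close>
  with coefficients proportional to those of \<open>B\<^sup>k v\<close>, vanish on an interval.
\<close>

lemma C_mat_pos_def:
  assumes psd: "\<And>u. (A *v u) \<bullet> u \<ge> 0"
    and zero: "\<And>u a. (A *v u) \<bullet> u = 0 \<Longrightarrow> lev a = 0 \<Longrightarrow> u $ a = 0"
    and obs: "\<And>u. (\<And>k a. lev a = 0 \<Longrightarrow> (mpow B k *v u) $ a = 0) \<Longrightarrow> u = 0"
    and t: "t > 0" and v: "v \<noteq> 0"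
  shows "(C_mat A B t *v v) \<bullet> v > 0"
proof -
  let ?y = "\<lambda>s. transpose (E_mat B s) *v v"
  let ?q = "\<lambda>s. (A *v ?y s) \<bullet> ?y s"
  have y: "?y s = (\<Sum>k<Suc r. ((- s) ^ k / fact k) *\<^sub>R (mpow B k *v v))" for s
  proof -
    have "linear (\<lambda>X :: real ^ 'n ^ 'n. X *v v)"
      by (rule linearI) (auto simp: matrix_vector_mult_add_rdistrib scaleR_matrix_vector_assoc[symmetric])
    note lin = linear_sum[OF this] linear_cmul[OF this]
    show ?thesis unfolding transpose_E_mat lin ..
  qed
  have cy: "continuous_on S ?y" for S unfolding y by (intro continuous_intros) auto
  have cq: "continuous_on {0..t} ?q"
    by (rule continuous_on_inner[OF bounded_linear.continuous_on[OF matrix_vector_mul_bounded_linear cy] cy])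
  have "integral {0..t} ?q \<ge> 0"
    by (rule integral_nonneg[OF integrable_continuous_interval[OF cq]]) (use psd in auto)
  moreover have "integral {0..t} ?q \<noteq> 0"
  proof
    assume "integral {0..t} ?q = 0"
    then have q0: "?q s = 0" if "s \<in> {0..t}" for s
      using integral_eq_0_iff[OF cq t] psd that by auto
    have "v = 0"
    proof (rule obs)
      fix k a assume a: "lev a = 0"
      define c where "c k = ((- 1) ^ k / fact k) * (mpow B k *v v) $ a" for k
      have ya: "?y s $ a = (\<Sum>k\<le>r. c k * s ^ k)" for s
      proof -
        have "?y s $ a = (\<Sum>k<Suc r. ((- s) ^ k / fact k) * (mpow B k *v v) $ a)"
          unfolding y by (simp del: sum.lessThan_Suc)
        also have "\<dots> = (\<Sum>k<Suc r. c k * s ^ k)"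
          by (rule sum.cong) (auto simp: c_def power_minus[of s])
        finally show ?thesis by (simp only: lessThan_Suc_atMost)
      qed
      have "{0..t} \<subseteq> {s. (\<Sum>k\<le>r. c k * s ^ k) = 0}"
        using zero[OF q0 a] by (auto simp: ya[symmetric])
      then have "infinite {s. (\<Sum>k\<le>r. c k * s ^ k) = 0}"
        using t infinite_super infinite_Icc by blast
      then have c0: "c k = 0" if "k \<le> r" for k
        using polyfun_finite_roots[of c r] that by auto
      show "(mpow B k *v v) $ a = 0"
      proof (cases "k \<le> r")
        case True
        then show ?thesis using c0[OF True] by (simp add: c_def)
      next
        case False
        then have "transpose (mpow B k) = 0" using mpow_transpose_nilpotent[of k] by (simp add: transpose_mpow)
        then have "transpose (transpose (mpow B k)) = 0" by (simp add: transpose_def vec_eq_iff)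
        then have "mpow B k = 0" by simp
        then show ?thesis by simp
      qed
    qed
    with v show False by simp
  qed
  ultimately show ?thesis by (simp add: C_mat_quadratic)
qed

end

section \<open>The block structure\<close>

lemma (in vec_space) full_rank_injective:
  assumes A: "A \<in> carrier_mat n nc" and rk: "rank A = nc" and v: "v \<in> carrier_vec nc" and Av: "A *\<^sub>v v = 0\<^sub>v n"
  shows "v = 0\<^sub>v nc"
proof (rule ccontr)
  assume "v \<noteq> 0\<^sub>v nc"
  have len: "length (cols A) = nc" using A by auto
  obtain S where S: "maximal S (\<lambda>T. T \<subseteq> set (cols A) \<and> lin_indpt T)"
    using maximal_exists[of "(\<lambda>T. T \<subseteq> set (cols A) \<and> lin_indpt T)" "card (set (cols A))" "{}"]
    by (meson List.finite_set card_mono empty_iff empty_subsetI finite_lin_indpt2 rev_finite_subset)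
  then have "rank A = card S" using rank_card_indpt[OF A] by blast
  also have "card S \<le> card (set (cols A))" using S by (simp add: card_mono maximal_def)
  finally have "distinct (cols A)" using rk len card_length[of "cols A"] by (simp add: card_distinct)
  then show False
    using lin_depI[OF A v \<open>v \<noteq> 0\<^sub>v nc\<close> Av] full_rank_lin_indpt[OF A rk] by blast
qed

context
  fixes r :: nat and m :: "nat \<Rightarrow> nat" and \<iota> :: "'n::finite \<Rightarrow> nat \<times> nat"
  assumes bc: "block_coordinates r m \<iota>"
begin

definition coord :: "nat \<Rightarrow> nat \<Rightarrow> 'n" where
  "coord k i = the_inv_into UNIV \<iota> (k, i)"

lemma iota_coord: "k \<le> r \<Longrightarrow> i < m k \<Longrightarrow> \<iota> (coord k i) = (k, i)"
  using bc unfolding coord_def block_coordinates_def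
  by (intro f_the_inv_into_f_bij_betw[of \<iota> UNIV]) auto

lemma coord_iota: "coord (fst (\<iota> a)) (snd (\<iota> a)) = a"
  using bc unfolding coord_def block_coordinates_def
  by (simp add: the_inv_into_f_f bij_betw_def)

lemma iota_range: "fst (\<iota> a) \<le> r" "snd (\<iota> a) < m (fst (\<iota> a))"
proof -
  have "\<iota> a \<in> (SIGMA k:{0..r}. {0..<m k})"
    using bc by (auto simp: block_coordinates_def bij_betw_def)
  then show "fst (\<iota> a) \<le> r" "snd (\<iota> a) < m (fst (\<iota> a))" by auto
qed

lemma sum_block:
  fixes F :: "'n \<Rightarrow> real"
  assumes k: "k \<le> r"
  shows "(\<Sum>a\<in>UNIV. if fst (\<iota> a) = k then F a else 0) = (\<Sum>i\<in>{0..<m k}. F (coord k i))"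
proof -
  have "(\<Sum>a\<in>UNIV. if fst (\<iota> a) = k then F a else 0) = (\<Sum>a\<in>{a. fst (\<iota> a) = k}. F a)"
    by (simp add: sum.If_cases)
  also have "\<dots> = (\<Sum>i\<in>{0..<m k}. F (coord k i))"
  proof (rule sum.reindex_bij_witness[where i="coord k" and j="\<lambda>a. snd (\<iota> a)"])
    fix a assume "a \<in> {a. fst (\<iota> a) = k}"
    then show "coord k (snd (\<iota> a)) = a" "snd (\<iota> a) \<in> {0..<m k}" "F (coord k (snd (\<iota> a))) = F a"
      using coord_iota[of a] iota_range[of a] by auto
  qed (use iota_coord k in auto)
  finally show ?thesis .
qed

lemma drift_matrix_graded: "drift_matrix \<iota> Bk $ a $ b \<noteq> 0 \<Longrightarrow> fst (\<iota> b) = fst (\<iota> a) + 1"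
  by (auto simp: drift_matrix_def split: if_splits)

lemma graded_drift_drift_matrix: "graded_drift (drift_matrix \<iota> Bk) (\<lambda>a. fst (\<iota> a)) r"
  by unfold_locales (use drift_matrix_graded iota_range in auto)

lemma diffusion_matrix_symmetric:
  assumes "pos_def_mat (m 0) A0"
  shows "transpose (diffusion_matrix \<iota> A0) = diffusion_matrix \<iota> A0"
proof -
  have A0: "A0 \<in> carrier_mat (m 0) (m 0)" "transpose_mat A0 = A0"
    using assms by (auto simp: pos_def_mat_def)
  have "A0 $$ (i, j) = A0 $$ (j, i)" if "i < m 0" "j < m 0" for i j
    using A0 that by (metis index_transpose_mat(1) carrier_matD)
  then have "A0 $$ (snd (\<iota> a), snd (\<iota> b)) = A0 $$ (snd (\<iota> b), snd (\<iota> a))" if "fst (\<iota> a) = 0" "fst (\<iota> b) = 0" for a b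
    using iota_range(2)[of a] iota_range(2)[of b] that by simp
  then show ?thesis by (auto simp: transpose_def diffusion_matrix_def vec_eq_iff)
qed

lemma diffusion_matrix_quadratic:
  fixes u :: "real ^ 'n"
  assumes "A0 \<in> carrier_mat (m 0) (m 0)"
  shows "(diffusion_matrix \<iota> A0 *v u) \<bullet> u
    = scalar_prod (Matrix.vec (m 0) (\<lambda>i. u $ coord 0 i)) (A0 *\<^sub>v Matrix.vec (m 0) (\<lambda>i. u $ coord 0 i))"
proof -
  let ?w = "Matrix.vec (m 0) (\<lambda>i. u $ coord 0 i)"
  have inner: "(diffusion_matrix \<iota> A0 *v u) $ a = (if fst (\<iota> a) = 0 then \<Sum>l\<in>{0..<m 0}. A0 $$ (snd (\<iota> a), l) * u $ coord 0 l else 0)" for a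
  proof -
    have "(diffusion_matrix \<iota> A0 *v u) $ a
      = (if fst (\<iota> a) = 0 then (\<Sum>b\<in>UNIV. if fst (\<iota> b) = 0 then A0 $$ (snd (\<iota> a), snd (\<iota> b)) * u $ b else 0) else 0)"
      by (auto simp: matrix_vector_mult_def diffusion_matrix_def intro!: sum.cong)
    then show ?thesis by (subst (asm) sum_block) (auto simp: iota_coord intro!: sum.cong)
  qed
  have "(diffusion_matrix \<iota> A0 *v u) \<bullet> u
    = (\<Sum>a\<in>UNIV. if fst (\<iota> a) = 0 then u $ a * (\<Sum>l\<in>{0..<m 0}. A0 $$ (snd (\<iota> a), l) * u $ coord 0 l) else 0)"
    by (auto simp: inner_vec_def inner intro!: sum.cong)
  also have "\<dots> = (\<Sum>i\<in>{0..<m 0}. u $ coord 0 i * (\<Sum>l\<in>{0..<m 0}. A0 $$ (i, l) * u $ coord 0 l))"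
    by (subst sum_block) (auto simp: iota_coord intro!: sum.cong)
  also have "\<dots> = scalar_prod ?w (A0 *\<^sub>v ?w)"
    using assms by (auto simp: scalar_prod_def mult_mat_vec_def Matrix.row_def intro!: sum.cong)
  finally show ?thesis .
qed

lemma diffusion_matrix_nonneg:
  assumes "pos_def_mat (m 0) A0"
  shows "(diffusion_matrix \<iota> A0 *v u) \<bullet> u \<ge> 0"
    and "(diffusion_matrix \<iota> A0 *v u) \<bullet> u = 0 \<Longrightarrow> fst (\<iota> a) = 0 \<Longrightarrow> u $ a = 0"
proof -
  let ?w = "Matrix.vec (m 0) (\<lambda>i. u $ coord 0 i)"
  have A0: "A0 \<in> carrier_mat (m 0) (m 0)"
    and pd: "w \<in> carrier_vec (m 0) \<Longrightarrow> w \<noteq> 0\<^sub>v (m 0) \<Longrightarrow> scalar_prod w (A0 *\<^sub>v w) > 0" for w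
    using assms by (auto simp: pos_def_mat_def)
  have q: "(diffusion_matrix \<iota> A0 *v u) \<bullet> u = scalar_prod ?w (A0 *\<^sub>v ?w)"
    by (rule diffusion_matrix_quadratic[OF A0])
  have w: "?w \<in> carrier_vec (m 0)" by simp
  have z: "?w = 0\<^sub>v (m 0)" if "\<not> (diffusion_matrix \<iota> A0 *v u) \<bullet> u > 0"
    using pd[OF w] that unfolding q by blast
  have z2: "u $ a = 0" if "?w = 0\<^sub>v (m 0)" "fst (\<iota> a) = 0" for a
  proof -
    have "vec_index ?w (snd (\<iota> a)) = vec_index (0\<^sub>v (m 0)) (snd (\<iota> a))" using that by simp
    then have "u $ coord 0 (snd (\<iota> a)) = 0" using iota_range(2)[of a] that(2) by simp
    then show ?thesis using coord_iota[of a] that by simp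
  qed
  show "(diffusion_matrix \<iota> A0 *v u) \<bullet> u = 0 \<Longrightarrow> fst (\<iota> a) = 0 \<Longrightarrow> u $ a = 0"
    using z z2 by simp
  show "(diffusion_matrix \<iota> A0 *v u) \<bullet> u \<ge> 0"
  proof (rule ccontr)
    assume neg: "\<not> ?thesis"
    then have u0: "u $ a = 0" if "fst (\<iota> a) = 0" for a using z z2 that by simp
    have "(diffusion_matrix \<iota> A0 *v u) \<bullet> u = 0"
      by (auto simp: inner_vec_def diffusion_matrix_def matrix_vector_mult_def u0 intro!: sum.neutral)
    then show False using neg by simp
  qed
qed

text \<open>
  Induction on the block index: the hypothesis passes from \<open>u\<close> to \<open>B u\<close>, so block \<open>j\<close> of \<open>B u\<close> vanishes by
  induction. This block is \<open>B\<^sub>j\<^sub>+\<^sub>1\<close> applied to block \<open>j + 1\<close> of \<open>u\<close>, and \<open>B\<^sub>j\<^sub>+\<^sub>1\<close> is injective.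
\<close>

lemma drift_matrix_observable:
  assumes Bk: "\<forall>k\<in>{1..r}. Bk k \<in> carrier_mat (m (k - 1)) (m k) \<and> vec_space.rank (m (k - 1)) (Bk k) = m k"
    and u: "\<And>k a. fst (\<iota> a) = 0 \<Longrightarrow> (mpow (drift_matrix \<iota> Bk) k *v u) $ a = 0"
  shows "u = 0"
proof -
  let ?B = "drift_matrix \<iota> Bk"
  have comp: "(?B *v u) $ coord j i = vec_index (Bk (Suc j) *\<^sub>v Matrix.vec (m (Suc j)) (\<lambda>l. u $ coord (Suc j) l)) i"
    if j: "Suc j \<le> r" and i: "i < m j" for u :: "real ^ 'n" and j i
  proof -
    have B: "Bk (Suc j) \<in> carrier_mat (m j) (m (Suc j))" using bspec[OF Bk, of "Suc j"] j by simp
    have "(?B *v u) $ coord j i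
      = (\<Sum>b\<in>UNIV. if fst (\<iota> b) = Suc j then Bk (Suc j) $$ (i, snd (\<iota> b)) * u $ b else 0)"
      using iota_coord[of j i] i j by (auto simp: matrix_vector_mult_def drift_matrix_def intro!: sum.cong)
    also have "\<dots> = (\<Sum>l\<in>{0..<m (Suc j)}. Bk (Suc j) $$ (i, l) * u $ coord (Suc j) l)"
      by (subst sum_block[OF j]) (use iota_coord[OF j] in \<open>auto intro!: sum.cong\<close>)
    also have "\<dots> = vec_index (Bk (Suc j) *\<^sub>v Matrix.vec (m (Suc j)) (\<lambda>l. u $ coord (Suc j) l)) i"
      using B i by (auto simp: scalar_prod_def mult_mat_vec_def Matrix.row_def intro!: sum.cong)
    finally show ?thesis .
  qed
  have "u $ a = 0" if "fst (\<iota> a) = j" "j \<le> r" "\<And>k a. fst (\<iota> a) = 0 \<Longrightarrow> (mpow ?B k *v u) $ a = 0" for j a u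
    using that
  proof (induction j arbitrary: u a)
    case 0
    then show ?case using 0(3)[of a 0] by simp
  next
    case (Suc j)
    let ?w = "Matrix.vec (m (Suc j)) (\<lambda>l. u $ coord (Suc j) l)"
    have "(mpow ?B k *v (?B *v u)) $ a = 0" if "fst (\<iota> a) = 0" for k a
    proof -
      have "mpow ?B k ** ?B = mpow ?B (k + 1)" by (subst mpow_add) (simp add: mpow_Suc)
      then show ?thesis using Suc.prems(3)[OF that, of "k + 1"] by (simp add: matrix_vector_mul_assoc)
    qed
    then have z: "(?B *v u) $ a = 0" if "fst (\<iota> a) = j" for a
      using Suc.IH[OF that, of "?B *v u"] Suc.prems(2) by simp
    have B: "Bk (Suc j) \<in> carrier_mat (m j) (m (Suc j))" "vec_space.rank (m j) (Bk (Suc j)) = m (Suc j)"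
      using bspec[OF Bk, of "Suc j"] Suc.prems(2) by simp_all
    have "Bk (Suc j) *\<^sub>v ?w = 0\<^sub>v (m j)"
    proof (rule eq_vecI)
      fix i assume "i < dim_vec (0\<^sub>v (m j))"
      then have i: "i < m j" by simp
      then show "vec_index (Bk (Suc j) *\<^sub>v ?w) i = vec_index (0\<^sub>v (m j)) i"
        using comp[OF Suc.prems(2) i, of u] z[of "coord j i"] iota_coord[of j i] Suc.prems(2) by simp
    qed (use B in auto)
    then have "?w = 0\<^sub>v (m (Suc j))"
      by (intro vec_space.full_rank_injective[OF B]) auto
    then have "vec_index ?w (snd (\<iota> a)) = vec_index (0\<^sub>v (m (Suc j))) (snd (\<iota> a))" by simp
    then show ?case using iota_range(2)[of a] coord_iota[of a] Suc.prems(1) by simp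
  qed
  then have "u $ a = 0" for a using iota_range(1)[of a] u by blast
  then show ?thesis by (simp add: vec_eq_iff)
qed

lemma C_mat_pos_def_of_full_rank_blocks:
  assumes "pos_def_mat (m 0) A0"
    and "\<forall>k\<in>{1..r}. Bk k \<in> carrier_mat (m (k - 1)) (m k) \<and> vec_space.rank (m (k - 1)) (Bk k) = m k"
    and "t > 0" "v \<noteq> 0"
  shows "(C_mat (diffusion_matrix \<iota> A0) (drift_matrix \<iota> Bk) t *v v) \<bullet> v > 0"
proof -
  interpret graded_drift "drift_matrix \<iota> Bk" "\<lambda>a. fst (\<iota> a)" r by (rule graded_drift_drift_matrix)
  show ?thesis
    by (rule C_mat_pos_def[OF diffusion_matrix_nonneg[OF assms(1)] drift_matrix_observable[OF assms(2)] assms(3,4)])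
qed

end

section \<open>Reduction to the Gaussian measure\<close>

lemma matrix_inv_mult:
  fixes C :: "real ^ 'n ^ 'n"
  assumes "invertible C"
  shows "C ** matrix_inv C = mat 1" "matrix_inv C ** C = mat 1"
  using someI_ex[of "\<lambda>A'. C ** A' = mat 1 \<and> A' ** C = mat 1"] assms
  by (auto simp: invertible_def matrix_inv_def)

text \<open>
  In the coordinates \<open>z\<close> the quadratic form of \<open>C(t)\<^sup>-\<^sup>1\<close> becomes \<open>|z|\<^sup>2\<close>, and the Jacobian cancels the
  normalising factor \<open>sqrt (det C(t)) = |det S|\<close>.
\<close>

lemma kernel_p_factorized:
  fixes A B S :: "real ^ 'n ^ 'n"
  assumes S: "invertible S" and C: "C_mat A B t = S ** transpose S"
  shows "\<bar>det S\<bar> * kernel_p A B (- (S *v z)) t = gaussian_density z"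
proof -
  let ?C = "C_mat A B t"
  have dS: "det S \<noteq> 0" using S by (simp add: invertible_det_nz)
  have detC: "det ?C = (det S)\<^sup>2" by (simp add: C det_mul power2_eq_square)
  then have "invertible ?C" using dS by (simp add: invertible_det_nz)
  then have inv: "?C ** matrix_inv ?C = mat 1" by (rule matrix_inv_mult)
  obtain R where R: "R ** S = mat 1" using S by (auto simp: invertible_def)
  define w where "w = matrix_inv ?C *v (- (S *v z))"
  have "?C *v (matrix_inv ?C *v u) = u" for u by (simp add: matrix_vector_mul_assoc inv)
  then have "?C *v w = - (S *v z)" by (simp only: w_def)
  then have "S *v (transpose S *v w) = - (S *v z)" by (simp only: C matrix_vector_mul_assoc)
  then have "S *v (transpose S *v w) = S *v (- z)"
    by (simp only: linear_neg[OF matrix_vector_mul_linear])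
  then have "(R ** S) *v (transpose S *v w) = (R ** S) *v (- z)"
    by (simp only: matrix_vector_mul_assoc[symmetric])
  then have Sw: "transpose S *v w = - z" by (simp only: R matrix_vector_mul_lid)
  have "w \<bullet> (- (S *v z)) = - ((S *v z) \<bullet> w)" by (simp add: inner_commute)
  also have "\<dots> = z \<bullet> z" by (simp only: inner_matrix_vector_mult Sw inner_minus_right minus_minus)
  finally have q: "(matrix_inv ?C *v (- (S *v z))) \<bullet> (- (S *v z)) = z \<bullet> z" by (simp only: w_def)
  have "\<bar>det S\<bar> * kernel_p A B (- (S *v z)) t
    = \<bar>det S\<bar> * ((2 * pi) powr (- real CARD('n) / 2) / \<bar>det S\<bar> * exp (- (1 / 2) * (z \<bullet> z)))"
    unfolding kernel_p_def q detC by simp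
  also have "\<dots> = gaussian_density z" using dS by (simp add: gaussian_density_def)
  finally show ?thesis .
qed

text \<open>
  Any factor \<open>S\<close> of \<open>C(t)\<close> serves; the time is fixed because \<open>S\<close> depends on it.
\<close>

locale hypoelliptic_gaussian = graded_drift B lev r for B :: "real ^ 'n ^ 'n" and lev r +
  fixes A :: "real ^ 'n ^ 'n" and t :: real and S :: "real ^ 'n ^ 'n"
  assumes S: "invertible S" and C: "C_mat A B t = S ** transpose S" and t: "t \<noteq> 0"
begin

definition T :: "real ^ 'n ^ 'n" where "T = E_mat B (- t) ** S"

lemma det_T: "det T = det S" "det T \<noteq> 0"
  using S by (simp_all add: T_def det_mul det_E_mat invertible_det_nz)

lemma borel_measurable_kernel [measurable]: "(\<lambda>y. kernel_p A B (x - E_mat B t *v y) t) \<in> borel_measurable borel"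
  unfolding kernel_p_def by measurable

lemma kernel_nonneg: "kernel_p A B x t \<ge> 0"
  unfolding kernel_p_def using det_mul[of S "transpose S"] by (simp add: C)

text \<open>
  The substitution \<open>y = E(-t) x + T z\<close> has the Jacobian \<open>|det S|\<close> because \<open>det E(-t) = 1\<close>. Hence \<open>P\<^sub>t f(x)\<close>
  averages \<open>f\<close> over the Gaussian measure with mean \<open>E(-t) x\<close> and covariance \<open>T T\<^sup>*\<close>.
\<close>

lemma density_kernel:
  "density lborel (\<lambda>y. ennreal (kernel_p A B (x - E_mat B t *v y) t))
     = distr std_gaussian borel (\<lambda>z. E_mat B (- t) *v x + T *v z)"
proof (rule measure_eqI)
  let ?a = "E_mat B (- t) *v x"
  let ?k = "\<lambda>y. ennreal (kernel_p A B (x - E_mat B t *v y) t)"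
  fix Y assume "Y \<in> sets (density lborel ?k)"
  then have Y[measurable]: "Y \<in> sets borel" by simp
  have arg: "x - E_mat B t *v (?a + T *v z) = - (S *v z)" for z
    by (simp add: T_def matrix_vector_right_distrib matrix_vector_mul_assoc matrix_mul_assoc E_mat_inverse)
  have "emeasure (density lborel ?k) Y = (\<integral>\<^sup>+y. ?k y * indicator Y y \<partial>lborel)"
    by (simp add: emeasure_density)
  also have "\<dots> = (\<integral>\<^sup>+y. ?k (?a + y) * indicator Y (?a + y) \<partial>lborel)"
    using nn_integral_lborel_affine[of "\<lambda>y. ?k y * indicator Y y" 1 ?a] by simp
  also have "\<dots> = ennreal \<bar>det T\<bar> * (\<integral>\<^sup>+z. ?k (?a + T *v z) * indicator Y (?a + T *v z) \<partial>lborel)"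
    using nn_integral_lborel_linear[OF det_T(2), of "\<lambda>y. ?k (?a + y) * indicator Y (?a + y)"] by simp
  also have "\<dots> = (\<integral>\<^sup>+z. ennreal \<bar>det T\<bar> * (?k (?a + T *v z) * indicator Y (?a + T *v z)) \<partial>lborel)"
    by (subst nn_integral_cmult) auto
  also have "\<dots> = (\<integral>\<^sup>+z. ennreal (gaussian_density z) * indicator Y (?a + T *v z) \<partial>lborel)"
  proof (rule nn_integral_cong)
    fix z
    have "ennreal \<bar>det T\<bar> * ?k (?a + T *v z) = ennreal (gaussian_density z)"
      unfolding arg det_T using kernel_p_factorized[OF S C, of z] by (simp add: ennreal_mult'[symmetric])
    then show "ennreal \<bar>det T\<bar> * (?k (?a + T *v z) * indicator Y (?a + T *v z))
      = ennreal (gaussian_density z) * indicator Y (?a + T *v z)"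
      by (simp only: mult.assoc[symmetric])
  qed
  also have "\<dots> = (\<integral>\<^sup>+z. indicator Y (?a + T *v z) \<partial>std_gaussian)"
    by (subst nn_integral_std_gaussian) auto
  also have "\<dots> = (\<integral>\<^sup>+y. indicator Y y \<partial>(distr std_gaussian borel (\<lambda>z. ?a + T *v z)))"
    by (subst nn_integral_distr) auto
  also have "\<dots> = emeasure (distr std_gaussian borel (\<lambda>z. ?a + T *v z)) Y" by simp
  finally show "emeasure (density lborel ?k) Y = emeasure (distr std_gaussian borel (\<lambda>z. ?a + T *v z)) Y" .
qed simp

lemma semigroup_P_eq:
  assumes [measurable]: "f \<in> borel_measurable borel"
  shows "semigroup_P A B t f x = (\<integral>z. f (E_mat B (- t) *v x + T *v z) \<partial>std_gaussian)"
proof -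
  have "semigroup_P A B t f x = (\<integral>y. f y \<partial>(density lborel (\<lambda>y. ennreal (kernel_p A B (x - E_mat B t *v y) t))))"
    using t by (subst integral_density) (auto simp: semigroup_P_def kernel_nonneg)
  also have "\<dots> = (\<integral>z. f (E_mat B (- t) *v x + T *v z) \<partial>std_gaussian)"
    unfolding density_kernel by (subst integral_distr) auto
  finally show ?thesis .
qed

lemma semigroup_P_nn_eq:
  assumes [measurable]: "f \<in> borel_measurable borel"
  shows "semigroup_P_nn A B t f x = (\<integral>\<^sup>+z. f (E_mat B (- t) *v x + T *v z) \<partial>std_gaussian)"
proof -
  have "semigroup_P_nn A B t f x = (\<integral>\<^sup>+y. f y \<partial>(density lborel (\<lambda>y. ennreal (kernel_p A B (x - E_mat B t *v y) t))))"
    using t by (subst nn_integral_density) (auto simp: semigroup_P_nn_def)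
  also have "\<dots> = (\<integral>\<^sup>+z. f (E_mat B (- t) *v x + T *v z) \<partial>std_gaussian)"
    unfolding density_kernel by (subst nn_integral_distr) auto
  finally show ?thesis .
qed

lemma T_covariance:
  "integral {0..t} (\<lambda>s. E_mat B (- (t - s)) ** A ** transpose (E_mat B (- (t - s)))) = T ** transpose T"
  unfolding backward_covariance by (simp add: C T_def matrix_transpose_mul matrix_mul_assoc)

end

lemma GDERIV_affine:
  fixes f :: "real ^ 'n \<Rightarrow> real" and T :: "real ^ 'n ^ 'n"
  assumes "GDERIV f (a + T *v z) :> D"
  shows "GDERIV (\<lambda>z. f (a + T *v z)) z :> transpose T *v D"
proof -
  have "((\<lambda>z. a + T *v z) has_derivative (\<lambda>h. T *v h)) (at z)"
    by (auto intro!: derivative_eq_intros bounded_linear.has_derivative[OF matrix_vector_mul_bounded_linear])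
  from has_derivative_compose[OF this assms[unfolded gderiv_def]]
  show ?thesis by (simp add: gderiv_def inner_matrix_vector_mult)
qed

lemma GDERIV_ln:
  assumes "GDERIV f x :> D" "f x > 0"
  shows "GDERIV (\<lambda>y. ln (f y)) x :> (1 / f x) *\<^sub>R D"
  using GDERIV_DERIV_compose[OF assms(1) DERIV_ln_divide[OF assms(2)]] .

lemma C2_gradient:
  fixes f :: "'a::euclidean_space \<Rightarrow> real"
  assumes "C2 f"
  obtains v where "\<And>y. GDERIV f y :> v y" "continuous_on UNIV v"
proof -
  obtain f' :: "'a \<Rightarrow> 'a \<Rightarrow>\<^sub>L real" and f'' where f': "\<And>x. (f has_derivative blinfun_apply (f' x)) (at x)"
    and f'': "\<And>x. (f' has_derivative blinfun_apply (f'' x)) (at x)"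
    using assms by (auto simp: C2_def)
  define v where "v y = (\<Sum>b\<in>Basis. blinfun_apply (f' y) b *\<^sub>R b)" for y
  have "blinfun_apply (f' y) h = h \<bullet> v y" for y h
  proof -
    have "blinfun_apply (f' y) h = blinfun_apply (f' y) (\<Sum>b\<in>Basis. (h \<bullet> b) *\<^sub>R b)" by (simp add: euclidean_representation)
    then show ?thesis by (simp add: v_def blinfun.sum_right blinfun.scaleR_right inner_sum_right mult.commute)
  qed
  then have "blinfun_apply (f' y) = (\<lambda>h. h \<bullet> v y)" for y by (rule ext)
  then have "GDERIV f y :> v y" for y
    using f'[of y] by (simp add: gderiv_def)
  moreover have "continuous_on UNIV f'"
    using f'' has_derivative_continuous by (blast intro: continuous_at_imp_continuous_on)
  then have "continuous_on UNIV v" unfolding v_def by (intro continuous_intros)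
  ultimately show ?thesis by (rule that)
qed

text \<open>
  The Gaussian inequality for \<open>g(z) = f(E(-t) x + T z)\<close>, whose gradient is \<open>T\<^sup>* \<nabla>f\<close>.
\<close>

lemma hypoelliptic_log_sobolev:
  fixes f :: "real ^ 'n \<Rightarrow> real"
  assumes h: "hypoelliptic_gaussian B lev r A t S"
    and f: "C2 f" "\<And>y. f y > 0" "L-lipschitz_on UNIV f" "bounded (range f)"
  shows "ennreal (semigroup_P A B t (\<lambda>y. f y * ln (f y)) x - semigroup_P A B t f x * ln (semigroup_P A B t f x))
        \<le> ennreal (1 / 2) * semigroup_P_nn A B t
             (\<lambda>y. ennreal (f y *
                ((integral {0..t} (\<lambda>s. E_mat B (- (t - s)) ** A ** transpose (E_mat B (- (t - s))))
                  *v grad (\<lambda>z. ln (f z)) y) \<bullet> grad (\<lambda>z. ln (f z)) y))) x"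
proof -
  interpret hypoelliptic_gaussian B lev r A t S by (rule h)
  obtain v where v: "\<And>y. GDERIV f y :> v y" and cv: "continuous_on UNIV v" by (rule C2_gradient[OF f(1)]) blast
  obtain M where M: "\<And>y. f y \<le> M"
    using f(4) by (auto simp: bounded_iff intro: order_trans[OF abs_ge_self])
  have cf: "continuous_on UNIV f" using f(3) by (rule lipschitz_on_continuous_on)
  have mf [measurable]: "f \<in> borel_measurable borel" using cf by (rule borel_measurable_continuous_onI)
  have mv [measurable]: "v \<in> borel_measurable borel" using cv by (rule borel_measurable_continuous_onI)
  let ?a = "E_mat B (- t) *v x"
  define g where "g z = f (?a + T *v z)" for z
  define w where "w z = transpose T *v v (?a + T *v z)" for z
  have gw: "GDERIV g z :> w z" for z
    unfolding g_def w_def by (rule GDERIV_affine[OF v])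
  have cw: "continuous_on UNIV w"
    unfolding w_def
    by (intro bounded_linear.continuous_on[OF matrix_vector_mul_bounded_linear]
        continuous_on_compose2[OF cv] continuous_intros) auto
  obtain K where K: "\<And>z. norm (T *v z) \<le> norm z * K" "K > 0"
    using bounded_linear.pos_bounded[OF matrix_vector_mul_bounded_linear[of T]] by blast
  have lg: "(L * K)-lipschitz_on UNIV g"
  proof (rule lipschitz_onI)
    show "0 \<le> L * K" using K lipschitz_on_nonneg[OF f(3)] by simp
    fix y z
    have "dist (g y) (g z) \<le> L * dist (?a + T *v y) (?a + T *v z)"
      unfolding g_def by (rule lipschitz_onD[OF f(3)]) auto
    also have "dist (?a + T *v y) (?a + T *v z) = norm (T *v (y - z))"
      by (simp add: dist_norm matrix_vector_mult_diff_distrib)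
    also have "L * norm (T *v (y - z)) \<le> L * (norm (y - z) * K)"
      using lipschitz_on_nonneg[OF f(3)] K(1) by (intro mult_left_mono)
    finally show "dist (g y) (g z) \<le> L * K * dist y z" by (simp add: dist_norm mult_ac)
  qed
  have quad: "((T ** transpose T) *v u) \<bullet> u = (transpose T *v u) \<bullet> (transpose T *v u)" for u
    by (simp only: matrix_vector_mul_assoc[symmetric] inner_matrix_vector_mult[of T])
  from gaussian_log_sobolev[OF gw cw lg, of M 0]
  have "ennreal (entropy 1 g 0) \<le> ennreal (1 / 2) * (\<integral>\<^sup>+z. ennreal (fisher g w z) \<partial>std_gaussian)"
    using f(2) M by (simp add: g_def)
  also have "entropy 1 g 0 = semigroup_P A B t (\<lambda>y. f y * ln (f y)) x - semigroup_P A B t f x * ln (semigroup_P A B t f x)"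
    by (simp add: entropy_def heat_def g_def semigroup_P_eq)
  also have "(\<integral>\<^sup>+z. ennreal (fisher g w z) \<partial>std_gaussian)
     = semigroup_P_nn A B t (\<lambda>y. ennreal (((T ** transpose T) *v v y) \<bullet> v y / f y)) x"
    by (subst semigroup_P_nn_eq) (measurable, simp only: fisher_def g_def w_def quad)
  also have "(\<lambda>y. ennreal (((T ** transpose T) *v v y) \<bullet> v y / f y))
     = (\<lambda>y. ennreal (f y *
                ((integral {0..t} (\<lambda>s. E_mat B (- (t - s)) ** A ** transpose (E_mat B (- (t - s))))
                  *v grad (\<lambda>z. ln (f z)) y) \<bullet> grad (\<lambda>z. ln (f z)) y)))"
  proof
    fix y
    have "grad (\<lambda>z. ln (f z)) y = (1 / f y) *\<^sub>R v y"
      by (rule grad_eq[OF GDERIV_ln[OF v f(2)]])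
    then show "ennreal (((T ** transpose T) *v v y) \<bullet> v y / f y) = ennreal (f y *
                ((integral {0..t} (\<lambda>s. E_mat B (- (t - s)) ** A ** transpose (E_mat B (- (t - s))))
                  *v grad (\<lambda>z. ln (f z)) y) \<bullet> grad (\<lambda>z. ln (f z)) y))"
      using f(2)[of y] unfolding T_covariance by (simp add: linear_cmul[OF matrix_vector_mul_linear])
  qed
  finally show ?thesis .
qed

text \<open>
  Here \<open>P\<^sub>t f(y) = P k(S\<^sup>-\<^sup>1 y)\<close> with \<open>k(z) = f(T z)\<close> and \<open>P\<close> the heat flow at time one. The inner product
  with \<open>C(t) = S S\<^sup>*\<close> undoes the factor \<open>S\<^sup>-\<^sup>1\<close> in the gradient, which leaves the Euclidean norm of the
  gradient of \<open>P k\<close>.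
\<close>

lemma hypoelliptic_reverse_log_sobolev:
  fixes f :: "real ^ 'n \<Rightarrow> real"
  assumes h: "hypoelliptic_gaussian B lev r A t S"
    and mf [measurable]: "f \<in> borel_measurable borel" and f: "\<And>y. f y > 0" "bounded (range f)"
  shows "semigroup_P A B t (\<lambda>y. f y * ln (f y)) x - semigroup_P A B t f x * ln (semigroup_P A B t f x)
        \<ge> 1 / 2 * semigroup_P A B t f x *
             ((C_mat A B t *v grad (\<lambda>z. ln (semigroup_P A B t f z)) x)
               \<bullet> grad (\<lambda>z. ln (semigroup_P A B t f z)) x)"
proof -
  interpret hypoelliptic_gaussian B lev r A t S by (rule h)
  obtain M where M: "\<And>y. f y \<le> M"
    using f(2) by (auto simp: bounded_iff intro: order_trans[OF abs_ge_self])
  obtain R where R: "S ** R = mat 1" "R ** S = mat 1" using S by (auto simp: invertible_def)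
  define k where "k z = f (T *v z)" for z
  have mk [measurable]: "k \<in> borel_measurable borel" unfolding k_def by measurable
  have k: "k z > 0" "k z \<le> M" for z using f M by (auto simp: k_def)
  have kn: "norm (k z) \<le> M" for z using k[of z] by simp
  have P: "semigroup_P A B t (\<lambda>y. F (f y)) y = heat 1 (\<lambda>z. F (k z)) (R *v y)" if [measurable]: "F \<in> borel_measurable borel" for F y
  proof -
    have "E_mat B (- t) *v y + T *v z = T *v (R *v y + z)" for z
      by (simp add: T_def matrix_vector_right_distrib matrix_vector_mul_assoc matrix_mul_assoc[symmetric] R)
    then show ?thesis by (simp add: semigroup_P_eq heat_def k_def)
  qed
  have Pf: "semigroup_P A B t f = (\<lambda>y. heat 1 k (0 + R *v y))"
    using P[of "\<lambda>u. u"] by (simp add: fun_eq_iff)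
  let ?H = "heat 1 k (R *v x)" and ?w = "heat_grad 1 k (R *v x)"
  have H: "?H > 0" by (rule heat_pos[OF mk k])
  obtain K where "quadratic_approx (heat 1 k) (heat_grad 1 k) K"
    using heat_quadratic_approx[OF mk kn, of 1] by auto
  then have "GDERIV (heat 1 k) (0 + R *v x) :> ?w" using quadratic_approx_GDERIV by simp
  then have "GDERIV (semigroup_P A B t f) x :> transpose R *v ?w"
    unfolding Pf by (rule GDERIV_affine)
  then have gr: "grad (\<lambda>z. ln (semigroup_P A B t f z)) x = (1 / ?H) *\<^sub>R (transpose R *v ?w)"
    using H by (intro grad_eq) (use GDERIV_ln[of "semigroup_P A B t f" x] in \<open>simp add: Pf\<close>)
  have "transpose S ** transpose R = mat 1"
    using R(2) by (metis matrix_transpose_mul transpose_mat)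
  then have SR: "transpose S *v (transpose R *v ?w) = ?w"
    by (simp only: matrix_vector_mul_assoc matrix_vector_mul_lid)
  have "(C_mat A B t *v (transpose R *v ?w)) \<bullet> (transpose R *v ?w) = ?w \<bullet> ?w"
    unfolding C matrix_vector_mul_assoc[symmetric] inner_matrix_vector_mult SR ..
  then have "1 / 2 * semigroup_P A B t f x *
             ((C_mat A B t *v grad (\<lambda>z. ln (semigroup_P A B t f z)) x)
               \<bullet> grad (\<lambda>z. ln (semigroup_P A B t f z)) x) = ?w \<bullet> ?w / (2 * ?H)"
    unfolding gr using H by (simp add: Pf linear_cmul[OF matrix_vector_mul_linear])
  also have "\<dots> \<le> entropy 1 k (R *v x)" by (rule gaussian_reverse_log_sobolev[OF mk k])
  also have "\<dots> = semigroup_P A B t (\<lambda>y. f y * ln (f y)) x - semigroup_P A B t f x * ln (semigroup_P A B t f x)"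
    using P[of "\<lambda>u. u * ln u" x] by (simp add: entropy_def Pf)
  finally show ?thesis .
qed

theorem theorem3p2:
  fixes r :: nat and m :: "nat \<Rightarrow> nat"
    and A0 :: "real mat" and Bk :: "nat \<Rightarrow> real mat"
    and \<iota> :: "'n::finite \<Rightarrow> nat \<times> nat"
    and A B :: "real ^ 'n ^ 'n"
  assumes "r \<ge> 1"
    and "\<forall>k \<in> {1..r}. m k \<le> m (k - 1)"
    and "m r \<ge> 1"
    and "pos_def_mat (m 0) A0"
    and "\<forall>k \<in> {1..r}. Bk k \<in> carrier_mat (m (k - 1)) (m k) \<and>
           vec_space.rank (m (k - 1)) (Bk k) = m k"
    and "block_coordinates r m \<iota>"
    and "A = diffusion_matrix \<iota> A0"
    and "B = drift_matrix \<iota> Bk"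
  shows
    "(\<forall>(f :: real ^ 'n \<Rightarrow> real) t x.
        C2 f \<and> (\<forall>y. f y > 0) \<and> (\<exists>L. L-lipschitz_on UNIV f) \<and> bounded (range f) \<and> t \<ge> 0 \<longrightarrow>
        ennreal (semigroup_P A B t (\<lambda>y. f y * ln (f y)) x
                 - semigroup_P A B t f x * ln (semigroup_P A B t f x))
        \<le> ennreal (1 / 2) * semigroup_P_nn A B t
             (\<lambda>y. ennreal (f y *
                ((integral {0..t} (\<lambda>s. E_mat B (- (t - s)) ** A ** transpose (E_mat B (- (t - s))))
                  *v grad (\<lambda>z. ln (f z)) y) \<bullet> grad (\<lambda>z. ln (f z)) y))) x)
     \<and>
     (\<forall>(f :: real ^ 'n \<Rightarrow> real) t x.
        f \<in> borel_measurable borel \<and> (\<forall>y. f y > 0) \<and> bounded (range f) \<and> t > 0 \<longrightarrow>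
        semigroup_P A B t (\<lambda>y. f y * ln (f y)) x
          - semigroup_P A B t f x * ln (semigroup_P A B t f x)
        \<ge> 1 / 2 * semigroup_P A B t f x *
             ((C_mat A B t *v grad (\<lambda>z. ln (semigroup_P A B t f z)) x)
               \<bullet> grad (\<lambda>z. ln (semigroup_P A B t f z)) x))"
proof -
  have gd: "graded_drift B (\<lambda>a. fst (\<iota> a)) r"
    unfolding assms(8) by (rule graded_drift_drift_matrix[OF assms(6)])
  have hyp: "\<exists>S. hypoelliptic_gaussian B (\<lambda>a. fst (\<iota> a)) r A t S" if t: "t > 0" for t
  proof -
    interpret graded_drift B "\<lambda>a. fst (\<iota> a)" r by (rule gd)
    have "transpose (C_mat A B t) = C_mat A B t"
      unfolding assms(7) by (rule transpose_C_mat[OF diffusion_matrix_symmetric[OF assms(6,4)]])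
    moreover have "(C_mat A B t *v v) \<bullet> v > 0" if "v \<noteq> 0" for v
      unfolding assms(7,8) by (rule C_mat_pos_def_of_full_rank_blocks[OF assms(6,4,5) t that])
    ultimately obtain S :: "real ^ 'n ^ 'n" where "invertible S" "C_mat A B t = S ** transpose S"
      using pos_def_factorization[of "C_mat A B t"] by blast
    then have "hypoelliptic_gaussian B (\<lambda>a. fst (\<iota> a)) r A t S"
      using t by unfold_locales auto
    then show ?thesis ..
  qed
  show ?thesis
  proof (intro conjI allI impI)
    fix f :: "real ^ 'n \<Rightarrow> real" and t :: real and x :: "real ^ 'n"
    assume f: "C2 f \<and> (\<forall>y. f y > 0) \<and> (\<exists>L. L-lipschitz_on UNIV f) \<and> bounded (range f) \<and> t \<ge> 0"
    then obtain L where L: "L-lipschitz_on UNIV f" by blast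
    show "ennreal (semigroup_P A B t (\<lambda>y. f y * ln (f y)) x
                 - semigroup_P A B t f x * ln (semigroup_P A B t f x))
        \<le> ennreal (1 / 2) * semigroup_P_nn A B t
             (\<lambda>y. ennreal (f y *
                ((integral {0..t} (\<lambda>s. E_mat B (- (t - s)) ** A ** transpose (E_mat B (- (t - s))))
                  *v grad (\<lambda>z. ln (f z)) y) \<bullet> grad (\<lambda>z. ln (f z)) y))) x"
    proof (cases "t = 0")
      case True
      then show ?thesis by (simp add: semigroup_P_def)
    next
      case False
      with f obtain S where "hypoelliptic_gaussian B (\<lambda>a. fst (\<iota> a)) r A t S" using hyp[of t] by auto
      then show ?thesis by (rule hypoelliptic_log_sobolev) (use f L in auto)
    qed
  next
    fix f :: "real ^ 'n \<Rightarrow> real" and t :: real and x :: "real ^ 'n"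
    assume f: "f \<in> borel_measurable borel \<and> (\<forall>y. f y > 0) \<and> bounded (range f) \<and> t > 0"
    then obtain S where "hypoelliptic_gaussian B (\<lambda>a. fst (\<iota> a)) r A t S" using hyp[of t] by auto
    then show "semigroup_P A B t (\<lambda>y. f y * ln (f y)) x
          - semigroup_P A B t f x * ln (semigroup_P A B t f x)
        \<ge> 1 / 2 * semigroup_P A B t f x *
             ((C_mat A B t *v grad (\<lambda>z. ln (semigroup_P A B t f z)) x)
               \<bullet> grad (\<lambda>z. ln (semigroup_P A B t f z)) x)"
      by (rule hypoelliptic_reverse_log_sobolev) (use f in auto)
  qed
qed

end
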